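(* The exponent $2$ on $a_2(\Omega)$ in the inequality $$\mu_1(\Omega)\le\frac{4j_{0,1}^2}{D_\Omega^2}-C\,\frac{a_2(\Omega)^2}{D_\Omega^4}\qquad(\Omega\subset\mathbb{R}^2\text{ open, bounded, convex})$$ is sharp, in the following sense: for every real $\alpha$ with $0<\alpha<2$ and every constant $C>0$ there exists a nonempty open, bounded and convex set $\Omega\subset\mathbb{R}^2$ such that $$\mu_1(\Omega)>\frac{4j_{0,1}^2}{D_\Omega^2}-C\,\frac{a_2(\Omega)^{\alpha}}{D_\Omega^{2+\alpha}}.$$
   Context: For a nonempty open, bounded, convex set $\Omega\subset\mathbb{R}^2$, $\mu_1(\Omega)$ is the first nonzero eigenvalue of the Neumann Laplacian on $\Omega$: $$\mu_1(\Omega)=\min\left\{\frac{\int_\Omega|\nabla u|^2\,dx}{\int_\Omega u^2\,dx}: u\in H^1(\Omega)\setminus\{0\},\ \int_\Omega u\,dx=0\right\}.$$ $D_\Omega$ is the diameter of $\Omega$, and $a_2(\Omega)$ is the second largest (i.e. in dimension two the smaller) semiaxis of the John ellipsoid of $\Omega$, the ellipse of maximal area contained in $\Omega$. $j_{0,1}$ is the first positive zero of the Bessel function $J_0$. The number $4j_{0,1}^2$ is the sharp upper bound $\mu_{1,2}^*$ of $D_\Omega^2\mu_1(\Omega)$ among planar open bounded convex sets. *)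

theory Defs
  imports "HOL-Analysis.Analysis"
begin

subsection \<open>The Sobolev space \<open>H\<^sup>1\<close>\<close>

primrec Ck :: "nat \<Rightarrow> ('a::euclidean_space \<Rightarrow> real) \<Rightarrow> bool" where
  "Ck 0 f \<longleftrightarrow> continuous_on UNIV f"
| "Ck (Suc k) f \<longleftrightarrow>
     (\<forall>x. f differentiable at x) \<and> (\<forall>i\<in>Basis. Ck k (\<lambda>x. frechet_derivative f (at x) i))"

definition test_function :: "'a::euclidean_space set \<Rightarrow> ('a \<Rightarrow> real) \<Rightarrow> bool" where
  "test_function \<Omega> \<phi> \<longleftrightarrow>
     (\<forall>k. Ck k \<phi>) \<and> compact (closure {x. \<phi> x \<noteq> 0}) \<and> closure {x. \<phi> x \<noteq> 0} \<subseteq> \<Omega>"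

definition L2_on :: "'a::euclidean_space set \<Rightarrow> ('a \<Rightarrow> 'b::euclidean_space) \<Rightarrow> bool" where
  "L2_on \<Omega> f \<longleftrightarrow>
     f \<in> borel_measurable (lebesgue_on \<Omega>) \<and> integrable (lebesgue_on \<Omega>) (\<lambda>x. (norm (f x))\<^sup>2)"

text \<open>Elements of \<open>L\<^sup>2\<close> are represented by functions, so a weak gradient is determined only up to a
  null set; \<open>H\<^sup>1(\<Omega>)\<close> consists of the functions \<open>u\<close> with \<open>weak_gradient \<Omega> u g\<close> for some \<open>g\<close>.\<close>

definition weak_gradient ::
    "'a::euclidean_space set \<Rightarrow> ('a \<Rightarrow> real) \<Rightarrow> ('a \<Rightarrow> 'a) \<Rightarrow> bool" where
  "weak_gradient \<Omega> u g \<longleftrightarrow>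
     L2_on \<Omega> u \<and> L2_on \<Omega> g \<and>
     (\<forall>\<phi>. test_function \<Omega> \<phi> \<longrightarrow>
        (\<forall>i\<in>Basis. (LINT x|lebesgue_on \<Omega>. u x * frechet_derivative \<phi> (at x) i)
                  = - (LINT x|lebesgue_on \<Omega>. (g x \<bullet> i) * \<phi> x)))"

subsection \<open>The first nonzero Neumann eigenvalue\<close>

text \<open>The condition \<open>u \<noteq> 0\<close> is meant in \<open>H\<^sup>1(\<Omega>)\<close>, that is, modulo null sets.\<close>

definition rayleigh_quotients :: "'a::euclidean_space set \<Rightarrow> real set" where
  "rayleigh_quotients \<Omega> =
     {(LINT x|lebesgue_on \<Omega>. (norm (g x))\<^sup>2) / (LINT x|lebesgue_on \<Omega>. (u x)\<^sup>2) | u g.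
        weak_gradient \<Omega> u g \<and> \<not> (AE x in lebesgue_on \<Omega>. u x = 0) \<and>
        (LINT x|lebesgue_on \<Omega>. u x) = 0}"

text \<open>For a nonempty open bounded convex set the infimum is attained, so it is the minimum.\<close>

definition neumann_mu1 :: "'a::euclidean_space set \<Rightarrow> real" where
  "neumann_mu1 \<Omega> = Inf (rayleigh_quotients \<Omega>)"

subsection \<open>The John ellipse\<close>

text \<open>\<open>E\<close> is a nondegenerate ellipse with semiaxes \<open>a \<ge> b\<close>, in the directions \<open>v\<close> and \<open>w\<close>. Ellipses
  are open: the domains are open, and no closed ellipse contained in an open set has maximal area.\<close>

definition ellipse_with_semiaxes :: "(real^2) set \<Rightarrow> real \<Rightarrow> real \<Rightarrow> bool" where
  "ellipse_with_semiaxes E a b \<longleftrightarrow>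
     0 < b \<and> b \<le> a \<and>
     (\<exists>c v w. norm v = a \<and> norm w = b \<and> v \<bullet> w = 0 \<and>
        E = {c + s *\<^sub>R v + t *\<^sub>R w | s t. s\<^sup>2 + t\<^sup>2 < 1})"

definition ellipse :: "(real^2) set \<Rightarrow> bool" where
  "ellipse E \<longleftrightarrow> (\<exists>a b. ellipse_with_semiaxes E a b)"

definition john_ellipse :: "(real^2) set \<Rightarrow> (real^2) set \<Rightarrow> bool" where
  "john_ellipse \<Omega> E \<longleftrightarrow>
     ellipse E \<and> E \<subseteq> \<Omega> \<and>
     (\<forall>E'. ellipse E' \<and> E' \<subseteq> \<Omega> \<longrightarrow> measure lebesgue E' \<le> measure lebesgue E)"

text \<open>Well defined for nonempty open bounded convex sets, whose John ellipse is unique.\<close>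

definition john_a2 :: "(real^2) set \<Rightarrow> real" where
  "john_a2 \<Omega> = (THE b. \<exists>E a. john_ellipse \<Omega> E \<and> ellipse_with_semiaxes E a b)"

subsection \<open>The Bessel function \<open>J\<^sub>0\<close> and its first positive zero\<close>

definition bessel_J0 :: "real \<Rightarrow> real" where
  "bessel_J0 x = (\<Sum>k. (-1) ^ k / (fact k)\<^sup>2 * (x / 2) ^ (2 * k))"

definition j01 :: real where
  "j01 = (LEAST x. 0 < x \<and> bessel_J0 x = 0)"

end

theory Submission
  imports Defs
begin

text \<open>
  The witnesses are thin rhombi \<open>|x\<^sub>1| + |x\<^sub>2| / e < 1\<close>.  Such a rhombus has diameter \<open>2\<close> and its John ellipse
  has semiaxes \<open>1 / \<surd>2\<close> and \<open>e / \<surd>2\<close> (\<open>john_a2_rhombus\<close>), and the point is that its eigenvalue falls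
  below the limit value \<open>j\<^sub>0\<^sub>1\<^sup>2\<close> only by a term of order \<open>e\<^sup>2\<close>:
  \<open>\<mu>\<^sub>1 \<ge> j\<^sub>0\<^sub>1\<^sup>2 / (1 + 2 e\<^sup>2)\<close> (\<open>neumann_mu1_rhombus\<close>).  Since \<open>\<alpha> < 2\<close>, the loss \<open>2 j\<^sub>0\<^sub>1\<^sup>2 e\<^sup>2\<close> is smaller
  than a given multiple of \<open>e\<^sup>\<alpha>\<close> once \<open>e\<close> is small.

  Why the lower bound holds: the rhombus consists of two thin cones with apexes \<open>(\<plusminus>1, 0)\<close>, glued along the
  short diagonal.  Foliate it by the broken lines that run from one apex through a point \<open>(0, t)\<close> of that
  diagonal to the other apex.  With the distance \<open>r\<close> (along the axis) from the apex as parameter, the area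
  element is \<open>r dr dt\<close>, so along each leaf one faces the radial problem \<open>- (r f')' = \<mu> r f\<close>.  For functions
  vanishing at \<open>r = 1\<close> its first eigenvalue is \<open>j\<^sub>0\<^sub>1\<^sup>2\<close>, with eigenfunction \<open>J\<^sub>0(j\<^sub>0\<^sub>1 r)\<close> (\<open>bessel_hardy\<close>).  The
  two halves of a leaf share the value \<open>c\<close> at \<open>(0, t)\<close>; subtracting \<open>c\<close> makes both halves admissible, and
  replacing \<open>c\<close> by the mean over the leaf only decreases the left-hand side.  So along each leaf the
  variance is controlled with the sharp constant (\<open>bessel_hardy_glued\<close>).  What remains is the oscillation of the leaf means as \<open>t\<close> varies.  It
  is an oscillation over an interval of length \<open>2 e\<close>, and an elementary Poincare inequality bounds it by
  \<open>4 e\<^sup>2\<close> times the energy in \<open>x\<^sub>2\<close>-direction.  The leaves are inclined by at most \<open>e\<close> to the axis, so their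
  part of the estimate uses, up to the factor \<open>1 + 2 e\<^sup>2\<close>, only the derivative in \<open>x\<^sub>1\<close>-direction and
  about half of the one in \<open>x\<^sub>2\<close>-direction; the other half absorbs the oscillation of the means
  (\<open>rhombus_Poincare_C1\<close>).

  This argument needs a differentiable function on a compact rhombus.  A general element of \<open>H\<^sup>1\<close> is
  mollified: on a compact subset of the domain the gradient of the mollified function is the mollified weak
  gradient, whose energy is not larger by Jensen's inequality, while the functions converge in \<open>L\<^sup>1\<close>
  (\<open>mollify\<close>); Fatou's lemma and an exhaustion by smaller rhombi finish the proof
  (\<open>rhombus_Poincare\<close>).
\<close>

section \<open>The Bessel function \<open>J\<^sub>0\<close> and its first positive zero\<close>

definition bessel_coeff :: "nat \<Rightarrow> real" where
  "bessel_coeff k = (-1) ^ k / (fact k)\<^sup>2"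

text \<open>In the variable \<open>z = x\<^sup>2 / 4\<close> the series of \<open>J\<^sub>0\<close> becomes an ordinary power series with infinite radius of
  convergence, which can be differentiated termwise; \<open>bessel_E'\<close> and \<open>bessel_E''\<close> are its derivatives.\<close>

definition bessel_E :: "real \<Rightarrow> real" where
  "bessel_E z = (\<Sum>k. bessel_coeff k * z ^ k)"

definition bessel_E' :: "real \<Rightarrow> real" where
  "bessel_E' z = (\<Sum>k. diffs bessel_coeff k * z ^ k)"

definition bessel_E'' :: "real \<Rightarrow> real" where
  "bessel_E'' z = (\<Sum>k. diffs (diffs bessel_coeff) k * z ^ k)"

lemma bessel_coeff_bound: "\<bar>bessel_coeff k\<bar> \<le> 1 / fact k"
proof -
  have f: "(1::real) \<le> fact k" by simp
  have "(fact k :: real) * 1 \<le> fact k * fact k" by (rule mult_left_mono[OF f]) simp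
  then have "(1::real) / (fact k * fact k) \<le> 1 / fact k" by (intro frac_le) auto
  then show ?thesis by (simp add: bessel_coeff_def power2_eq_square abs_mult)
qed

lemma summable_bessel: "summable (\<lambda>k. bessel_coeff k * z ^ k)"
proof (rule summable_comparison_test')
  show "summable (\<lambda>k. \<bar>z\<bar> ^ k /\<^sub>R fact k)" by (rule summable_exp_generic)
  show "norm (bessel_coeff n * z ^ n) \<le> \<bar>z\<bar> ^ n /\<^sub>R fact n" if "n \<ge> 0" for n
  proof -
    have "\<bar>bessel_coeff n\<bar> * \<bar>z\<bar> ^ n \<le> 1 / fact n * \<bar>z\<bar> ^ n"
      by (rule mult_right_mono[OF bessel_coeff_bound]) simp
    then show ?thesis by (simp add: abs_mult power_abs inverse_eq_divide)
  qed
qed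

lemma summable_bessel_diffs: "summable (\<lambda>k. diffs bessel_coeff k * z ^ k)"
  by (rule termdiff_converges_all) (rule summable_bessel)

lemma summable_bessel_diffs2: "summable (\<lambda>k. diffs (diffs bessel_coeff) k * z ^ k)"
  by (rule termdiff_converges_all) (rule summable_bessel_diffs)

lemma DERIV_bessel_E: "(bessel_E has_real_derivative bessel_E' z) (at z)"
  unfolding bessel_E_def[abs_def] bessel_E'_def
  by (rule termdiffs_strong_converges_everywhere) (rule summable_bessel)

lemma DERIV_bessel_E': "(bessel_E' has_real_derivative bessel_E'' z) (at z)"
  unfolding bessel_E'_def[abs_def] bessel_E''_def
  by (rule termdiffs_strong_converges_everywhere) (rule summable_bessel_diffs)

text \<open>In terms of the coefficients this is \<open>(k + 1)\<^sup>2 c\<^sub>k\<^sub>+\<^sub>1 = - c\<^sub>k\<close>.\<close>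

lemma bessel_E_ode: "z * bessel_E'' z + bessel_E' z = - bessel_E z"
proof -
  have "(\<lambda>k. diffs (diffs bessel_coeff) k * z ^ k) sums bessel_E'' z"
    unfolding bessel_E''_def using summable_bessel_diffs2 by (rule summable_sums)
  then have "(\<lambda>k. z * (diffs (diffs bessel_coeff) k * z ^ k)) sums (z * bessel_E'' z)"
    by (rule sums_mult)
  then have "(\<lambda>k. of_nat (Suc k) * diffs bessel_coeff (Suc k) * z ^ Suc k) sums (z * bessel_E'' z)"
    by (simp add: diffs_def mult_ac)
  then have 2: "(\<lambda>k. of_nat k * diffs bessel_coeff k * z ^ k) sums (z * bessel_E'' z)"
    using sums_Suc_iff[of "\<lambda>k. of_nat k * diffs bessel_coeff k * z ^ k"] by simp
  have 1: "(\<lambda>k. diffs bessel_coeff k * z ^ k) sums bessel_E' z"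
    unfolding bessel_E'_def using summable_bessel_diffs by (rule summable_sums)
  have 0: "(\<lambda>k. bessel_coeff k * z ^ k) sums bessel_E z"
    unfolding bessel_E_def using summable_bessel by (rule summable_sums)
  have "bessel_coeff k + (of_nat k + 1) * diffs bessel_coeff k = 0" for k
  proof -
    have "(of_nat k + 1) * diffs bessel_coeff k = (real k + 1)\<^sup>2 * bessel_coeff (Suc k)"
      by (simp add: diffs_def power2_eq_square algebra_simps)
    also have "\<dots> = - bessel_coeff k"
      by (simp add: bessel_coeff_def power_mult_distrib add.commute)
    finally show ?thesis by simp
  qed
  then have "(bessel_coeff k + (of_nat k + 1) * diffs bessel_coeff k) * z ^ k = 0" for k by simp
  then have "of_nat k * diffs bessel_coeff k * z ^ k + diffs bessel_coeff k * z ^ k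
      + bessel_coeff k * z ^ k = 0" for k
    by (simp add: algebra_simps)
  then have "(\<lambda>k. 0) sums (z * bessel_E'' z + bessel_E' z + bessel_E z)"
    using sums_add[OF sums_add[OF 2 1] 0] by simp
  then have "z * bessel_E'' z + bessel_E' z + bessel_E z = 0"
    using sums_unique2 sums_zero by blast
  then show ?thesis by simp
qed

lemma bessel_J0_eq: "bessel_J0 x = bessel_E (x\<^sup>2 / 4)"
  unfolding bessel_J0_def bessel_E_def
  by (simp add: bessel_coeff_def power_mult power_divide)

definition bessel_J0' :: "real \<Rightarrow> real" where
  "bessel_J0' x = x / 2 * bessel_E' (x\<^sup>2 / 4)"

lemma DERIV_bessel_J0: "(bessel_J0 has_real_derivative bessel_J0' x) (at x)"
proof -
  have "((\<lambda>x. bessel_E (x\<^sup>2 / 4)) has_real_derivative bessel_E' (x\<^sup>2 / 4) * (x / 2)) (at x)"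
    by (rule DERIV_chain2[OF DERIV_bessel_E]) (auto intro!: derivative_eq_intros)
  then show ?thesis by (simp add: bessel_J0_eq[abs_def] bessel_J0'_def mult.commute)
qed

text \<open>Bessel's equation in divergence form: the weight \<open>x\<close> under the derivative is the Jacobian of the cone
  coordinates used below.\<close>

lemma bessel_equation: "((\<lambda>x. x * bessel_J0' x) has_real_derivative - x * bessel_J0 x) (at x)"
proof -
  let ?z = "x\<^sup>2 / 4"
  have "((\<lambda>x. bessel_E' (x\<^sup>2 / 4)) has_real_derivative bessel_E'' ?z * (x / 2)) (at x)"
    by (rule DERIV_chain2[OF DERIV_bessel_E']) (auto intro!: derivative_eq_intros)
  then have "((\<lambda>x. x\<^sup>2 / 2 * bessel_E' (x\<^sup>2 / 4)) has_real_derivative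
      x * bessel_E' ?z + x\<^sup>2 / 2 * (bessel_E'' ?z * (x / 2))) (at x)"
    by (auto intro!: derivative_eq_intros)
  also have "x * bessel_E' ?z + x\<^sup>2 / 2 * (bessel_E'' ?z * (x / 2))
      = x * (?z * bessel_E'' ?z + bessel_E' ?z)"
    by (simp add: algebra_simps power2_eq_square)
  also have "\<dots> = - x * bessel_J0 x"
    by (simp only: bessel_E_ode bessel_J0_eq)
  finally show ?thesis
    by (simp add: bessel_J0'_def power2_eq_square mult.assoc)
qed

lemma continuous_bessel_J0: "continuous_on A bessel_J0"
  using DERIV_bessel_J0 DERIV_isCont continuous_at_imp_continuous_on by blast

text \<open>The point \<open>z = 2\<close> lies just beyond the first zero of \<open>bessel_E\<close>, near \<open>1.446\<close>: the first five terms add up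
  to \<open>- 7 / 36\<close>, and from \<open>120 \<sqdot> 2\<^sup>k \<le> (k + 5)!\<close> the remaining ones are dominated by a geometric series of
  sum \<open>64 / 14400\<close>.\<close>

lemma bessel_E_2_neg: "bessel_E 2 < 0"
proof -
  have s: "summable (\<lambda>k. bessel_coeff (k + 5) * 2 ^ (k + 5))"
    using summable_bessel[of 2] by (rule summable_ignore_initial_segment)
  have bnd: "bessel_coeff (k + 5) * 2 ^ (k + 5) \<le> 32 / 120 / 120 * (1/2) ^ k" for k
  proof -
    have f: "120 * 2 ^ k \<le> (fact (k + 5) :: real)"
    proof (induction k)
      case 0 then show ?case by (simp add: fact_numeral)
    next
      case (Suc k)
      have "120 * 2 ^ Suc k = 2 * (120 * 2 ^ k :: real)" by simp
      also have "\<dots> \<le> (of_nat (Suc (k + 5))) * fact (k + 5)"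
        using Suc by (intro mult_mono) auto
      also have "\<dots> = fact (Suc k + 5)" by (simp only: add_Suc fact_Suc)
      finally show ?case .
    qed
    have "bessel_coeff (k + 5) * 2 ^ (k + 5) \<le> \<bar>bessel_coeff (k + 5)\<bar> * 2 ^ (k + 5)"
      by (intro mult_right_mono) auto
    also have "\<dots> = 2 ^ (k + 5) / (fact (k + 5) * fact (k + 5))"
      by (simp add: bessel_coeff_def power2_eq_square abs_mult)
    also have "\<dots> \<le> 2 ^ (k + 5) / ((120 * 2 ^ k) * (120 * 2 ^ k))"
      using f by (intro divide_left_mono mult_mono) auto
    also have "\<dots> = 32 / 120 / 120 * (1/2) ^ k"
      by (simp add: power_add power_one_over)
    finally show ?thesis .
  qed
  have "(\<Sum>k. bessel_coeff (k + 5) * 2 ^ (k + 5)) \<le> (\<Sum>k. 32 / 120 / 120 * (1/2::real) ^ k)"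
    by (intro suminf_le bnd s summable_mult summable_geometric) auto
  also have "\<dots> = 64 / 120 / 120"
    by (subst suminf_mult) (simp_all add: suminf_geometric)
  finally have tail: "(\<Sum>k. bessel_coeff (k + 5) * 2 ^ (k + 5)) \<le> 64 / 120 / 120" .
  have "bessel_E 2 = (\<Sum>k. bessel_coeff (k + 5) * 2 ^ (k + 5)) + (\<Sum>k<5. bessel_coeff k * 2 ^ k)"
    unfolding bessel_E_def by (rule suminf_split_initial_segment[OF summable_bessel])
  moreover have "(\<Sum>k<5. bessel_coeff k * 2 ^ k) < - (1/10)"
    by (simp add: bessel_coeff_def lessThan_nat_numeral fact_numeral)
  ultimately show ?thesis using tail by simp
qed

lemma bessel_J0_0: "bessel_J0 0 = 1"
proof -
  have "bessel_E 0 = bessel_coeff 0" unfolding bessel_E_def by (rule powser_zero)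
  then show ?thesis by (simp add: bessel_J0_eq bessel_coeff_def)
qed

text \<open>\<open>j01\<close> is given by a \<open>LEAST\<close> operator over the reals and hence says nothing until a least zero is known to
  exist.  Zeros exist by the sign change just found; the set of nonnegative zeros is closed, so it contains its
  infimum, and that is positive because \<open>J\<^sub>0(0) = 1\<close>.\<close>

lemma j01_pos: "0 < j01"
  and bessel_J0_pos: "0 \<le> x \<Longrightarrow> x < j01 \<Longrightarrow> 0 < bessel_J0 x"
proof -
  let ?Z = "{x. 0 \<le> x \<and> bessel_J0 x = 0}"
  have "bessel_J0 (sqrt 8) < 0" using bessel_E_2_neg by (simp add: bessel_J0_eq)
  then have "\<exists>x\<ge>0. x \<le> sqrt 8 \<and> bessel_J0 x = 0"
    by (intro IVT2' continuous_bessel_J0) (auto simp: bessel_J0_0)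
  then have ne: "?Z \<noteq> {}" by auto
  have "closed ({0..} \<inter> bessel_J0 -` {0})"
    by (intro continuous_closed_preimage continuous_bessel_J0) auto
  then have cl: "closed ?Z" by (simp add: vimage_def Int_def)
  have bdd: "bdd_below ?Z" by (auto intro: bdd_belowI)
  let ?m = "Inf ?Z"
  have m: "?m \<in> ?Z" using closed_contains_Inf[OF ne bdd cl] .
  have le: "?m \<le> x" if "0 \<le> x" "bessel_J0 x = 0" for x
    using that bdd by (intro cInf_lower) auto
  have "?m \<noteq> 0" using m bessel_J0_0 by (metis (mono_tags, lifting) mem_Collect_eq zero_neq_one)
  then have mpos: "0 < ?m" using m by auto
  have j: "j01 = ?m" unfolding j01_def
    using m mpos le by (intro Least_equality) auto
  show "0 < j01" using j mpos by simp
  show "0 < bessel_J0 x" if "0 \<le> x" "x < j01"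
  proof (rule ccontr)
    assume "\<not> 0 < bessel_J0 x"
    then have "\<exists>y\<ge>0. y \<le> x \<and> bessel_J0 y = 0"
      using that by (intro IVT2' continuous_bessel_J0) (auto simp: bessel_J0_0)
    then show False using le that j by force
  qed
qed

section \<open>The sharp Hardy inequality on a cone\<close>

text \<open>The sharp radial inequality, by Picone's trick.  The function \<open>p(r) = J\<^sub>0(s r)\<close> is positive on the closed
  interval because \<open>s L < j01\<close>, and it solves \<open>(r p')' = - s\<^sup>2 r p\<close>.  Therefore
  \<open>r f'\<^sup>2 - s\<^sup>2 r f\<^sup>2 = (r p' f\<^sup>2 / p)' + r (f' - p' f / p)\<^sup>2\<close>, and the boundary terms vanish: at \<open>0\<close> because of the
  weight, at \<open>L\<close> because of \<open>f L = 0\<close>.  Staying strictly below \<open>j01\<close> avoids a division by zero at \<open>r = L\<close>.\<close>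

lemma bessel_hardy:
  fixes f f' :: "real \<Rightarrow> real"
  assumes L: "0 < L" and s: "0 \<le> s" "s * L < j01"
    and f': "\<And>r. r \<in> {0..L} \<Longrightarrow> (f has_real_derivative f' r) (at r within {0..L})"
    and cont: "continuous_on {0..L} f'"
    and fL: "f L = 0"
  shows "s\<^sup>2 * integral {0..L} (\<lambda>r. r * (f r)\<^sup>2) \<le> integral {0..L} (\<lambda>r. r * (f' r)\<^sup>2)"
proof -
  define p where "p r = bessel_J0 (s * r)" for r
  define p' where "p' r = s * bessel_J0' (s * r)" for r
  have pos: "0 < p r" if "r \<in> {0..L}" for r
  proof -
    have "s * r \<le> s * L" using that s by (intro mult_left_mono) auto
    then show ?thesis unfolding p_def using that s by (intro bessel_J0_pos) auto
  qed
  have dp: "(p has_real_derivative p' r) (at r within A)" for r A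
  proof -
    have "((\<lambda>r. bessel_J0 (s * r)) has_real_derivative bessel_J0' (s * r) * s) (at r)"
      by (rule DERIV_chain2[where g = "\<lambda>r. s * r", OF DERIV_bessel_J0])
        (auto intro!: derivative_eq_intros)
    then have "(p has_real_derivative p' r) (at r)"
      by (simp add: p_def[abs_def] p'_def mult.commute)
    then show ?thesis by (rule has_field_derivative_at_within)
  qed
  have dq: "((\<lambda>r. r * p' r) has_real_derivative - s\<^sup>2 * r * p r) (at r within A)" for r A
  proof -
    have "((\<lambda>r. (s * r) * bessel_J0' (s * r)) has_real_derivative - (s * r) * bessel_J0 (s * r) * s) (at r)"
      by (rule DERIV_chain2[where f = "\<lambda>x. x * bessel_J0' x" and g = "\<lambda>r. s * r", OF bessel_equation])
        (auto intro!: derivative_eq_intros)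
    then have "((\<lambda>r. r * p' r) has_real_derivative - s\<^sup>2 * r * p r) (at r)"
      by (simp add: p'_def p_def power2_eq_square mult_ac)
    then show ?thesis by (rule has_field_derivative_at_within)
  qed
  have cf: "continuous_on {0..L} f"
    by (rule DERIV_continuous_on) (rule f')
  \<comment> \<open>\<open>D\<close> is the derivative of \<open>r p' f\<^sup>2 / p\<close>.\<close>
  define D where "D r = - s\<^sup>2 * r * (f r)\<^sup>2 - r * p' r * p' r / (p r * p r) * (f r)\<^sup>2
      + 2 * (r * p' r / p r) * f r * f' r" for r
  have "((\<lambda>r. r * p' r / p r * (f r)\<^sup>2) has_real_derivative D r) (at r within {0..L})"
    if r: "r \<in> {0..L}" for r
  proof -
    have "((\<lambda>r. r * p' r / p r) has_real_derivative
        ((- s\<^sup>2 * r * p r) * p r - (r * p' r) * p' r) / (p r * p r)) (at r within {0..L})"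
      using pos[OF r] by (intro DERIV_divide dq dp) simp
    moreover have "((\<lambda>r. (f r)\<^sup>2) has_real_derivative 2 * (f r * f' r)) (at r within {0..L})"
      using DERIV_power[OF f'[OF r], of 2] by (simp add: mult_ac)
    ultimately have "((\<lambda>r. r * p' r / p r * (f r)\<^sup>2) has_real_derivative
        ((- s\<^sup>2 * r * p r) * p r - (r * p' r) * p' r) / (p r * p r) * (f r)\<^sup>2
          + 2 * (f r * f' r) * (r * p' r / p r)) (at r within {0..L})"
      by (rule DERIV_mult)
    then show ?thesis
    proof (rule DERIV_cong)
      have "((- s\<^sup>2 * r * p r) * p r - (r * p' r) * p' r) / (p r * p r)
          = - s\<^sup>2 * r - r * p' r * p' r / (p r * p r)"
        using pos[OF r] by (simp add: diff_divide_distrib)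
      then show "((- s\<^sup>2 * r * p r) * p r - (r * p' r) * p' r) / (p r * p r) * (f r)\<^sup>2
          + 2 * (f r * f' r) * (r * p' r / p r) = D r"
        unfolding D_def by (simp only:) (simp add: left_diff_distrib)
    qed
  qed
  then have "(D has_integral (L * p' L / p L * (f L)\<^sup>2 - 0 * p' 0 / p 0 * (f 0)\<^sup>2)) {0..L}"
    using L by (intro fundamental_theorem_of_calculus)
      (auto simp: has_real_derivative_iff_has_vector_derivative)
  then have D: "(D has_integral 0) {0..L}" using fL by simp
  have i1: "(\<lambda>r. s\<^sup>2 * (r * (f r)\<^sup>2)) integrable_on {0..L}"
    by (intro integrable_continuous_real continuous_intros cf)
  have i2: "(\<lambda>r. r * (f' r)\<^sup>2) integrable_on {0..L}"
    by (intro integrable_continuous_real continuous_intros cont)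
  have "integral {0..L} (\<lambda>r. s\<^sup>2 * (r * (f r)\<^sup>2) + D r) \<le> integral {0..L} (\<lambda>r. r * (f' r)\<^sup>2)"
  proof (rule integral_le)
    show "(\<lambda>r. s\<^sup>2 * (r * (f r)\<^sup>2) + D r) integrable_on {0..L}"
      using D i1 by (intro integrable_add) auto
    show "s\<^sup>2 * (r * (f r)\<^sup>2) + D r \<le> r * (f' r)\<^sup>2" if r: "r \<in> {0..L}" for r
    proof -
      have "0 \<le> r * (f' r - p' r / p r * f r)\<^sup>2" using r by simp
      also have "\<dots> = r * (f' r)\<^sup>2 - (s\<^sup>2 * (r * (f r)\<^sup>2) + D r)"
        using pos[OF r] unfolding D_def by (simp add: field_simps power2_eq_square)
      finally show ?thesis by simp
    qed
  qed (rule i2)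
  also have "integral {0..L} (\<lambda>r. s\<^sup>2 * (r * (f r)\<^sup>2) + D r)
      = s\<^sup>2 * integral {0..L} (\<lambda>r. r * (f r)\<^sup>2) + integral {0..L} D"
    using D i1 by (subst integral_add) auto
  finally show ?thesis using D by (simp add: integral_unique)
qed

section \<open>The thin rhombus and its John ellipse\<close>

definition rhombus :: "real \<Rightarrow> (real^2) set" where
  "rhombus e = {x. \<bar>x $ 1\<bar> + \<bar>x $ 2\<bar> / e < 1}"

lemma open_rhombus: "0 < e \<Longrightarrow> open (rhombus e)"
  unfolding rhombus_def by (intro open_Collect_less continuous_intros) auto

lemma convex_rhombus:
  assumes "0 < e"
  shows "convex (rhombus e)"
proof (rule convexI)
  fix x y :: "real^2" and u v :: real
  assume x: "x \<in> rhombus e" and y: "y \<in> rhombus e" and uv: "0 \<le> u" "0 \<le> v" "u + v = 1"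
  have c: "\<bar>u * a + v * b\<bar> \<le> u * \<bar>a\<bar> + v * \<bar>b\<bar>" for a b :: real
    using abs_triangle_ineq[of "u * a" "v * b"] uv by (simp add: abs_mult)
  have "\<bar>u * x $ 1 + v * y $ 1\<bar> + \<bar>u * x $ 2 + v * y $ 2\<bar> / e
      \<le> (u * \<bar>x $ 1\<bar> + v * \<bar>y $ 1\<bar>) + (u * \<bar>x $ 2\<bar> + v * \<bar>y $ 2\<bar>) / e"
    using assms by (intro add_mono divide_right_mono c) auto
  also have "\<dots> = u * (\<bar>x $ 1\<bar> + \<bar>x $ 2\<bar> / e) + v * (\<bar>y $ 1\<bar> + \<bar>y $ 2\<bar> / e)"
    by (simp add: algebra_simps add_divide_distrib)
  also have "\<dots> < 1"
    using x y uv by (intro convex_bound_lt) (auto simp: rhombus_def)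
  finally show "u *\<^sub>R x + v *\<^sub>R y \<in> rhombus e" by (simp add: rhombus_def)
qed

lemma norm_le_abs_components: "norm (x::real^2) \<le> \<bar>x $ 1\<bar> + \<bar>x $ 2\<bar>"
  using norm_le_l1_cart[of x] by (simp add: sum_2)

lemma rhombus_subset_ball:
  assumes "0 < e" "e \<le> 1"
  shows "rhombus e \<subseteq> ball 0 1"
proof
  fix x assume x: "x \<in> rhombus e"
  have "\<bar>x $ 2\<bar> * e \<le> \<bar>x $ 2\<bar> * 1" using assms by (intro mult_left_mono) auto
  then have "\<bar>x $ 2\<bar> \<le> \<bar>x $ 2\<bar> / e" using assms by (simp add: pos_le_divide_eq)
  then show "x \<in> ball 0 1" using x norm_le_abs_components[of x] by (simp add: rhombus_def)
qed

lemma bounded_rhombus: "0 < e \<Longrightarrow> e \<le> 1 \<Longrightarrow> bounded (rhombus e)"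
  using rhombus_subset_ball bounded_ball bounded_subset by blast

lemma diameter_rhombus:
  assumes "0 < e" "e \<le> 1"
  shows "diameter (rhombus e) = 2"
proof (rule antisym)
  have "diameter (rhombus e) \<le> diameter (ball (0::real^2) 1)"
    by (intro diameter_subset rhombus_subset_ball assms) auto
  then show "diameter (rhombus e) \<le> 2" by simp
  show "2 \<le> diameter (rhombus e)"
  proof (rule field_le_epsilon)
    fix d :: real assume d: "0 < d"
    \<comment> \<open>The vertices \<open>(\<plusminus>1, 0)\<close> are not in the open rhombus; they are approached by \<open>(\<plusminus>c, 0)\<close>.\<close>
    define c where "c = max 0 (1 - d / 2)"
    have c: "0 \<le> c" "c < 1" "2 \<le> 2 * c + d" using d by (auto simp: c_def max_def)
    let ?x = "c *\<^sub>R axis 1 1 :: real^2"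
    have "?x \<in> rhombus e" "- ?x \<in> rhombus e" using c by (auto simp: rhombus_def axis_def)
    then have "dist ?x (- ?x) \<le> diameter (rhombus e)"
      by (intro diameter_bounded_bound bounded_rhombus assms)
    moreover have "dist ?x (- ?x) = 2 * norm ?x"
      using norm_scaleR[of 2 ?x] by (simp only: dist_norm diff_minus_eq_add scaleR_2)
    moreover have "norm ?x = c" using c by simp
    ultimately show "2 \<le> diameter (rhombus e) + d" using c by linarith
  qed
qed

lemma measure_ellipse:
  fixes v w c :: "real^2"
  shows "measure lebesgue {c + s *\<^sub>R v + t *\<^sub>R w | s t. s\<^sup>2 + t\<^sup>2 < 1}
    = \<bar>v $ 1 * w $ 2 - w $ 1 * v $ 2\<bar> * measure lebesgue (ball (0::real^2) 1)"
proof -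
  define f where "f x = (x $ 1) *\<^sub>R v + (x $ 2) *\<^sub>R w" for x :: "real^2"
  have lin: "linear f"
    by (rule linearI) (auto simp: f_def algebra_simps)
  have B: "x \<in> ball 0 1 \<longleftrightarrow> (x $ 1)\<^sup>2 + (x $ 2)\<^sup>2 < 1" for x :: "real^2"
    by (simp add: norm_vec_def L2_set_def sum_2)
  have "{c + s *\<^sub>R v + t *\<^sub>R w | s t. s\<^sup>2 + t\<^sup>2 < 1} = (+) c ` f ` ball 0 1"
  proof (intro subset_antisym subsetI)
    fix y assume "y \<in> {c + s *\<^sub>R v + t *\<^sub>R w | s t. s\<^sup>2 + t\<^sup>2 < 1}"
    then obtain s t where st: "y = c + s *\<^sub>R v + t *\<^sub>R w" "s\<^sup>2 + t\<^sup>2 < 1" by auto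
    then have "y = c + f (vector [s, t])" "vector [s, t] \<in> (ball 0 1 :: (real^2) set)"
      unfolding B by (auto simp: f_def)
    then show "y \<in> (+) c ` f ` ball 0 1" by blast
  next
    fix y assume "y \<in> (+) c ` f ` ball 0 1"
    then obtain x :: "real^2" where x: "x \<in> ball 0 1" "y = c + f x" by auto
    then show "y \<in> {c + s *\<^sub>R v + t *\<^sub>R w | s t. s\<^sup>2 + t\<^sup>2 < 1}"
      unfolding B f_def by (auto simp: add.assoc)
  qed
  moreover have "measure lebesgue (f ` ball 0 1) = \<bar>det (matrix f)\<bar> * measure lebesgue (ball (0::real^2) 1)"
    by (rule measure_linear_image[OF lin]) simp
  moreover have "det (matrix f) = v $ 1 * w $ 2 - w $ 1 * v $ 2"
    by (simp add: det_2 matrix_def f_def axis_def)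
  ultimately show ?thesis by (simp add: measure_translation)
qed

text \<open>Whatever the centre, the values of \<open>n \<bullet> x\<close> on the ellipse fill an interval whose length is twice the norm of
  \<open>(n \<bullet> v, n \<bullet> w)\<close>; on the slab that contains the ellipse they fill one of length \<open>2\<close>.\<close>

lemma ellipse_in_slab:
  fixes n c v w :: "'a::real_inner"
  assumes sub: "\<And>s t. s\<^sup>2 + t\<^sup>2 < 1 \<Longrightarrow> \<bar>n \<bullet> (c + s *\<^sub>R v + t *\<^sub>R w)\<bar> < 1"
  shows "(n \<bullet> v)\<^sup>2 + (n \<bullet> w)\<^sup>2 \<le> 1"
proof (rule ccontr)
  define q where "q = (n \<bullet> v)\<^sup>2 + (n \<bullet> w)\<^sup>2"
  \<comment> \<open>If \<open>q > 1\<close>, these parameters are admissible and move the centre by \<open>1\<close> in direction \<open>n\<close>;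
    with both signs one leaves the slab.\<close>
  define s t where "s = (n \<bullet> v) / q" and "t = (n \<bullet> w) / q"
  assume "\<not> (n \<bullet> v)\<^sup>2 + (n \<bullet> w)\<^sup>2 \<le> 1"
  then have q: "1 < q" by (simp add: q_def)
  have "s\<^sup>2 + t\<^sup>2 = q / q\<^sup>2"
    by (simp add: s_def t_def q_def power_divide add_divide_distrib)
  then have st: "s\<^sup>2 + t\<^sup>2 < 1" using q by (simp add: power2_eq_square)
  have "s * (n \<bullet> v) + t * (n \<bullet> w) = ((n \<bullet> v)\<^sup>2 + (n \<bullet> w)\<^sup>2) / q"
    by (simp add: s_def t_def power2_eq_square add_divide_distrib)
  also have "\<dots> = q / q" by (simp add: q_def)
  finally have "s * (n \<bullet> v) + t * (n \<bullet> w) = q / q" .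
  then have one: "s * (n \<bullet> v) + t * (n \<bullet> w) = 1" using q by simp
  have "\<bar>n \<bullet> c + 1\<bar> < 1"
    using sub[OF st] one by (simp add: inner_add_right add.assoc)
  moreover have "\<bar>n \<bullet> c - 1\<bar> < 1"
    using sub[of "-s" "-t"] st one by (simp add: inner_add_right inner_diff_right algebra_simps)
  ultimately show False by linarith
qed

text \<open>The rhombus is the intersection of two slabs, with normals \<open>(1, 1/e)\<close> and \<open>(1, -1/e)\<close>.  Adding the two width
  conditions cancels the mixed terms and leaves a bound on the rows of the matrix with columns \<open>v\<close> and \<open>w\<close>;
  the determinant is then bounded by the product of the row norms (Hadamard).\<close>

lemma rhombus_ellipse_bounds:
  fixes c v w :: "real^2"
  assumes e: "0 < e"
    and sub: "{c + s *\<^sub>R v + t *\<^sub>R w | s t. s\<^sup>2 + t\<^sup>2 < 1} \<subseteq> rhombus e"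
  defines "p \<equiv> (v $ 1)\<^sup>2 + (w $ 1)\<^sup>2" and "q \<equiv> ((v $ 2)\<^sup>2 + (w $ 2)\<^sup>2) / e\<^sup>2"
  shows "p + q \<le> 1" "(v $ 1 * w $ 2 - w $ 1 * v $ 2)\<^sup>2 \<le> e\<^sup>2 * (p * q)"
proof -
  have *: "(n \<bullet> v)\<^sup>2 + (n \<bullet> w)\<^sup>2 \<le> 1" if n: "n = vector [1, 1 / e] \<or> n = vector [1, - (1 / e)]" for n :: "real^2"
  proof (rule ellipse_in_slab)
    fix s t :: real assume "s\<^sup>2 + t\<^sup>2 < 1"
    then have "c + s *\<^sub>R v + t *\<^sub>R w \<in> rhombus e" using sub by auto
    moreover have "\<bar>n \<bullet> x\<bar> \<le> \<bar>x $ 1\<bar> + \<bar>x $ 2\<bar> / e" for x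
    proof -
      have "n \<bullet> x = x $ 1 + x $ 2 / e \<or> n \<bullet> x = x $ 1 - x $ 2 / e"
        using n by (auto simp: inner_vec_def sum_2)
      moreover have "\<bar>x $ 2 / e\<bar> = \<bar>x $ 2\<bar> / e" using e by simp
      ultimately show ?thesis by linarith
    qed
    ultimately show "\<bar>n \<bullet> (c + s *\<^sub>R v + t *\<^sub>R w)\<bar> < 1"
      unfolding rhombus_def by (meson le_less_trans mem_Collect_eq)
  qed
  have "(v $ 1 + v $ 2 / e)\<^sup>2 + (w $ 1 + w $ 2 / e)\<^sup>2 \<le> 1"
    "(v $ 1 - v $ 2 / e)\<^sup>2 + (w $ 1 - w $ 2 / e)\<^sup>2 \<le> 1"
    using *[of "vector [1, 1 / e]"] *[of "vector [1, - (1 / e)]"]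
    by (auto simp: inner_vec_def sum_2)
  then show "p + q \<le> 1"
    unfolding p_def q_def by (simp add: power2_sum power2_diff power_divide add_divide_distrib)
  have "(v $ 1 * w $ 2 - w $ 1 * v $ 2)\<^sup>2 \<le> ((v $ 1)\<^sup>2 + (w $ 1)\<^sup>2) * ((v $ 2)\<^sup>2 + (w $ 2)\<^sup>2)"
    using zero_le_power2[of "v $ 1 * v $ 2 + w $ 1 * w $ 2"]
    by (simp add: power2_eq_square algebra_simps)
  also have "\<dots> = e\<^sup>2 * (p * q)" using e by (simp add: p_def q_def)
  finally show "(v $ 1 * w $ 2 - w $ 1 * v $ 2)\<^sup>2 \<le> e\<^sup>2 * (p * q)" .
qed

lemma det_orthogonal:
  fixes v w :: "real^2"
  assumes "v \<bullet> w = 0"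
  shows "\<bar>v $ 1 * w $ 2 - w $ 1 * v $ 2\<bar> = norm v * norm w"
proof -
  have "(v $ 1 * w $ 2 - w $ 1 * v $ 2)\<^sup>2 + (v \<bullet> w)\<^sup>2 = (norm v)\<^sup>2 * (norm w)\<^sup>2"
    unfolding power2_norm_eq_inner by (simp add: inner_vec_def sum_2 power2_eq_square algebra_simps)
  then have "(v $ 1 * w $ 2 - w $ 1 * v $ 2)\<^sup>2 = (norm v * norm w)\<^sup>2"
    using assms by (simp add: power_mult_distrib)
  then show ?thesis by (metis abs_mult abs_norm_cancel power2_eq_iff_nonneg abs_ge_zero power2_abs)
qed

lemma measure_semiaxes:
  assumes "ellipse_with_semiaxes E a b"
  shows "measure lebesgue E = a * b * measure lebesgue (ball (0::real^2) 1)"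
  using assms unfolding ellipse_with_semiaxes_def by (auto simp: measure_ellipse det_orthogonal)

text \<open>The area bound is \<open>p q \<le> 1/4\<close> for \<open>p + q \<le> 1\<close>.  In the case of equality \<open>p = q = 1/2\<close>, which fixes both
  \<open>a\<^sup>2 + b\<^sup>2\<close> (the sum of the squared row norms) and \<open>a b\<close>; with \<open>b \<le> a\<close> this determines \<open>b\<close>.\<close>

lemma semiaxes_in_rhombus:
  assumes e: "0 < e" "e \<le> 1" and E: "ellipse_with_semiaxes E a b" "E \<subseteq> rhombus e"
  shows "a * b \<le> e / 2" "a * b = e / 2 \<Longrightarrow> b = e / sqrt 2"
proof -
  obtain c v w where vw: "norm v = a" "norm w = b" "v \<bullet> w = 0"
    "E = {c + s *\<^sub>R v + t *\<^sub>R w | s t. s\<^sup>2 + t\<^sup>2 < 1}" and b: "0 < b" "b \<le> a"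
    using E unfolding ellipse_with_semiaxes_def by auto
  define p q where "p = (v $ 1)\<^sup>2 + (w $ 1)\<^sup>2" and "q = ((v $ 2)\<^sup>2 + (w $ 2)\<^sup>2) / e\<^sup>2"
  have sub: "{c + s *\<^sub>R v + t *\<^sub>R w | s t. s\<^sup>2 + t\<^sup>2 < 1} \<subseteq> rhombus e" using E vw by simp
  note bounds = rhombus_ellipse_bounds[OF e(1) sub, folded p_def q_def]
  have "(a * b)\<^sup>2 = (v $ 1 * w $ 2 - w $ 1 * v $ 2)\<^sup>2"
    using det_orthogonal[OF vw(3)] vw by (metis power2_abs)
  then have ab: "(a * b)\<^sup>2 \<le> e\<^sup>2 * (p * q)" using bounds by simp
  have pq0: "0 \<le> p" "0 \<le> q" by (auto simp: p_def q_def)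
  have amgm: "4 * (p * q) = (p + q)\<^sup>2 - (p - q)\<^sup>2" by (simp add: power2_eq_square algebra_simps)
  have sq: "(p + q)\<^sup>2 \<le> 1" using bounds(1) pq0 by (simp add: power_le_one)
  have "e\<^sup>2 * (p * q) \<le> e\<^sup>2 * (1 / 4)"
  proof (rule mult_left_mono)
    show "p * q \<le> 1 / 4" using amgm sq zero_le_power2[of "p - q"] by linarith
  qed simp
  with ab have "(a * b)\<^sup>2 \<le> (e / 2)\<^sup>2" by (simp add: power_divide)
  then show "a * b \<le> e / 2" using e by (simp add: power2_le_iff_abs_le abs_le_iff)
  show "b = e / sqrt 2" if "a * b = e / 2"
  proof -
    have "1 / 4 \<le> p * q" using ab e that by (simp add: power_divide field_simps)
    then have "(p - q)\<^sup>2 \<le> 0" "1 \<le> (p + q)\<^sup>2" using amgm sq zero_le_power2[of "p - q"] by linarith+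
    then have "p = q" "1\<^sup>2 \<le> (p + q)\<^sup>2" by auto
    then have "p = q" "1 \<le> p + q" using pq0 by (auto intro: power2_le_imp_le)
    then have pq: "p = 1 / 2" "q = 1 / 2" using bounds(1) by auto
    have "a\<^sup>2 + b\<^sup>2 = p + e\<^sup>2 * q"
      using e unfolding vw(1,2)[symmetric] power2_norm_eq_inner
      by (simp add: inner_vec_def sum_2 p_def q_def power2_eq_square)
    then have s: "a\<^sup>2 + b\<^sup>2 = (1 + e\<^sup>2) / 2" by (simp add: pq add_divide_distrib)
    have "(a\<^sup>2 - b\<^sup>2)\<^sup>2 = (a\<^sup>2 + b\<^sup>2)\<^sup>2 - 4 * (a * b)\<^sup>2"
      by (simp add: power2_eq_square algebra_simps)
    also have "\<dots> = ((1 + e\<^sup>2) / 2)\<^sup>2 - 4 * (e / 2)\<^sup>2" by (simp only: s that)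
    also have "\<dots> = ((1 - e\<^sup>2) / 2)\<^sup>2" by (simp add: power2_eq_square field_simps)
    finally have "a\<^sup>2 - b\<^sup>2 = (1 - e\<^sup>2) / 2"
      using b e by (subst (asm) power2_eq_iff_nonneg) (auto simp: power_mono power_le_one)
    with s have "b\<^sup>2 = e\<^sup>2 / 2" by (simp add: field_simps)
    then have "b\<^sup>2 = (e / sqrt 2)\<^sup>2" by (simp add: power_divide)
    then show ?thesis using b e by (subst (asm) power2_eq_iff_nonneg) auto
  qed
qed

text \<open>The definite description asks for a smaller semiaxis that all maximal ellipses share.  The equality case
  above provides its value, and the axis-parallel ellipse below attains the maximal area.\<close>

lemma john_a2_rhombus:
  assumes e: "0 < e" "e \<le> 1"
  shows "john_a2 (rhombus e) = e / sqrt 2"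
proof -
  define v w :: "real^2" where "v = vector [1 / sqrt 2, 0]" and "w = vector [0, e / sqrt 2]"
  define E where "E = {0 + s *\<^sub>R v + t *\<^sub>R w | s t. s\<^sup>2 + t\<^sup>2 < 1}"
  have "norm v = 1 / sqrt 2" "norm w = e / sqrt 2" "v \<bullet> w = 0"
    using e by (auto simp: v_def w_def norm_vec_def L2_set_def sum_2 inner_vec_def)
  then have E: "ellipse_with_semiaxes E (1 / sqrt 2) (e / sqrt 2)"
    unfolding ellipse_with_semiaxes_def E_def using e
    by (intro conjI exI[of _ "0::real^2"] exI[of _ v] exI[of _ w]) (auto simp: divide_right_mono)
  have sub: "E \<subseteq> rhombus e"
  proof
    fix x assume "x \<in> E"
    then obtain s t where st: "x = 0 + s *\<^sub>R v + t *\<^sub>R w" "s\<^sup>2 + t\<^sup>2 < 1" unfolding E_def by auto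
    have "(\<bar>s\<bar> + \<bar>t\<bar>)\<^sup>2 \<le> (\<bar>s\<bar> + \<bar>t\<bar>)\<^sup>2 + (\<bar>s\<bar> - \<bar>t\<bar>)\<^sup>2" by simp
    also have "\<dots> = 2 * (s\<^sup>2 + t\<^sup>2)" by (simp add: power2_sum power2_diff)
    also have "\<dots> < (sqrt 2)\<^sup>2" using st(2) by simp
    finally have "(\<bar>s\<bar> + \<bar>t\<bar>)\<^sup>2 < (sqrt 2)\<^sup>2" .
    then have "\<bar>s\<bar> + \<bar>t\<bar> < sqrt 2" by (rule power2_less_imp_less) simp
    then have "\<bar>s\<bar> / sqrt 2 + \<bar>t\<bar> / sqrt 2 < 1" by (simp add: add_divide_distrib[symmetric])
    moreover have "\<bar>x $ 1\<bar> = \<bar>s\<bar> / sqrt 2" "\<bar>x $ 2\<bar> / e = \<bar>t\<bar> / sqrt 2"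
      using e by (auto simp: st v_def w_def abs_mult)
    ultimately show "x \<in> rhombus e" by (simp add: rhombus_def)
  qed
  have mB: "0 < measure lebesgue (ball (0::real^2) 1)"
    by (simp add: content_ball_pos)
  have mE: "measure lebesgue E = e / 2 * measure lebesgue (ball (0::real^2) 1)"
    using measure_semiaxes[OF E] by simp
  have john: "john_ellipse (rhombus e) E"
    unfolding john_ellipse_def ellipse_def
  proof (intro conjI allI impI sub)
    show "\<exists>a b. ellipse_with_semiaxes E a b" using E by blast
    fix E' assume "(\<exists>a b. ellipse_with_semiaxes E' a b) \<and> E' \<subseteq> rhombus e"
    then obtain a b where ab: "ellipse_with_semiaxes E' a b" "E' \<subseteq> rhombus e" by blast
    show "measure lebesgue E' \<le> measure lebesgue E"
      unfolding mE measure_semiaxes[OF ab(1)]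
      using semiaxes_in_rhombus(1)[OF e ab] mB by (intro mult_right_mono) auto
  qed
  show ?thesis unfolding john_a2_def
  proof (rule the_equality)
    show "\<exists>E a. john_ellipse (rhombus e) E \<and> ellipse_with_semiaxes E a (e / sqrt 2)"
      using john E by blast
    fix b assume "\<exists>E a. john_ellipse (rhombus e) E \<and> ellipse_with_semiaxes E a b"
    then obtain E' a where E': "john_ellipse (rhombus e) E'" "ellipse_with_semiaxes E' a b" by blast
    then have sub': "E' \<subseteq> rhombus e" by (simp add: john_ellipse_def)
    have "measure lebesgue E \<le> measure lebesgue E'"
      using E'(1) E sub unfolding john_ellipse_def ellipse_def by blast
    then have "e / 2 \<le> a * b"
      unfolding mE measure_semiaxes[OF E'(2)] using mB by simp
    then show "b = e / sqrt 2"
      using semiaxes_in_rhombus[OF e E'(2) sub'] by auto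
  qed
qed

section \<open>Smooth functions with compact support\<close>

lemma Ck_SucI:
  assumes "\<And>x. (f has_derivative D x) (at x)" and "\<And>i. i \<in> Basis \<Longrightarrow> Ck k (\<lambda>x. D x i)"
  shows "Ck (Suc k) f"
proof -
  have "frechet_derivative f (at x) = D x" for x
    using frechet_derivative_at[OF assms(1)] by simp
  then show ?thesis using assms by (auto simp: differentiable_def)
qed

lemma Ck_SucD:
  assumes "Ck (Suc k) f"
  shows "(f has_derivative frechet_derivative f (at x)) (at x)"
    and "i \<in> Basis \<Longrightarrow> Ck k (\<lambda>x. frechet_derivative f (at x) i)"
  using assms by (auto simp: frechet_derivative_works)

lemma Ck_continuous:
  assumes "Ck k f"
  shows "continuous_on A f"
proof (cases k)
  case (Suc n)
  then have "(f has_derivative frechet_derivative f (at x)) (at x within A)" for x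
    using Ck_SucD(1) assms has_derivative_at_withinI by blast
  then show ?thesis by (rule has_derivative_continuous_on)
qed (use assms continuous_on_subset in auto)

lemma Ck_Suc_imp: "Ck (Suc k) f \<Longrightarrow> Ck k f"
proof (induction k arbitrary: f)
  case 0
  then show ?case using Ck_continuous[of "Suc 0"] by auto
next
  case (Suc k)
  show ?case
    by (rule Ck_SucI[OF Ck_SucD(1)[OF Suc.prems]]) (rule Suc.IH[OF Ck_SucD(2)[OF Suc.prems]])
qed

lemma Ck_const: "Ck k (\<lambda>x. c)"
proof (induction k arbitrary: c)
  case (Suc k)
  show ?case by (rule Ck_SucI[OF has_derivative_const]) (rule Suc.IH)
qed simp

lemma Ck_inner: "Ck k (\<lambda>x. x \<bullet> b)"
proof (cases k)
  case (Suc n)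
  have "((\<lambda>x. x \<bullet> b) has_derivative (\<lambda>h. h \<bullet> b)) (at x)" for x
    by (rule has_derivative_inner_left[OF has_derivative_ident])
  then show ?thesis unfolding Suc by (rule Ck_SucI) (rule Ck_const)
qed (simp add: continuous_on_inner)

lemma Ck_add: "Ck k f \<Longrightarrow> Ck k g \<Longrightarrow> Ck k (\<lambda>x. f x + g x)"
proof (induction k arbitrary: f g)
  case (Suc k)
  show ?case
    by (rule Ck_SucI[OF has_derivative_add[OF Ck_SucD(1)[OF Suc.prems(1)] Ck_SucD(1)[OF Suc.prems(2)]]])
      (rule Suc.IH[OF Ck_SucD(2)[OF Suc.prems(1)] Ck_SucD(2)[OF Suc.prems(2)]])
qed (auto intro: continuous_intros)

lemma Ck_mult: "Ck k f \<Longrightarrow> Ck k g \<Longrightarrow> Ck k (\<lambda>x. f x * g x)"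
proof (induction k arbitrary: f g)
  case (Suc k)
  show ?case
    by (rule Ck_SucI[OF has_derivative_mult[OF Ck_SucD(1)[OF Suc.prems(1)] Ck_SucD(1)[OF Suc.prems(2)]]])
      (rule Ck_add[OF Suc.IH[OF Ck_Suc_imp[OF Suc.prems(1)] Ck_SucD(2)[OF Suc.prems(2)]]
          Suc.IH[OF Ck_SucD(2)[OF Suc.prems(1)] Ck_Suc_imp[OF Suc.prems(2)]]])
qed (auto intro: continuous_intros)

lemma Ck_cmult: "Ck k f \<Longrightarrow> Ck k (\<lambda>x. c * f x)"
  by (rule Ck_mult[OF Ck_const])

lemma has_derivative_reflect:
  assumes "(f has_derivative D) (at (a - x))"
  shows "((\<lambda>x. f (a - x)) has_derivative (\<lambda>h. - D h)) (at x)"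
proof -
  have D: "linear D" using assms has_derivative_linear by blast
  have "((\<lambda>x. f (a - x)) has_derivative (\<lambda>h. D (- h))) (at x)"
    by (rule has_derivative_compose[of "\<lambda>x. a - x" "\<lambda>h. - h" x UNIV f D, simplified])
      (auto intro!: derivative_eq_intros assms)
  then show ?thesis by (simp add: linear_neg[OF D])
qed

lemma Ck_reflect: "Ck k f \<Longrightarrow> Ck k (\<lambda>x. f (a - x))"
proof (induction k arbitrary: f)
  case (Suc k)
  have "Ck k (\<lambda>x. (-1) * frechet_derivative f (at (a - x)) i)" if "i \<in> Basis" for i
    by (rule Ck_cmult[OF Suc.IH[OF Ck_SucD(2)[OF Suc.prems that]]])
  then show ?case
    by (intro Ck_SucI[OF has_derivative_reflect[OF Ck_SucD(1)[OF Suc.prems]]]) simp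
next
  case 0
  then show ?case
    using continuous_on_compose2[of UNIV f UNIV "\<lambda>x. a - x"] by (simp add: continuous_on_diff)
qed

text \<open>A smooth function of one variable enters as the sequence \<open>F\<close> of its successive derivatives; this makes the
  induction on the order of differentiability go through.\<close>

lemma Ck_compose:
  assumes F: "\<And>n x. (F n has_real_derivative F (Suc n) x) (at x)" and q: "\<And>k. Ck k q"
  shows "Ck k (\<lambda>x. F n (q x))"
proof (induction k arbitrary: n)
  case 0
  have "continuous_on UNIV (F n)" using F DERIV_continuous_on by blast
  then show ?case using q[of 0] continuous_on_compose2[of UNIV "F n" UNIV q] by auto
next
  case (Suc k)
  have D: "((\<lambda>x. F n (q x)) has_derivative (\<lambda>h. F (Suc n) (q x) * frechet_derivative q (at x) h)) (at x)" for x
    using has_derivative_compose[OF Ck_SucD(1)[OF q[of "Suc 0"]] F[of n "q x", unfolded has_field_derivative_def]]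
    by simp
  show ?case
    by (rule Ck_SucI[OF D]) (rule Ck_mult[OF Suc.IH Ck_SucD(2)[OF q]])
qed

text \<open>For \<open>p = 1\<close> this is the classical function \<open>exp (- 1 / x)\<close>, extended by \<open>0\<close>.  The polynomial factor in
  \<open>1 / x\<close> makes the family closed under differentiation: the derivative of \<open>flat p\<close> is \<open>flat (X\<^sup>2 (p - p'))\<close>.\<close>

definition flat :: "real poly \<Rightarrow> real \<Rightarrow> real" where
  "flat p x = (if x \<le> 0 then 0 else poly p (inverse x) * exp (- inverse x))"

lemma poly_times_exp_tendsto_0: "((\<lambda>x. poly p x * exp (- x)) \<longlongrightarrow> (0::real)) at_top"
proof -
  have "((\<lambda>x. \<Sum>i\<le>degree p. coeff p i * (x ^ i / exp x)) \<longlongrightarrow> (\<Sum>i\<le>degree p. coeff p i * 0)) at_top"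
    by (intro tendsto_intros tendsto_power_div_exp_0)
  then show ?thesis
    by (simp add: poly_altdef exp_minus divide_inverse sum_distrib_right mult.assoc)
qed

lemma DERIV_flat: "(flat p has_real_derivative flat ([:0, 0, 1:] * (p - pderiv p)) x) (at x)"
proof -
  consider "x < 0" | "x = 0" | "0 < x" by linarith
  then show ?thesis
  proof cases
    case 1
    have "((\<lambda>x. 0) has_real_derivative 0) (at x)" by simp
    then have "(flat p has_real_derivative 0) (at x)"
      by (rule DERIV_cong_ev[THEN iffD1, rotated 3])
        (use 1 in \<open>auto simp: flat_def intro!: eventually_mono[OF eventually_nhds_in_open[of "{..<0}" x]]\<close>)
    then show ?thesis using 1 by (simp add: flat_def)
  next
    case 2
    have "((\<lambda>h. flat p h / h) \<longlongrightarrow> 0) (at 0)"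
    proof (rule filterlim_split_at)
      show "((\<lambda>h. flat p h / h) \<longlongrightarrow> 0) (at_left 0)"
        by (rule tendsto_eventually) (auto simp: flat_def eventually_at_left_field intro: exI[of _ "-1"])
      have "((\<lambda>h. poly ([:0, 1:] * p) (inverse h) * exp (- inverse h)) \<longlongrightarrow> (0::real)) (at_right 0)"
        by (rule filterlim_compose[OF poly_times_exp_tendsto_0 filterlim_inverse_at_top_right])
      then show "((\<lambda>h. flat p h / h) \<longlongrightarrow> 0) (at_right 0)"
        by (rule Lim_transform_eventually)
          (auto simp: flat_def eventually_at_right_field divide_inverse mult_ac intro: exI[of _ 1])
    qed
    then show ?thesis using 2 by (simp add: has_field_derivative_iff flat_def)
  next
    case 3
    have "((\<lambda>x. poly p (inverse x) * exp (- inverse x)) has_real_derivative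
        poly (pderiv p) (inverse x) * (- (inverse x)\<^sup>2) * exp (- inverse x)
         + exp (- inverse x) * (inverse x)\<^sup>2 * poly p (inverse x)) (at x)"
      using 3 by (auto intro!: derivative_eq_intros DERIV_chain2[of "poly p"] poly_DERIV simp: power2_eq_square)
    then have "(flat p has_real_derivative
        poly (pderiv p) (inverse x) * (- (inverse x)\<^sup>2) * exp (- inverse x)
         + exp (- inverse x) * (inverse x)\<^sup>2 * poly p (inverse x)) (at x)"
      by (rule DERIV_cong_ev[THEN iffD1, rotated 3])
        (use 3 in \<open>auto simp: flat_def intro!: eventually_mono[OF eventually_nhds_in_open[of "{0<..}" x]]\<close>)
    moreover have "poly (pderiv p) (inverse x) * (- (inverse x)\<^sup>2) * exp (- inverse x)
         + exp (- inverse x) * (inverse x)\<^sup>2 * poly p (inverse x)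
       = flat ([:0, 0, 1:] * (p - pderiv p)) x"
      using 3 by (simp add: flat_def power2_eq_square algebra_simps)
    ultimately show ?thesis by simp
  qed
qed

definition bump :: "real \<Rightarrow> 'a::euclidean_space \<Rightarrow> real" where
  "bump r z = flat [:1:] (1 - (z \<bullet> z) / r\<^sup>2)"

lemma Ck_bump: "Ck k (bump r :: 'a::euclidean_space \<Rightarrow> real)"
proof -
  have sq: "Ck k (\<lambda>z::'a. z \<bullet> z)" for k
  proof (cases k)
    case (Suc n)
    have "((\<lambda>z::'a. z \<bullet> z) has_derivative (\<lambda>h. 2 * (x \<bullet> h))) (at x)" for x
      by (auto intro!: derivative_eq_intros simp: inner_commute)
    then show ?thesis unfolding Suc by (rule Ck_SucI[where D = "\<lambda>x h. 2 * (x \<bullet> h)"]) (rule Ck_cmult[OF Ck_inner])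
  qed (auto intro!: continuous_intros)
  have q: "Ck k (\<lambda>z::'a. 1 + (- 1 / r\<^sup>2) * (z \<bullet> z))" for k
    by (intro Ck_add Ck_const Ck_cmult sq)
  define F where "F n = flat (((\<lambda>p. [:0, 0, 1:] * (p - pderiv p)) ^^ n) [:1:])" for n
  have "(F n has_real_derivative F (Suc n) x) (at x)" for n x
    unfolding F_def using DERIV_flat by simp
  from Ck_compose[of F, OF this q, of k 0]
  show ?thesis by (simp add: F_def bump_def[abs_def])
qed

lemma bump_nonneg: "0 \<le> bump r z"
  by (simp add: bump_def flat_def)

lemma bump_eq_0_iff:
  assumes "0 < r"
  shows "bump r z = 0 \<longleftrightarrow> r \<le> norm z"
proof -
  have "bump r z = 0 \<longleftrightarrow> 1 \<le> (z \<bullet> z) / r\<^sup>2"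
    by (simp add: bump_def flat_def)
  also have "\<dots> \<longleftrightarrow> r\<^sup>2 \<le> (norm z)\<^sup>2"
    using assms by (simp add: dot_square_norm pos_le_divide_eq)
  also have "\<dots> \<longleftrightarrow> r \<le> norm z"
    using assms by (simp add: power_mono_iff)
  finally show ?thesis .
qed

lemma frechet_derivative_outside_support:
  assumes "closure {x. f x \<noteq> 0} \<subseteq> S" "x \<notin> S"
  shows "frechet_derivative f (at x) = (\<lambda>h. 0 :: 'b::real_normed_vector)"
proof -
  have "open (- closure {x. f x \<noteq> 0})" "x \<in> - closure {x. f x \<noteq> 0}" using assms by auto
  moreover have "0 = f y" if "y \<in> - closure {x. f x \<noteq> 0}" for y
    using that closure_subset[of "{x. f x \<noteq> 0}"] by auto
  ultimately have "(f has_derivative (\<lambda>h. 0)) (at x)"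
    by (rule has_derivative_transform_within_open[OF has_derivative_const])
  then show ?thesis using frechet_derivative_at[of f "\<lambda>h. 0" x] by simp
qed

lemma compactly_supported_bounded:
  fixes f :: "'a::euclidean_space \<Rightarrow> real"
  assumes "continuous_on UNIV f" "bounded S" "\<And>x. x \<notin> S \<Longrightarrow> f x = 0"
  obtains M where "0 < M" "\<And>x. \<bar>f x\<bar> \<le> M"
proof -
  have "compact (f ` closure S)"
    using assms by (intro compact_continuous_image continuous_on_subset[OF assms(1)]) auto
  then have "bounded (f ` closure S)" by (rule compact_imp_bounded)
  then obtain B where B: "\<And>x. x \<in> closure S \<Longrightarrow> norm (f x) \<le> B"
    by (auto simp: bounded_iff)
  show thesis
  proof (rule that)
    show "\<bar>f x\<bar> \<le> max B 1" for x
    proof (cases "x \<in> S")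
      case True
      then have "x \<in> closure S" using closure_subset by auto
      then show ?thesis using B[of x] by simp
    qed (simp add: assms(3))
  qed simp
qed

lemma linear_functional_bound:
  fixes D :: "'a::euclidean_space \<Rightarrow> real" and M :: real
  assumes "linear D" "\<And>i. i \<in> Basis \<Longrightarrow> \<bar>D i\<bar> \<le> M"
  shows "\<bar>D h\<bar> \<le> (DIM('a) * M) * norm h"
proof -
  have "D (\<Sum>i\<in>Basis. (h \<bullet> i) *\<^sub>R i) = (\<Sum>i\<in>Basis. (h \<bullet> i) * D i)"
    by (simp add: linear_sum[OF assms(1)] linear_scale[OF assms(1)])
  then have "D h = (\<Sum>i\<in>Basis. (h \<bullet> i) * D i)"
    by (simp add: euclidean_representation)
  then have "\<bar>D h\<bar> \<le> (\<Sum>i\<in>Basis. \<bar>(h \<bullet> i) * D i\<bar>)"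
    by (simp only:) (rule sum_abs)
  also have "\<dots> \<le> (\<Sum>i\<in>(Basis::'a set). norm h * M)"
  proof (rule sum_mono)
    fix i :: 'a assume "i \<in> Basis"
    then show "\<bar>(h \<bullet> i) * D i\<bar> \<le> norm h * M"
      unfolding abs_mult using assms(2) by (intro mult_mono Basis_le_norm) auto
  qed
  finally show ?thesis by (simp add: mult_ac)
qed

lemma Ck_lipschitz:
  fixes f :: "'a::euclidean_space \<Rightarrow> real"
  assumes f: "Ck (Suc k) f" and S: "closure {x. f x \<noteq> 0} \<subseteq> S" "bounded S"
  shows "\<exists>M\<ge>0. \<forall>x y. \<bar>f x - f y\<bar> \<le> M * norm (x - y)"
proof -
  let ?D = "\<lambda>x. frechet_derivative f (at x)"
  have "\<exists>M. \<forall>x. \<bar>?D x i\<bar> \<le> M" if i: "i \<in> Basis" for i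
  proof (rule compactly_supported_bounded[of "\<lambda>x. ?D x i" S])
    show "continuous_on UNIV (\<lambda>x. ?D x i)" by (rule Ck_continuous[OF Ck_SucD(2)[OF f i]])
    show "?D x i = 0" if "x \<notin> S" for x
      by (simp add: frechet_derivative_outside_support[OF S(1) that])
  qed (use S in auto)
  then obtain B where B: "\<And>i x. i \<in> Basis \<Longrightarrow> \<bar>?D x i\<bar> \<le> B i" by metis
  define M where "M = (\<Sum>i\<in>Basis. \<bar>B i\<bar>)"
  have M: "\<bar>?D x i\<bar> \<le> M" if "i \<in> Basis" for i x
  proof -
    have "\<bar>B i\<bar> \<le> M" unfolding M_def by (rule member_le_sum) (use that in auto)
    then show ?thesis using B[OF that, of x] by linarith
  qed
  have "0 \<le> M" by (simp add: M_def sum_nonneg)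
  have "norm (f x - f y) \<le> (DIM('a) * M) * norm (x - y)" for x y
  proof (rule differentiable_bound[OF convex_UNIV])
    show "(f has_derivative ?D z) (at z within UNIV)" for z using Ck_SucD(1)[OF f] by simp
    show "onorm (?D z) \<le> DIM('a) * M" for z
    proof (rule onorm_le)
      fix h
      have "linear (?D z)" using Ck_SucD(1)[OF f] has_derivative_linear by blast
      then show "norm (?D z h) \<le> DIM('a) * M * norm h"
        using linear_functional_bound[of "?D z" M h] M by simp
    qed
  qed auto
  then have "\<bar>f x - f y\<bar> \<le> (DIM('a) * M) * norm (x - y)" for x y by simp
  then show ?thesis using \<open>0 \<le> M\<close> by (intro exI[of _ "DIM('a) * M"]) simp
qed

text \<open>A Taylor estimate that is uniform in the base point; it is what allows differentiation of a convolution under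
  the integral sign, for an integrable function as the other factor.\<close>

lemma Ck_taylor:
  fixes f :: "'a::euclidean_space \<Rightarrow> real"
  assumes f: "Ck 2 f" and S: "closure {x. f x \<noteq> 0} \<subseteq> S" "compact S"
  shows "\<exists>M\<ge>0. \<forall>x h. \<bar>f (x + h) - f x - frechet_derivative f (at x) h\<bar> \<le> M * (norm h)\<^sup>2"
proof -
  let ?D = "\<lambda>x. frechet_derivative f (at x)"
  have f2: "Ck (Suc (Suc 0)) f" using f by (simp add: numeral_2_eq_2)
  have "\<exists>M\<ge>0. \<forall>x y. \<bar>?D x i - ?D y i\<bar> \<le> M * norm (x - y)" if i: "i \<in> Basis" for i
  proof -
    have "?D x i = 0" if "x \<notin> S" for x
      by (simp add: frechet_derivative_outside_support[OF S(1) that])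
    then have "{x. ?D x i \<noteq> 0} \<subseteq> S" by blast
    then have "closure {x. ?D x i \<noteq> 0} \<subseteq> S"
      using S(2) by (simp add: closure_minimal compact_imp_closed)
    from Ck_lipschitz[OF Ck_SucD(2)[OF f2 i] this compact_imp_bounded[OF S(2)]]
    show ?thesis .
  qed
  then obtain B where B: "\<And>i. i \<in> Basis \<Longrightarrow> 0 \<le> B i"
    "\<And>i x y. i \<in> Basis \<Longrightarrow> \<bar>?D x i - ?D y i\<bar> \<le> B i * norm (x - y)" by metis
  define M where "M = (\<Sum>i\<in>Basis. B i)"
  have M0: "0 \<le> M" using B(1) by (simp add: M_def sum_nonneg)
  have M: "\<bar>?D x i - ?D y i\<bar> \<le> M * norm (x - y)" if i: "i \<in> Basis" for i x y
  proof -
    have "B i \<le> M" unfolding M_def by (rule member_le_sum) (use i B in auto)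
    then have "B i * norm (x - y) \<le> M * norm (x - y)" by (rule mult_right_mono) simp
    with B(2)[OF i, of x y] show ?thesis by (rule order_trans)
  qed
  have lin: "linear (?D z)" for z using Ck_SucD(1)[OF f2] has_derivative_linear by blast
  have "\<bar>f (x + h) - f x - ?D x h\<bar> \<le> (DIM('a) * M) * (norm h)\<^sup>2" for x h
  proof -
    have "norm (f (x + h) - f x - ?D x (x + h - x)) \<le> norm (x + h - x) * (DIM('a) * (M * norm h))"
    proof (rule differentiable_bound_linearization[of x "x + h" "cball x (norm h)"])
      show "x + t *\<^sub>R (x + h - x) \<in> cball x (norm h)" if "t \<in> {0..1}" for t
        using that by (simp add: dist_norm mult_left_le_one_le)
      show "(f has_derivative ?D z) (at z within cball x (norm h))" for z
        using Ck_SucD(1)[OF f2] has_derivative_at_withinI by blast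
      show "onorm (?D z - ?D x) \<le> DIM('a) * (M * norm h)" if z: "z \<in> cball x (norm h)" for z
      proof (rule onorm_le)
        fix k
        have "linear (\<lambda>k. ?D z k - ?D x k)" by (intro linear_compose_sub lin)
        moreover have "\<bar>?D z i - ?D x i\<bar> \<le> M * norm h" if "i \<in> Basis" for i
        proof -
          have "norm (z - x) \<le> norm h" using z by (simp add: dist_norm norm_minus_commute)
          then have "M * norm (z - x) \<le> M * norm h" using M0 by (rule mult_left_mono)
          with M[OF that, of z x] show ?thesis by (rule order_trans)
        qed
        ultimately show "norm ((?D z - ?D x) k) \<le> DIM('a) * (M * norm h) * norm k"
          using linear_functional_bound[of "\<lambda>k. ?D z k - ?D x k" "M * norm h" k] by simp
      qed
    qed auto
    then show ?thesis by (simp add: power2_eq_square mult_ac)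
  qed
  then show ?thesis using M0 by (intro exI[of _ "DIM('a) * M"]) simp
qed

section \<open>Borel representatives of weak gradients\<close>

lemma borel_extension:
  fixes f :: "'a::euclidean_space \<Rightarrow> 'b::euclidean_space"
  assumes O: "open \<Omega>" and f: "f \<in> borel_measurable (lebesgue_on \<Omega>)"
  shows "\<exists>f'\<in>borel_measurable borel. (\<forall>x. x \<notin> \<Omega> \<longrightarrow> f' x = 0) \<and> (AE x in lebesgue_on \<Omega>. f x = f' x)"
proof -
  have S: "\<Omega> \<in> sets borel" using O by simp
  then have S': "\<Omega> \<in> sets lebesgue" by simp
  define F where "F x = (if x \<in> \<Omega> then f x else 0)" for x
  have "F \<in> borel_measurable lebesgue"
    using f S' unfolding F_def by (simp add: borel_measurable_if)
  then have F: "(\<lambda>x. F x \<bullet> i) \<in> borel_measurable (completion lborel)" for i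
    by (rule borel_measurable_inner) simp
  have "\<exists>h\<in>borel_measurable lborel. AE x in lborel. F x \<bullet> i = h x" for i
    using completion_ex_borel_measurable_real[OF F[of i]] .
  then obtain h where h: "\<And>i. h i \<in> borel_measurable lborel" "\<And>i. AE x in lborel. F x \<bullet> i = h i x"
    by metis
  have hm [measurable]: "h i \<in> borel_measurable borel" for i using h(1) by simp
  define f' where "f' x = indicator \<Omega> x *\<^sub>R (\<Sum>i\<in>Basis. h i x *\<^sub>R i)" for x
  have "f' \<in> borel_measurable borel"
    unfolding f'_def using S by measurable
  moreover have "f' x = 0" if "x \<notin> \<Omega>" for x using that by (simp add: f'_def)
  moreover have "AE x in lebesgue_on \<Omega>. f x = f' x"
  proof -
    have "AE x in lborel. \<forall>i\<in>Basis. F x \<bullet> i = h i x"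
      by (rule AE_finite_allI[OF finite_Basis]) (rule h(2))
    then have "AE x in lebesgue. \<forall>i\<in>Basis. F x \<bullet> i = h i x" by (rule AE_completion)
    then have "AE x in lebesgue. x \<in> \<Omega> \<longrightarrow> f x = f' x"
    proof eventually_elim
      case (elim x)
      show ?case
      proof
        assume x: "x \<in> \<Omega>"
        have "f x = (\<Sum>i\<in>Basis. (f x \<bullet> i) *\<^sub>R i)" by (simp add: euclidean_representation)
        also have "\<dots> = (\<Sum>i\<in>Basis. h i x *\<^sub>R i)" using elim x by (intro sum.cong) (auto simp: F_def)
        finally show "f x = f' x" using x by (simp add: f'_def)
      qed
    qed
    then show ?thesis using S' by (simp add: AE_restrict_space_iff)
  qed
  ultimately show ?thesis by blast
qed

lemma lebesgue_on_transfer: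
  fixes f f' :: "'a::euclidean_space \<Rightarrow> 'b::{banach, second_countable_topology}"
  assumes O: "open \<Omega>" and f: "f \<in> borel_measurable (lebesgue_on \<Omega>)" and f': "f' \<in> borel_measurable borel"
    and 0: "\<And>x. x \<notin> \<Omega> \<Longrightarrow> f' x = 0" and ae: "AE x in lebesgue_on \<Omega>. f x = f' x"
  shows "(LINT x|lebesgue_on \<Omega>. f x) = (LINT x|lborel. f' x)"
    and "integrable (lebesgue_on \<Omega>) f \<longleftrightarrow> integrable lborel f'"
proof -
  have S: "\<Omega> \<inter> space lebesgue \<in> sets lebesgue" using O by simp
  have f'b: "f' \<in> borel_measurable lborel" using f' by simp
  then have "f' \<in> borel_measurable lebesgue" by (rule measurable_completion)
  then have m: "f' \<in> borel_measurable (lebesgue_on \<Omega>)" by (rule measurable_restrict_space1)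
  have ind: "(\<lambda>x. indicator \<Omega> x *\<^sub>R f' x) = f'" using 0 by (auto simp: indicator_def fun_eq_iff)
  have "(LINT x|lebesgue_on \<Omega>. f x) = (LINT x|lebesgue_on \<Omega>. f' x)"
    by (rule integral_cong_AE[OF f m ae])
  also have "\<dots> = (LINT x|lebesgue. f' x)"
    using integral_restrict_space[OF S, of f'] by (simp add: ind)
  also have "\<dots> = (LINT x|lborel. f' x)" by (rule integral_completion[OF f'b])
  finally show "(LINT x|lebesgue_on \<Omega>. f x) = (LINT x|lborel. f' x)" .
  have "integrable (lebesgue_on \<Omega>) f \<longleftrightarrow> integrable (lebesgue_on \<Omega>) f'"
    by (rule integrable_cong_AE[OF f m ae])
  also have "\<dots> \<longleftrightarrow> integrable lebesgue f'"
    using integrable_restrict_space[OF S, of f'] by (simp add: ind)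
  also have "\<dots> \<longleftrightarrow> integrable lborel f'" by (rule integrable_completion[OF f'b])
  finally show "integrable (lebesgue_on \<Omega>) f \<longleftrightarrow> integrable lborel f'" .
qed

text \<open>The weak gradient moved to the whole space: \<open>u\<close> and \<open>g\<close> are Borel functions that vanish off \<open>\<Omega>\<close>, and all
  integrals are with respect to \<open>lborel\<close>, so that one can translate, convolve and interchange integrals.  By the
  next lemma every weak gradient on an open set has a representative of this kind.\<close>

definition borel_weak_gradient ::
    "'a::euclidean_space set \<Rightarrow> ('a \<Rightarrow> real) \<Rightarrow> ('a \<Rightarrow> 'a) \<Rightarrow> bool" where
  "borel_weak_gradient \<Omega> u g \<longleftrightarrow>
     u \<in> borel_measurable borel \<and> g \<in> borel_measurable borel \<and>
     (\<forall>x. x \<notin> \<Omega> \<longrightarrow> u x = 0 \<and> g x = 0) \<and>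
     integrable lborel (\<lambda>x. (u x)\<^sup>2) \<and> integrable lborel (\<lambda>x. (norm (g x))\<^sup>2) \<and>
     (\<forall>\<phi>. test_function \<Omega> \<phi> \<longrightarrow>
        (\<forall>i\<in>Basis. (LINT x|lborel. u x * frechet_derivative \<phi> (at x) i)
                  = - (LINT x|lborel. (g x \<bullet> i) * \<phi> x)))"

lemma weak_gradient_borel:
  fixes \<Omega> :: "'a::euclidean_space set"
  assumes O: "open \<Omega>" and wg: "weak_gradient \<Omega> u g"
  obtains v G where "borel_weak_gradient \<Omega> v G"
    "AE x in lebesgue_on \<Omega>. u x = v x"
    "(LINT x|lebesgue_on \<Omega>. u x) = (LINT x|lborel. v x)"
    "(LINT x|lebesgue_on \<Omega>. (u x)\<^sup>2) = (LINT x|lborel. (v x)\<^sup>2)"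
    "(LINT x|lebesgue_on \<Omega>. (norm (g x))\<^sup>2) = (LINT x|lborel. (norm (G x))\<^sup>2)"
proof -
  have u [measurable]: "u \<in> borel_measurable (lebesgue_on \<Omega>)" and g [measurable]: "g \<in> borel_measurable (lebesgue_on \<Omega>)"
    and iu: "integrable (lebesgue_on \<Omega>) (\<lambda>x. (u x)\<^sup>2)"
    and ig: "integrable (lebesgue_on \<Omega>) (\<lambda>x. (norm (g x))\<^sup>2)"
    using wg by (auto simp: weak_gradient_def L2_on_def)
  obtain v where v [measurable]: "v \<in> borel_measurable borel" and v0: "\<And>x. x \<notin> \<Omega> \<Longrightarrow> v x = 0"
    and uv: "AE x in lebesgue_on \<Omega>. u x = v x"
    using borel_extension[OF O u] by blast
  obtain G where G [measurable]: "G \<in> borel_measurable borel" and G0: "\<And>x. x \<notin> \<Omega> \<Longrightarrow> G x = 0"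
    and gG: "AE x in lebesgue_on \<Omega>. g x = G x"
    using borel_extension[OF O g] by blast
  have u2: "(\<lambda>x. (u x)\<^sup>2) \<in> borel_measurable (lebesgue_on \<Omega>)" "(\<lambda>x. (v x)\<^sup>2) \<in> borel_measurable borel"
    "AE x in lebesgue_on \<Omega>. (u x)\<^sup>2 = (v x)\<^sup>2"
    using uv by auto
  have g2: "(\<lambda>x. (norm (g x))\<^sup>2) \<in> borel_measurable (lebesgue_on \<Omega>)"
    "(\<lambda>x. (norm (G x))\<^sup>2) \<in> borel_measurable borel"
    "AE x in lebesgue_on \<Omega>. (norm (g x))\<^sup>2 = (norm (G x))\<^sup>2"
    using gG by auto
  note tu = lebesgue_on_transfer[OF O u2(1,2) _ u2(3)] and tg = lebesgue_on_transfer[OF O g2(1,2) _ g2(3)]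
  have "(LINT x|lborel. v x * frechet_derivative \<phi> (at x) i) = - (LINT x|lborel. (G x \<bullet> i) * \<phi> x)"
    if \<phi>: "test_function \<Omega> \<phi>" and i: "i \<in> Basis" for \<phi> i
  proof -
    have C: "Ck (Suc 0) \<phi>" "Ck 0 \<phi>" using \<phi> by (auto simp: test_function_def)
    have [measurable]: "\<phi> \<in> borel_measurable borel"
      by (rule borel_measurable_continuous_onI[OF Ck_continuous[OF C(2)]])
    have [measurable]: "(\<lambda>x. frechet_derivative \<phi> (at x) i) \<in> borel_measurable borel"
      by (rule borel_measurable_continuous_onI[OF Ck_continuous[OF Ck_SucD(2)[OF C(1) i]]])
    have m: "h \<in> borel_measurable (lebesgue_on \<Omega>)" if "h \<in> borel_measurable borel" for h :: "'a \<Rightarrow> real"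
    proof -
      have "h \<in> borel_measurable lborel" using that by simp
      then show ?thesis by (intro measurable_restrict_space1 measurable_completion)
    qed
    have "(LINT x|lebesgue_on \<Omega>. u x * frechet_derivative \<phi> (at x) i) = (LINT x|lborel. v x * frechet_derivative \<phi> (at x) i)"
    proof (rule lebesgue_on_transfer(1)[OF O])
      show "(\<lambda>x. u x * frechet_derivative \<phi> (at x) i) \<in> borel_measurable (lebesgue_on \<Omega>)"
        by (intro borel_measurable_times u m) measurable
    qed (use v0 uv in auto)
    moreover have "(LINT x|lebesgue_on \<Omega>. (g x \<bullet> i) * \<phi> x) = (LINT x|lborel. (G x \<bullet> i) * \<phi> x)"
    proof (rule lebesgue_on_transfer(1)[OF O])
      show "(\<lambda>x. (g x \<bullet> i) * \<phi> x) \<in> borel_measurable (lebesgue_on \<Omega>)"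
        by (intro borel_measurable_times borel_measurable_inner g m) measurable
    qed (use G0 gG in auto)
    moreover have "(LINT x|lebesgue_on \<Omega>. u x * frechet_derivative \<phi> (at x) i)
        = - (LINT x|lebesgue_on \<Omega>. (g x \<bullet> i) * \<phi> x)"
      using wg \<phi> i unfolding weak_gradient_def by blast
    ultimately show ?thesis by linarith
  qed
  moreover have "integrable lborel (\<lambda>x. (v x)\<^sup>2)" using iu tu(2) v0 by simp
  moreover have "integrable lborel (\<lambda>x. (norm (G x))\<^sup>2)" using ig tg(2) G0 by simp
  ultimately have "borel_weak_gradient \<Omega> v G"
    unfolding borel_weak_gradient_def using v0 G0 v G by blast
  moreover have "(LINT x|lebesgue_on \<Omega>. u x) = (LINT x|lborel. v x)"
    by (rule lebesgue_on_transfer(1)[OF O u v v0 uv])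
  moreover have "(LINT x|lebesgue_on \<Omega>. (u x)\<^sup>2) = (LINT x|lborel. (v x)\<^sup>2)"
    by (rule tu(1)) (simp add: v0)
  moreover have "(LINT x|lebesgue_on \<Omega>. (norm (g x))\<^sup>2) = (LINT x|lborel. (norm (G x))\<^sup>2)"
    by (rule tg(1)) (simp add: G0)
  ultimately show thesis using uv by (intro that)
qed

lemma square_integrable_bounded_support:
  fixes f :: "'a::euclidean_space \<Rightarrow> 'b::{banach, second_countable_topology}"
  assumes O: "open \<Omega>" "bounded \<Omega>" and f: "f \<in> borel_measurable borel" "\<And>x. x \<notin> \<Omega> \<Longrightarrow> f x = 0"
    and i: "integrable lborel (\<lambda>x. (norm (f x))\<^sup>2)"
  shows "integrable lborel f"
proof (rule Bochner_Integration.integrable_bound)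
  have "emeasure lborel \<Omega> < \<infinity>" using O(2) by (rule emeasure_bounded_finite)
  then show "integrable lborel (\<lambda>x. indicator \<Omega> x + (norm (f x))\<^sup>2)"
    using i O by (intro Bochner_Integration.integrable_add integrable_real_indicator) auto
  have "norm (f x) \<le> indicator \<Omega> x + (norm (f x))\<^sup>2" for x
  proof (cases "x \<in> \<Omega>")
    case True
    have "0 \<le> (norm (f x) - 1)\<^sup>2" by simp
    then have "2 * norm (f x) \<le> 1 + (norm (f x))\<^sup>2" by (simp add: power2_diff)
    then have "norm (f x) \<le> 1 + (norm (f x))\<^sup>2" using norm_ge_zero[of "f x"] by linarith
    then show ?thesis using True by simp
  qed (simp add: f)
  then show "AE x in lborel. norm (f x) \<le> norm (indicator \<Omega> x + (norm (f x))\<^sup>2 :: real)"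
    by (intro AE_I2) (auto intro: order_trans[OF _ abs_ge_self])
qed (use f in simp)

section \<open>Convolutions\<close>

lemma lborel_distr_reflect: "distr lborel borel (\<lambda>y. x - y) = (lborel :: 'a::euclidean_space measure)"
proof -
  have "density (distr lborel borel (\<lambda>y. x + (- 1) *\<^sub>R y)) (\<lambda>_. ennreal (\<bar>- 1\<bar> ^ DIM('a))) = (lborel :: 'a measure)"
    by (rule lborel_affine[symmetric]) simp
  then show ?thesis by (simp add: density_1)
qed

lemma integral_reflect:
  fixes f :: "'a::euclidean_space \<Rightarrow> 'b::{banach, second_countable_topology}"
  assumes [measurable]: "f \<in> borel_measurable borel"
  shows "(LINT y|lborel. f (x - y)) = (LINT y|lborel. f y)"
    and "integrable lborel (\<lambda>y. f (x - y)) \<longleftrightarrow> integrable lborel f"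
proof -
  have "(LINT y|lborel. f y) = (LINT y|distr lborel borel (\<lambda>y. x - y). f y)"
    by (simp only: lborel_distr_reflect)
  also have "\<dots> = (LINT y|lborel. f (x - y))" by (subst integral_distr) auto
  finally show "(LINT y|lborel. f (x - y)) = (LINT y|lborel. f y)" by simp
  have "integrable lborel f \<longleftrightarrow> integrable (distr lborel borel (\<lambda>y. x - y)) f"
    by (simp only: lborel_distr_reflect)
  also have "\<dots> \<longleftrightarrow> integrable lborel (\<lambda>y. f (x - y))" by (subst integrable_distr_eq) auto
  finally show "integrable lborel (\<lambda>y. f (x - y)) \<longleftrightarrow> integrable lborel f" by simp
qed

lemma integrable_bounded_scaleR:
  fixes f :: "'a \<Rightarrow> 'b::{banach, second_countable_topology}" and k :: "'a \<Rightarrow> real"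
  assumes f: "integrable M f" and k: "k \<in> borel_measurable M" "\<And>x. \<bar>k x\<bar> \<le> B"
  shows "integrable M (\<lambda>x. k x *\<^sub>R f x)"
proof (rule Bochner_Integration.integrable_bound[OF integrable_scaleR_right[OF f, of B]])
  show "(\<lambda>x. k x *\<^sub>R f x) \<in> borel_measurable M"
    using k(1) f by (intro borel_measurable_scaleR) auto
  have "norm (k x *\<^sub>R f x) \<le> norm (B *\<^sub>R f x)" for x
  proof -
    have "\<bar>k x\<bar> \<le> \<bar>B\<bar>" using k(2)[of x] by linarith
    then show ?thesis by (simp add: mult_right_mono)
  qed
  then show "AE x in M. norm (k x *\<^sub>R f x) \<le> norm (B *\<^sub>R f x)" by simp
qed

lemma integrable_bounded_mult:
  fixes f k :: "'a \<Rightarrow> real"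
  assumes f: "integrable M f" and k: "k \<in> borel_measurable M" "\<And>x. \<bar>k x\<bar> \<le> B"
  shows "integrable M (\<lambda>x. f x * k x)"
  using integrable_bounded_scaleR[OF assms] by (simp add: mult.commute)

lemma convolution_has_derivative:
  fixes \<psi> u :: "'a::euclidean_space \<Rightarrow> real"
  assumes u: "integrable lborel u" and \<psi>: "\<And>k. Ck k \<psi>"
    and S: "closure {x. \<psi> x \<noteq> 0} \<subseteq> S" "compact S"
  shows "((\<lambda>x. LINT y|lborel. u y * \<psi> (x - y)) has_derivative
    (\<lambda>h. LINT y|lborel. u y * frechet_derivative \<psi> (at (x - y)) h)) (at x)"
proof -
  let ?D = "\<lambda>x. frechet_derivative \<psi> (at x)"
  have lin: "linear (?D z)" for z using Ck_SucD(1)[OF \<psi>[of "Suc 0"]] has_derivative_linear by blast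
  have S0: "\<psi> z = 0" if "z \<notin> S" for z using S(1) that closure_subset[of "{x. \<psi> x \<noteq> 0}"] by auto
  have D0: "?D z i = 0" if "z \<notin> S" for z i
    by (simp add: frechet_derivative_outside_support[OF S(1) that])
  have bS: "bounded S" using S(2) by (rule compact_imp_bounded)
  have c\<psi>: "continuous_on UNIV \<psi>" by (rule Ck_continuous[OF \<psi>])
  have [measurable]: "\<psi> \<in> borel_measurable borel" by (rule borel_measurable_continuous_onI[OF c\<psi>])
  obtain B where B: "\<And>x. \<bar>\<psi> x\<bar> \<le> B"
    using compactly_supported_bounded[OF c\<psi> bS S0] by metis
  have i\<psi>: "integrable lborel (\<lambda>y. u y * \<psi> (z - y))" for z
    by (rule integrable_bounded_mult[OF u _ B]) measurable
  have iD: "integrable lborel (\<lambda>y. u y * ?D (z - y) h)" for z h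
  proof -
    have "continuous_on UNIV (\<lambda>z. \<Sum>i\<in>Basis. (h \<bullet> i) * ?D z i)"
      by (intro continuous_intros Ck_continuous[OF Ck_SucD(2)[OF \<psi>]]) auto
    moreover have "(\<Sum>i\<in>Basis. (h \<bullet> i) * ?D z i) = ?D z h" for z
    proof -
      have "?D z (\<Sum>i\<in>Basis. (h \<bullet> i) *\<^sub>R i) = (\<Sum>i\<in>Basis. (h \<bullet> i) * ?D z i)"
        by (simp add: linear_sum[OF lin] linear_scale[OF lin])
      then show ?thesis by (simp add: euclidean_representation)
    qed
    ultimately have c: "continuous_on UNIV (\<lambda>z. ?D z h)" by simp
    then have [measurable]: "(\<lambda>z. ?D z h) \<in> borel_measurable borel"
      by (rule borel_measurable_continuous_onI)
    obtain B where B: "\<And>x. \<bar>?D x h\<bar> \<le> B"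
      using compactly_supported_bounded[OF c bS D0] by metis
    show ?thesis by (rule integrable_bounded_mult[OF u _ B]) measurable
  qed
  obtain M where M: "0 \<le> M" "\<And>x h. \<bar>\<psi> (x + h) - \<psi> x - ?D x h\<bar> \<le> M * (norm h)\<^sup>2"
    using Ck_taylor[OF \<psi> S] by blast
  define U where "U z = (LINT y|lborel. u y * \<psi> (z - y))" for z
  define U' where "U' h = (LINT y|lborel. u y * ?D (x - y) h)" for h
  define A where "A = (LINT y|lborel. \<bar>u y\<bar>) * M"
  have "linear U'"
  proof (rule linearI)
    show "U' (h + k) = U' h + U' k" for h k
      unfolding U'_def by (simp add: linear_add[OF lin] distrib_left iD)
    show "U' (c *\<^sub>R h) = c *\<^sub>R U' h" for c h
      unfolding U'_def by (simp add: linear_scale[OF lin] mult.left_commute)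
  qed
  then have bl: "bounded_linear U'" by (simp add: linear_conv_bounded_linear)
  have est: "\<bar>U z - U x - U' (z - x)\<bar> \<le> A * (norm (z - x))\<^sup>2" for z
  proof -
    let ?r = "\<lambda>y. u y * \<psi> (z - y) - u y * \<psi> (x - y) - u y * ?D (x - y) (z - x)"
    have ir: "integrable lborel ?r" by (intro Bochner_Integration.integrable_diff i\<psi> iD)
    have "U z - U x - U' (z - x) = (LINT y|lborel. ?r y)"
      unfolding U_def U'_def by (simp add: i\<psi> iD)
    also have "\<bar>LINT y|lborel. ?r y\<bar> \<le> (LINT y|lborel. \<bar>u y\<bar> * (M * (norm (z - x))\<^sup>2))"
    proof (rule order_trans[OF integral_abs_bound], rule integral_mono)
      show "integrable lborel (\<lambda>y. \<bar>?r y\<bar>)" using ir by (rule integrable_abs)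
      show "integrable lborel (\<lambda>y. \<bar>u y\<bar> * (M * (norm (z - x))\<^sup>2))" using u by simp
      fix y
      have "?r y = u y * (\<psi> (z - y) - \<psi> (x - y) - ?D (x - y) (z - x))" by (simp add: algebra_simps)
      moreover have "\<bar>\<psi> (z - y) - \<psi> (x - y) - ?D (x - y) (z - x)\<bar> \<le> M * (norm (z - x))\<^sup>2"
        using M(2)[of "x - y" "z - x"] by simp
      ultimately show "\<bar>?r y\<bar> \<le> \<bar>u y\<bar> * (M * (norm (z - x))\<^sup>2)"
        by (simp add: abs_mult mult_left_mono)
    qed
    also have "\<dots> = A * (norm (z - x))\<^sup>2" by (simp add: A_def)
    finally show ?thesis .
  qed
  have "(U has_derivative U') (at x)"
    unfolding has_derivative_iff_norm
  proof (intro conjI bl)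
    show "((\<lambda>z. norm (U z - U x - U' (z - x)) / norm (z - x)) \<longlongrightarrow> 0) (at x)"
    proof (rule Lim_null_comparison)
      show "\<forall>\<^sub>F z in at x. norm (norm (U z - U x - U' (z - x)) / norm (z - x)) \<le> A * norm (z - x)"
      proof (rule always_eventually, rule allI)
        fix z
        show "norm (norm (U z - U x - U' (z - x)) / norm (z - x)) \<le> A * norm (z - x)"
        proof (cases "z = x")
          case False
          then show ?thesis using est[of z]
            by (simp add: pos_divide_le_eq power2_eq_square mult.assoc)
        qed simp
      qed
      have "((\<lambda>z. A * norm (z - x)) \<longlongrightarrow> A * norm (x - x)) (at x)"
        by (intro tendsto_intros)
      then show "((\<lambda>z. A * norm (z - x)) \<longlongrightarrow> 0) (at x)" by simp
    qed
  qed
  then show ?thesis unfolding U_def[abs_def] U'_def[abs_def] .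
qed

text \<open>Translation invariance: the convolution of \<open>\<psi>\<close> with the indicator of a large ball is constant near the
  origin, so its derivative there vanishes.  The previous lemma computes this derivative as the integral in
  question (up to a reflection).\<close>

lemma integral_derivative_compact_support:
  fixes \<psi> :: "'a::euclidean_space \<Rightarrow> real"
  assumes \<psi>: "\<And>k. Ck k \<psi>" and S: "closure {x. \<psi> x \<noteq> 0} \<subseteq> S" "compact S" and i: "i \<in> Basis"
  shows "(LINT y|lborel. frechet_derivative \<psi> (at y) i) = 0"
proof -
  let ?D = "\<lambda>x. frechet_derivative \<psi> (at x)"
  obtain R where R: "\<And>x. x \<in> S \<Longrightarrow> norm x \<le> R" 
    using compact_imp_bounded[OF S(2)] by (auto simp: bounded_iff)
  have S0: "\<psi> z = 0" if "z \<notin> S" for z using S(1) that closure_subset[of "{x. \<psi> x \<noteq> 0}"] by auto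
  have D0: "?D z i = 0" if "z \<notin> S" for z i
    by (simp add: frechet_derivative_outside_support[OF S(1) that])
  define u :: "'a \<Rightarrow> real" where "u = indicator (cball 0 (R + 1))"
  have u: "integrable lborel u"
    unfolding u_def by (intro integrable_real_indicator emeasure_bounded_finite) auto
  have u1: "u y = 1" if "norm x \<le> 1" "x - y \<in> S" for x y
  proof -
    have "norm y \<le> norm x + norm (x - y)" using norm_triangle_ineq4[of x "x - y"] by simp
    then show ?thesis using that R[of "x - y"] by (simp add: u_def)
  qed
  have [measurable]: "\<psi> \<in> borel_measurable borel" "(\<lambda>z. ?D z i) \<in> borel_measurable borel"
    by (rule borel_measurable_continuous_onI[OF Ck_continuous[OF \<psi>]]
        borel_measurable_continuous_onI[OF Ck_continuous[OF Ck_SucD(2)[OF \<psi> i]]])+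
  define U where "U x = (LINT y|lborel. u y * \<psi> (x - y))" for x
  have U: "U x = (LINT y|lborel. \<psi> y)" if "x \<in> ball 0 1" for x
  proof -
    have "u y * \<psi> (x - y) = \<psi> (x - y)" for y
      using u1[of x y] S0[of "x - y"] that by (cases "x - y \<in> S") auto
    then have "U x = (LINT y|lborel. \<psi> (x - y))"
      unfolding U_def by (rule Bochner_Integration.integral_cong[OF refl])
    then show ?thesis by (simp add: integral_reflect(1))
  qed
  have "(U has_derivative (\<lambda>h. 0)) (at 0)"
    by (rule has_derivative_transform_within_open[OF has_derivative_const, of "ball 0 1"]) (auto simp: U)
  moreover have "(U has_derivative (\<lambda>h. LINT y|lborel. u y * ?D (0 - y) h)) (at 0)"
    unfolding U_def[abs_def] by (rule convolution_has_derivative[OF u \<psi> S])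
  ultimately have "(\<lambda>h. 0) = (\<lambda>h. LINT y|lborel. u y * ?D (0 - y) h)"
    by (rule has_derivative_unique)
  then have "(LINT y|lborel. u y * ?D (0 - y) i) = 0" by metis
  moreover have "(LINT y|lborel. u y * ?D (0 - y) i) = (LINT y|lborel. ?D (0 - y) i)"
  proof (intro Bochner_Integration.integral_cong refl)
    show "u y * ?D (0 - y) i = ?D (0 - y) i" for y
      using u1[of 0 y] D0[of "0 - y" i] by (cases "0 - y \<in> S") auto
  qed
  ultimately have "(LINT y|lborel. ?D (0 - y) i) = 0" by linarith
  moreover have "(LINT y|lborel. ?D (0 - y) i) = (LINT y|lborel. ?D y i)"
    by (rule integral_reflect(1)) measurable
  ultimately show ?thesis by (simp only:)
qed

lemma convolution_pair_integrable:
  fixes k w :: "'a::euclidean_space \<Rightarrow> real"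
  assumes k: "integrable lborel k" and w: "integrable lborel w"
  shows "integrable (lborel \<Otimes>\<^sub>M lborel) (\<lambda>(y, x). k (x - y) * w y)"
proof (rule lborel_pair.Fubini_integrable)
  have [measurable]: "k \<in> borel_measurable borel" "w \<in> borel_measurable borel" using k w by auto
  show "(\<lambda>(y, x). k (x - y) * w y) \<in> borel_measurable (lborel \<Otimes>\<^sub>M lborel)" by measurable
  have tr: "integrable lborel (\<lambda>x. f (x - y)) \<and> (LINT x|lborel. f (x - y)) = (LINT x|lborel. f x)"
    if [measurable]: "f \<in> borel_measurable borel" and f: "integrable lborel f" for f :: "'a \<Rightarrow> real" and y
  proof -
    have 1: "(LINT x|lborel. f (- x)) = (LINT x|lborel. f x)" "integrable lborel (\<lambda>x. f (- x))"
      using integral_reflect[of f 0] f by auto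
    have "(LINT x|lborel. f (- (y - x))) = (LINT x|lborel. f (- x))"
      "integrable lborel (\<lambda>x. f (- (y - x)))"
      using integral_reflect[of "\<lambda>x. f (- x)" y] 1 by auto
    then show ?thesis using 1 by simp
  qed
  have "integrable lborel (\<lambda>x. k (x - y))" for y using tr[of k y] k by simp
  then show "AE y in lborel. integrable lborel (\<lambda>x. case (y, x) of (y, x) \<Rightarrow> k (x - y) * w y)"
    by simp
  have "(LINT x|lborel. norm (k (x - y) * w y)) = (LINT x|lborel. \<bar>k x\<bar>) * \<bar>w y\<bar>" for y
    using tr[of "\<lambda>x. \<bar>k x\<bar>" y] k by (simp add: abs_mult)
  then show "integrable lborel (\<lambda>y. LINT x|lborel. norm (case (y, x) of (y, x) \<Rightarrow> k (x - y) * w y))"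
    using w by simp
qed

lemma convolution_integral:
  fixes k w :: "'a::euclidean_space \<Rightarrow> real"
  assumes k: "integrable lborel k" "(LINT x|lborel. k x) = 1" and w: "integrable lborel w"
  shows "integrable lborel (\<lambda>x. LINT y|lborel. k (x - y) * w y)"
    and "(LINT x|lborel. LINT y|lborel. k (x - y) * w y) = (LINT y|lborel. w y)"
proof -
  note P = convolution_pair_integrable[OF k(1) w]
  show "integrable lborel (\<lambda>x. LINT y|lborel. k (x - y) * w y)"
    using lborel_pair.integrable_snd[OF P] .
  have [measurable]: "k \<in> borel_measurable borel" using k by auto
  have tr: "(LINT x|lborel. k (x - y)) = 1" for y
  proof -
    have "(LINT x|lborel. k (- (y - x))) = (LINT x|lborel. k (- x))"
      by (rule integral_reflect(1)[of "\<lambda>x. k (- x)" y]) measurable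
    then show ?thesis using integral_reflect(1)[of k 0] k by simp
  qed
  have "(LINT x|lborel. LINT y|lborel. k (x - y) * w y) = (LINT y|lborel. LINT x|lborel. k (x - y) * w y)"
    using lborel_pair.Fubini_integral[OF P] .
  also have "\<dots> = (LINT y|lborel. w y)" by (simp add: tr)
  finally show "(LINT x|lborel. LINT y|lborel. k (x - y) * w y) = (LINT y|lborel. w y)" .
qed

text \<open>The variance of \<open>g\<close> with respect to the probability density \<open>k\<close> is nonnegative.\<close>

lemma jensen_norm_square:
  fixes g :: "'a \<Rightarrow> 'b::euclidean_space" and k :: "'a \<Rightarrow> real"
  assumes k: "\<And>x. 0 \<le> k x" "integrable M k" "(LINT x|M. k x) = 1"
    and g: "integrable M (\<lambda>x. k x *\<^sub>R g x)" "integrable M (\<lambda>x. k x * (norm (g x))\<^sup>2)"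
  shows "(norm (LINT x|M. k x *\<^sub>R g x))\<^sup>2 \<le> (LINT x|M. k x * (norm (g x))\<^sup>2)"
proof -
  define m where "m = (LINT x|M. k x *\<^sub>R g x)"
  have "0 \<le> (LINT x|M. k x * (norm (g x - m))\<^sup>2)"
    using k(1) by (intro integral_nonneg_AE) auto
  also have "(\<lambda>x. k x * (norm (g x - m))\<^sup>2)
      = (\<lambda>x. k x * (norm (g x))\<^sup>2 - 2 * ((k x *\<^sub>R g x) \<bullet> m) + k x * (norm m)\<^sup>2)"
    by (simp add: power2_norm_eq_inner inner_diff_left inner_diff_right inner_commute algebra_simps fun_eq_iff)
  also have "(LINT x|M. \<dots> x) = (LINT x|M. k x * (norm (g x))\<^sup>2)
      - 2 * (LINT x|M. (k x *\<^sub>R g x) \<bullet> m) + (LINT x|M. k x * (norm m)\<^sup>2)"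
    using k g integrable_inner_left[OF g(1), of m] by simp
  also have "(LINT x|M. (k x *\<^sub>R g x) \<bullet> m) = m \<bullet> m"
    unfolding m_def using g(1) by (intro integral_inner_left) auto
  also have "(LINT x|M. k x * (norm m)\<^sup>2) = m \<bullet> m"
    using k by (simp add: power2_norm_eq_inner)
  finally show ?thesis unfolding m_def[symmetric] by (simp add: power2_norm_eq_inner)
qed

section \<open>Mollification\<close>

text \<open>Truncate \<open>u\<close> at height \<open>m\<close>.  A measurable function is an almost everywhere limit of continuous functions;
  truncated at the same height and cut off outside a ball, these are dominated and hence converge in \<open>L\<^sup>1\<close>.\<close>

lemma L1_approx_continuous:
  fixes u :: "'a::euclidean_space \<Rightarrow> real"
  assumes u: "integrable lborel u" and R: "\<And>x. x \<notin> cball 0 R \<Longrightarrow> u x = 0" and e: "0 < e"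
  shows "\<exists>\<phi>. continuous_on UNIV \<phi> \<and> integrable lborel \<phi> \<and> (LINT x|lborel. \<bar>u x - \<phi> x\<bar>) < e"
proof -
  have [measurable]: "u \<in> borel_measurable borel" using u by auto
  define c where "c m x = max (- real m) (min (real m) (u x))" for m x
  have c_le: "\<bar>c m x\<bar> \<le> \<bar>u x\<bar>" "\<bar>c m x\<bar> \<le> real m" for m x by (auto simp: c_def)
  have [measurable]: "c m \<in> borel_measurable borel" for m unfolding c_def by measurable
  have c_int: "integrable lborel (c m)" for m
    by (rule Bochner_Integration.integrable_bound[OF u]) (use c_le in auto)
  have "(\<lambda>m. LINT x|lborel. \<bar>u x - c m x\<bar>) \<longlonglongrightarrow> (LINT x|(lborel::'a measure). 0)"
  proof (rule integral_dominated_convergence[where w = "\<lambda>x. 2 * \<bar>u x\<bar>"])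
    show "AE x in lborel. (\<lambda>m. \<bar>u x - c m x\<bar>) \<longlonglongrightarrow> 0"
    proof (rule AE_I2, rule tendsto_eventually)
      fix x
      obtain N :: nat where "\<bar>u x\<bar> \<le> N" using real_arch_simple by blast
      then have "\<bar>u x - c m x\<bar> = 0" if "m \<ge> N" for m using that by (auto simp: c_def)
      then show "\<forall>\<^sub>F m in sequentially. \<bar>u x - c m x\<bar> = 0"
        by (auto simp: eventually_sequentially)
    qed
    have "\<bar>u x - c m x\<bar> \<le> 2 * \<bar>u x\<bar>" for m x using c_le(1)[of m x] by linarith
    then show "AE x in lborel. norm \<bar>u x - c m x\<bar> \<le> 2 * \<bar>u x\<bar>" for m by simp
  qed (use u in auto)
  then have "\<forall>\<^sub>F m in sequentially. (LINT x|lborel. \<bar>u x - c m x\<bar>) < e / 2"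
    using e by (intro order_tendstoD(2)) auto
  then obtain m where m: "(LINT x|lborel. \<bar>u x - c m x\<bar>) < e / 2"
    by (auto simp: eventually_sequentially)
  have "c m \<in> borel_measurable lebesgue"
    by (rule measurable_completion) simp
  then have "c m measurable_on UNIV" by (rule lebesgue_measurable_imp_measurable_on) simp
  then obtain N g where N: "negligible N" and g: "\<And>n. continuous_on UNIV (g n)"
    and lim: "\<And>x. x \<notin> N \<Longrightarrow> (\<lambda>n. g n x) \<longlonglongrightarrow> c m x"
    unfolding measurable_on_def by auto
  define \<eta> where "\<eta> x = max 0 (min 1 (R + 1 - norm x))" for x :: 'a
  have \<eta>: "0 \<le> \<eta> x" "\<eta> x \<le> 1" "x \<in> cball 0 R \<Longrightarrow> \<eta> x = 1" "x \<notin> cball 0 (R + 1) \<Longrightarrow> \<eta> x = 0" for x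
    by (auto simp: \<eta>_def)
  define \<phi> where "\<phi> n x = max (- real m) (min (real m) (g n x)) * \<eta> x" for n x
  have c\<phi>: "continuous_on UNIV (\<phi> n)" for n
    unfolding \<phi>_def[abs_def] \<eta>_def by (intro continuous_intros g)
  have [measurable]: "\<phi> n \<in> borel_measurable borel" for n
    by (rule borel_measurable_continuous_onI[OF c\<phi>])
  have iB: "integrable lborel (\<lambda>x::'a. real m * indicator (cball 0 (R + 1)) x)"
    by (intro integrable_mult_right integrable_real_indicator emeasure_bounded_finite) auto
  have b\<phi>: "\<bar>\<phi> n x\<bar> \<le> real m * indicator (cball 0 (R + 1)) x" for n x
  proof (cases "x \<in> cball 0 (R + 1)")
    case True
    have "\<bar>\<phi> n x\<bar> \<le> real m * 1"
      unfolding \<phi>_def abs_mult by (intro mult_mono) (use \<eta>[of x] in auto)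
    then show ?thesis using True by simp
  next
    case False
    then show ?thesis using \<eta>(4)[OF False] by (simp add: \<phi>_def)
  qed
  have i\<phi>: "integrable lborel (\<phi> n)" for n
  proof (rule Bochner_Integration.integrable_bound[OF iB])
    show "AE x in lborel. norm (\<phi> n x) \<le> norm (real m * indicator (cball 0 (R + 1)) x :: real)"
      by (intro AE_I2) (metis b\<phi> abs_ge_self order_trans real_norm_def)
  qed simp
  have "(\<lambda>n. LINT x|lborel. \<bar>c m x - \<phi> n x\<bar>) \<longlonglongrightarrow> (LINT x|(lborel::'a measure). 0)"
  proof (rule integral_dominated_convergence[where w = "\<lambda>x. \<bar>c m x\<bar> + real m * indicator (cball 0 (R + 1)) x"])
    have "N \<in> null_sets lebesgue" using N by (simp add: negligible_iff_null_sets)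
    then have "AE x in lebesgue. x \<notin> N" by (rule AE_not_in)
    then have "AE x in lborel. x \<notin> N" by (simp add: AE_completion_iff)
    then show "AE x in lborel. (\<lambda>n. \<bar>c m x - \<phi> n x\<bar>) \<longlonglongrightarrow> 0"
    proof eventually_elim
      case (elim x)
      have "(\<lambda>n. max (- real m) (min (real m) (g n x)) * \<eta> x) \<longlonglongrightarrow> max (- real m) (min (real m) (c m x)) * \<eta> x"
        by (intro tendsto_intros lim elim)
      moreover have "max (- real m) (min (real m) (c m x)) = c m x" using c_le(2)[of m x] by auto
      moreover have "c m x * \<eta> x = c m x"
        using \<eta>(3)[of x] c_le(1)[of m x] R[of x] by (cases "x \<in> cball 0 R") auto
      ultimately have "(\<lambda>n. \<phi> n x) \<longlonglongrightarrow> c m x" unfolding \<phi>_def by simp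
      then have "(\<lambda>n. \<bar>c m x - \<phi> n x\<bar>) \<longlonglongrightarrow> \<bar>c m x - c m x\<bar>" by (intro tendsto_intros)
      then show ?case by simp
    qed
    have "\<bar>c m x - \<phi> n x\<bar> \<le> \<bar>c m x\<bar> + real m * indicator (cball 0 (R + 1)) x" for n x
      using b\<phi>[of n x] by linarith
    then show "AE x in lborel. norm \<bar>c m x - \<phi> n x\<bar> \<le> \<bar>c m x\<bar> + real m * indicator (cball 0 (R + 1)) x" for n
      by simp
  qed (use c_int iB in auto)
  then have "\<forall>\<^sub>F n in sequentially. (LINT x|lborel. \<bar>c m x - \<phi> n x\<bar>) < e / 2"
    using e by (intro order_tendstoD(2)) auto
  then obtain n where n: "(LINT x|lborel. \<bar>c m x - \<phi> n x\<bar>) < e / 2"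
    by (auto simp: eventually_sequentially)
  have "(LINT x|lborel. \<bar>u x - \<phi> n x\<bar>) \<le> (LINT x|lborel. \<bar>u x - c m x\<bar> + \<bar>c m x - \<phi> n x\<bar>)"
    using u c_int i\<phi> by (intro integral_mono) auto
  also have "\<dots> < e" using m n u c_int i\<phi> by (subst Bochner_Integration.integral_add) auto
  finally show ?thesis using c\<phi> i\<phi> by blast
qed

definition mollifier :: "real \<Rightarrow> 'a::euclidean_space \<Rightarrow> real" where
  "mollifier r z = bump r z / (LINT y|(lborel::'a measure). bump r y)"

lemma bump_integral:
  fixes r :: real
  assumes r: "0 < r"
  shows "integrable lborel (bump r :: 'a::euclidean_space \<Rightarrow> real)" "0 < (LINT y|(lborel::'a measure). bump r y)"
proof -
  let ?b = "bump r :: 'a \<Rightarrow> real"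
  have b0: "?b z = 0" if "z \<notin> ball 0 r" for z using bump_eq_0_iff[OF r, of z] that by simp
  have b: "?b z \<noteq> 0" if "z \<in> ball 0 r" for z using bump_eq_0_iff[OF r, of z] that by simp
  have c: "continuous_on UNIV ?b" by (rule Ck_continuous[OF Ck_bump])
  have [measurable]: "?b \<in> borel_measurable borel" by (rule borel_measurable_continuous_onI[OF c])
  obtain B where B: "\<And>z. \<bar>?b z\<bar> \<le> B" using compactly_supported_bounded[OF c bounded_ball b0] by metis
  have "integrable lborel (\<lambda>z::'a. B * indicator (ball 0 r) z)"
    by (intro integrable_mult_right integrable_real_indicator emeasure_bounded_finite) auto
  then show i: "integrable lborel ?b"
  proof (rule Bochner_Integration.integrable_bound)
    have "\<bar>?b z\<bar> \<le> \<bar>B * indicator (ball 0 r) z\<bar>" for z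
      using B[of z] b0[of z] by (cases "z \<in> ball 0 r") auto
    then show "AE z in lborel. norm (?b z) \<le> norm (B * indicator (ball 0 r) z)" by simp
  qed simp
  have "0 \<le> (LINT y|lborel. ?b y)" by (intro integral_nonneg_AE) (auto simp: bump_nonneg)
  moreover have "(LINT y|lborel. ?b y) \<noteq> 0"
  proof
    assume "(LINT y|lborel. ?b y) = 0"
    then have "AE y in lborel. ?b y = 0"
      using integral_nonneg_eq_0_iff_AE[OF i] by (simp add: bump_nonneg)
    then have "AE y in (lborel::'a measure). y \<notin> ball 0 r" by (rule eventually_mono) (use b in blast)
    then have "emeasure lborel (ball (0::'a) r) = 0" by (subst (asm) AE_iff_measurable[of "ball 0 r"]) auto
    then have "measure lborel (ball (0::'a) r) = 0" by (simp add: measure_def)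
    then show False using content_ball_pos[OF r, of "0::'a"] by simp
  qed
  ultimately show "0 < (LINT y|lborel. ?b y)" by simp
qed

context
  fixes r :: real
  assumes r: "0 < r"
begin

lemma Ck_mollifier: "Ck k (mollifier r :: 'a::euclidean_space \<Rightarrow> real)"
  using Ck_cmult[OF Ck_bump, of k "inverse (LINT y|(lborel::'a measure). bump r y)" r]
  by (simp add: mollifier_def[abs_def] divide_inverse mult.commute)

lemma mollifier_nonneg: "0 \<le> mollifier r (z :: 'a::euclidean_space)"
  unfolding mollifier_def using bump_integral(2)[OF r, where 'a = 'a]
  by (intro divide_nonneg_nonneg) (auto simp: bump_nonneg)

lemma mollifier_outside: "r \<le> norm z \<Longrightarrow> mollifier r (z :: 'a::euclidean_space) = 0"
  unfolding mollifier_def using bump_eq_0_iff[OF r, of z] by simp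

lemma mollifier_integral:
  "integrable lborel (mollifier r :: 'a::euclidean_space \<Rightarrow> real)"
  "(LINT z|(lborel::'a measure). mollifier r z) = 1"
  using bump_integral[OF r, where 'a = 'a] by (auto simp: mollifier_def[abs_def])

lemma mollifier_support:
  "closure {z :: 'a::euclidean_space. mollifier r z \<noteq> 0} \<subseteq> cball 0 r"
  "closure {z :: 'a::euclidean_space. mollifier r (x - z) \<noteq> 0} \<subseteq> cball x r"
proof -
  show "closure {z :: 'a::euclidean_space. mollifier r z \<noteq> 0} \<subseteq> cball 0 r"
  proof (rule closure_minimal)
    show "{z :: 'a. mollifier r z \<noteq> 0} \<subseteq> cball 0 r"
    proof
      fix z :: 'a assume "z \<in> {z. mollifier r z \<noteq> 0}"
      then show "z \<in> cball 0 r" using mollifier_outside[of z] by (cases "r \<le> norm z") auto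
    qed
  qed simp
  show "closure {z :: 'a::euclidean_space. mollifier r (x - z) \<noteq> 0} \<subseteq> cball x r"
  proof (rule closure_minimal)
    show "{z :: 'a. mollifier r (x - z) \<noteq> 0} \<subseteq> cball x r"
    proof
      fix z :: 'a assume "z \<in> {z. mollifier r (x - z) \<noteq> 0}"
      then show "z \<in> cball x r"
        using mollifier_outside[of "x - z"] by (cases "r \<le> norm (x - z)") (auto simp: dist_norm)
    qed
  qed simp
qed

lemma test_function_mollifier:
  fixes x :: "'a::euclidean_space"
  assumes "cball x r \<subseteq> \<Omega>"
  shows "test_function \<Omega> (\<lambda>y. mollifier r (x - y))"
  unfolding test_function_def
proof (intro conjI allI)
  show "Ck k (\<lambda>y. mollifier r (x - y))" for k by (rule Ck_reflect[OF Ck_mollifier])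
  show "closure {y. mollifier r (x - y) \<noteq> 0} \<subseteq> \<Omega>" using mollifier_support(2) assms by blast
  show "compact (closure {y. mollifier r (x - y) \<noteq> 0})"
    using mollifier_support(2)[of x] bounded_subset[OF bounded_cball[of x r]]
    by (auto simp: compact_eq_bounded_closed)
qed

end

text \<open>A bound on the energy together with \<open>L\<^sup>1\<close>-approximation is what a lower bound of the Rayleigh quotient asks
  for, since Fatou's lemma takes care of the \<open>L\<^sup>2\<close> norm.  At points of \<open>K\<close> the gradient of the mollified function
  is the mollified weak gradient, because there the support of the translated mollifier stays inside \<open>\<Omega>\<close>,
  so that it is a test function.\<close>

lemma mollify:
  fixes \<Omega> :: "'a::euclidean_space set"
  assumes bw: "borel_weak_gradient \<Omega> u g" and O: "open \<Omega>" "bounded \<Omega>"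
    and K: "compact K" "K \<subseteq> \<Omega>" and e: "0 < e"
  shows "\<exists>U G. (\<forall>x\<in>K. (U has_derivative (\<lambda>h. G x \<bullet> h)) (at x)) \<and> continuous_on K G \<and>
    (LINT x|lborel. indicator K x * (norm (G x))\<^sup>2) \<le> (LINT x|lborel. (norm (g x))\<^sup>2) \<and>
    (LINT x|lborel. indicator K x * \<bar>U x - u x\<bar>) \<le> e"
proof -
  have [measurable]: "u \<in> borel_measurable borel" "g \<in> borel_measurable borel"
    and off: "\<And>x. x \<notin> \<Omega> \<Longrightarrow> u x = 0" "\<And>x. x \<notin> \<Omega> \<Longrightarrow> g x = 0"
    and iu2: "integrable lborel (\<lambda>x. (u x)\<^sup>2)" and ig2: "integrable lborel (\<lambda>x. (norm (g x))\<^sup>2)"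
    and wg: "\<And>\<phi> i. test_function \<Omega> \<phi> \<Longrightarrow> i \<in> Basis \<Longrightarrow>
      (LINT x|lborel. u x * frechet_derivative \<phi> (at x) i) = - (LINT x|lborel. (g x \<bullet> i) * \<phi> x)"
    using bw unfolding borel_weak_gradient_def by blast+
  have iu: "integrable lborel u"
    by (rule square_integrable_bounded_support[OF O]) (use off iu2 in simp_all)
  have ig: "integrable lborel g"
    by (rule square_integrable_bounded_support[OF O]) (use off ig2 in simp_all)
  obtain \<delta> where \<delta>: "0 < \<delta>" "(\<Union>x\<in>K. cball x \<delta>) \<subseteq> \<Omega>"
    using compact_subset_open_imp_cball_epsilon_subset[OF K(1) O(1) K(2)] by blast
  obtain R where R: "\<And>x. x \<in> \<Omega> \<Longrightarrow> norm x \<le> R" using O(2) by (auto simp: bounded_iff)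
  have uR: "u x = 0" if "x \<notin> cball 0 R" for x using that R[of x] off(1)[of x] by auto
  have "0 < e / 4" using e by simp
  from L1_approx_continuous[OF iu uR this]
  obtain \<phi> where \<phi>: "continuous_on UNIV \<phi>" "integrable lborel \<phi>" "(LINT x|lborel. \<bar>u x - \<phi> x\<bar>) < e / 4"
    by auto
  have [measurable]: "\<phi> \<in> borel_measurable borel" by (rule borel_measurable_continuous_onI[OF \<phi>(1)])
  have fK: "emeasure lborel K < \<infinity>" using K(1) by (intro emeasure_bounded_finite compact_imp_bounded)
  have mK [measurable]: "K \<in> sets borel" using K(1) by (simp add: borel_compact)
  define \<mu> where "\<mu> = measure lborel K"
  have \<mu>: "0 \<le> \<mu>" by (simp add: \<mu>_def)
  \<comment> \<open>The modulus of continuity of the approximant contributes \<open>\<eta>\<close> on all of \<open>K\<close>, that is at most \<open>e / 2\<close>;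
    its \<open>L\<^sup>1\<close> distance \<open>e / 4\<close> from \<open>u\<close> enters twice.\<close>
  define \<eta> where "\<eta> = e / (2 * (\<mu> + 1))"
  have \<eta>: "0 < \<eta>" "\<eta> * \<mu> \<le> e / 2"
    using e \<mu> by (auto simp: \<eta>_def field_simps)
  have "uniformly_continuous_on (cball 0 (R + 1)) \<phi>"
    by (intro compact_uniformly_continuous continuous_on_subset[OF \<phi>(1)]) auto
  then obtain d where d: "0 < d"
    "\<And>x y. x \<in> cball 0 (R + 1) \<Longrightarrow> y \<in> cball 0 (R + 1) \<Longrightarrow> dist y x < d \<Longrightarrow> dist (\<phi> y) (\<phi> x) < \<eta>"
    using \<eta>(1) unfolding uniformly_continuous_on_def by meson
  define r where "r = min \<delta> (min d 1)"
  have r: "0 < r" "r \<le> \<delta>" "r \<le> d" "r \<le> 1" using \<delta> d by (auto simp: r_def)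
  define k where "k = (mollifier r :: 'a \<Rightarrow> real)"
  let ?D = "\<lambda>x. frechet_derivative k (at x)"
  have Ck: "Ck n k" for n unfolding k_def by (rule Ck_mollifier[OF r(1)])
  have supp: "closure {z. k z \<noteq> 0} \<subseteq> cball 0 r" unfolding k_def by (rule mollifier_support[OF r(1)])
  have k0: "0 \<le> k z" for z unfolding k_def by (rule mollifier_nonneg[OF r(1)])
  have ik: "integrable lborel k" "(LINT z|lborel. k z) = 1"
    unfolding k_def using mollifier_integral[OF r(1)] by auto
  have kout: "k z = 0" if "r \<le> norm z" for z
    unfolding k_def by (rule mollifier_outside[OF r(1) that])
  have ck: "continuous_on UNIV k" by (rule Ck_continuous[OF Ck])
  have [measurable]: "k \<in> borel_measurable borel" by (rule borel_measurable_continuous_onI[OF ck])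
  obtain B where B: "\<And>z. \<bar>k z\<bar> \<le> B"
    using compactly_supported_bounded[OF ck bounded_ball[of 0 r]] kout by (metis mem_ball_0 not_le)
  obtain L where L: "0 \<le> L" "\<And>x y. \<bar>k x - k y\<bar> \<le> L * norm (x - y)"
    using Ck_lipschitz[OF Ck supp bounded_cball] by blast
  have ikx: "integrable lborel (\<lambda>y. k (x - y))" "(LINT y|lborel. k (x - y)) = 1" for x
    using integral_reflect[of k x] ik by auto
  have ikg: "integrable lborel (\<lambda>y. k (x - y) *\<^sub>R g y)" for x
    by (rule integrable_bounded_scaleR[OF ig _ B]) measurable
  have ikw: "integrable lborel (\<lambda>y. k (x - y) * w y)" if "integrable lborel w" for x and w :: "'a \<Rightarrow> real"
    by (rule integrable_bounded_scaleR[OF that _ B, unfolded real_scaleR_def]) measurable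
  define U where "U x = (LINT y|lborel. u y * k (x - y))" for x
  define G where "G x = (LINT y|lborel. k (x - y) *\<^sub>R g y)" for x
  have dU: "(U has_derivative (\<lambda>h. G x \<bullet> h)) (at x)" if x: "x \<in> K" for x
  proof -
    let ?U' = "\<lambda>h. LINT y|lborel. u y * ?D (x - y) h"
    have U': "(U has_derivative ?U') (at x)"
      unfolding U_def[abs_def] by (rule convolution_has_derivative[OF iu Ck supp compact_cball])
    have "?U' = (\<lambda>h. G x \<bullet> h)"
    proof (rule linear_eq_stdbasis)
      show "linear ?U'" using U' has_derivative_linear by blast
      show "linear (\<lambda>h. G x \<bullet> h)" by (intro bounded_linear.linear bounded_linear_inner_right)
      fix i :: 'a assume i: "i \<in> Basis"
      have "cball x r \<subseteq> \<Omega>" using \<delta>(2) x r(2) subset_cball[of r \<delta> x] by blast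
      then have test: "test_function \<Omega> (\<lambda>y. k (x - y))"
        unfolding k_def by (rule test_function_mollifier[OF r(1)])
      have "frechet_derivative (\<lambda>y. k (x - y)) (at y) = (\<lambda>h. - ?D (x - y) h)" for y
        using frechet_derivative_at[OF has_derivative_reflect[OF Ck_SucD(1)[OF Ck[of "Suc 0"]]]] by metis
      then have "- ?U' i = (LINT y|lborel. u y * frechet_derivative (\<lambda>y. k (x - y)) (at y) i)"
        by simp
      also have "\<dots> = - (LINT y|lborel. (g y \<bullet> i) * k (x - y))" by (rule wg[OF test i])
      also have "(LINT y|lborel. (g y \<bullet> i) * k (x - y)) = (LINT y|lborel. (k (x - y) *\<^sub>R g y) \<bullet> i)"
        by (simp add: mult.commute)
      also have "\<dots> = G x \<bullet> i" unfolding G_def by (rule integral_inner_left) (rule ikg)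
      finally show "?U' i = G x \<bullet> i" by simp
    qed
    then show ?thesis using U' by simp
  qed
  have cU: "continuous_on K U"
    using dU has_derivative_continuous continuous_at_imp_continuous_on by blast
  have cG: "continuous_on K G"
  proof (rule lipschitz_on_continuous_on[OF lipschitz_onI])
    let ?I = "LINT y|lborel. norm (g y)"
    show "0 \<le> L * ?I" using L(1) by (intro mult_nonneg_nonneg integral_nonneg_AE) auto
    fix x x'
    have "G x - G x' = (LINT y|lborel. (k (x - y) - k (x' - y)) *\<^sub>R g y)"
      unfolding G_def by (simp add: scaleR_diff_left ikg)
    also have "norm \<dots> \<le> (LINT y|lborel. norm ((k (x - y) - k (x' - y)) *\<^sub>R g y))"
      by (rule integral_norm_bound)
    also have "\<dots> \<le> (LINT y|lborel. (L * dist x x') * norm (g y))"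
    proof (rule integral_mono)
      show "integrable lborel (\<lambda>y. norm ((k (x - y) - k (x' - y)) *\<^sub>R g y))"
        unfolding scaleR_diff_left by (intro integrable_norm Bochner_Integration.integrable_diff ikg)
      show "integrable lborel (\<lambda>y. (L * dist x x') * norm (g y))" using ig by simp
      fix y
      have "\<bar>k (x - y) - k (x' - y)\<bar> \<le> L * dist x x'" using L(2)[of "x - y" "x' - y"] by (simp add: dist_norm)
      then show "norm ((k (x - y) - k (x' - y)) *\<^sub>R g y) \<le> (L * dist x x') * norm (g y)"
        by (simp add: mult_right_mono)
    qed
    finally show "dist (G x) (G x') \<le> L * ?I * dist x x'" by (simp add: dist_norm mult_ac)
  qed
  have energy: "(LINT x|lborel. indicator K x * (norm (G x))\<^sup>2) \<le> (LINT x|lborel. (norm (g x))\<^sup>2)"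
  proof -
    have "(LINT x|lborel. indicator K x * (norm (G x))\<^sup>2)
        \<le> (LINT x|lborel. LINT y|lborel. k (x - y) * (norm (g y))\<^sup>2)"
    proof (rule integral_mono)
      show "integrable lborel (\<lambda>x. indicator K x * (norm (G x))\<^sup>2)"
        using borel_integrable_compact[OF K(1), of "\<lambda>x. (norm (G x))\<^sup>2"] cG by (simp add: continuous_intros)
      show "integrable lborel (\<lambda>x. LINT y|lborel. k (x - y) * (norm (g y))\<^sup>2)"
        by (rule convolution_integral(1)[OF ik ig2])
      fix x
      have "(norm (G x))\<^sup>2 \<le> (LINT y|lborel. k (x - y) * (norm (g y))\<^sup>2)"
        unfolding G_def by (rule jensen_norm_square) (auto simp: k0 ikx ikg ikw ig2)
      moreover have "indicator K x * (norm (G x))\<^sup>2 \<le> (norm (G x))\<^sup>2"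
        by (simp add: indicator_def)
      ultimately show "indicator K x * (norm (G x))\<^sup>2 \<le> (LINT y|lborel. k (x - y) * (norm (g y))\<^sup>2)"
        by (rule order_trans[rotated])
    qed
    also have "\<dots> = (LINT x|lborel. (norm (g x))\<^sup>2)" by (rule convolution_integral(2)[OF ik ig2])
    finally show ?thesis .
  qed
  have close: "(LINT x|lborel. indicator K x * \<bar>U x - u x\<bar>) \<le> e"
  proof -
    define P where "P x = (LINT y|lborel. k (x - y) * \<bar>u y - \<phi> y\<bar>)" for x
    have iuf: "integrable lborel (\<lambda>y. \<bar>u y - \<phi> y\<bar>)" using iu \<phi>(2) by simp
    have iP: "integrable lborel P" unfolding P_def[abs_def] by (rule convolution_integral(1)[OF ik iuf])
    have P0: "0 \<le> P x" for x unfolding P_def using k0 by (intro integral_nonneg_AE) auto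
    have near: "\<bar>U x - u x\<bar> \<le> P x + \<eta> + \<bar>u x - \<phi> x\<bar>" if x: "x \<in> K" for x
    proof -
      have i\<phi>: "integrable lborel (\<lambda>y. k (x - y) * \<phi> y)" "integrable lborel (\<lambda>y. k (x - y) * u y)"
        by (rule ikw, fact)+
      have ic: "integrable lborel (\<lambda>y. k (x - y) * \<phi> x)" using ikx(1) by simp
      have c1: "(LINT y|lborel. k (x - y) * \<phi> x) = \<phi> x" using ikx(2)[of x] by simp
      have "\<bar>(LINT y|lborel. k (x - y) * (u y - \<phi> y))\<bar> \<le> (LINT y|lborel. \<bar>k (x - y) * (u y - \<phi> y)\<bar>)"
        by (rule integral_abs_bound)
      also have "\<dots> = P x" unfolding P_def by (simp add: abs_mult k0)
      finally have 1: "\<bar>(LINT y|lborel. k (x - y) * (u y - \<phi> y))\<bar> \<le> P x" .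
      have "\<bar>(LINT y|lborel. k (x - y) * (\<phi> y - \<phi> x))\<bar> \<le> (LINT y|lborel. \<bar>k (x - y) * (\<phi> y - \<phi> x)\<bar>)"
        by (rule integral_abs_bound)
      also have "\<dots> \<le> (LINT y|lborel. k (x - y) * \<eta>)"
      proof (rule integral_mono)
        show "integrable lborel (\<lambda>y. \<bar>k (x - y) * (\<phi> y - \<phi> x)\<bar>)"
          unfolding right_diff_distrib by (intro integrable_abs Bochner_Integration.integrable_diff i\<phi> ic)
        show "integrable lborel (\<lambda>y. k (x - y) * \<eta>)" using ikx(1) by simp
        fix y
        show "\<bar>k (x - y) * (\<phi> y - \<phi> x)\<bar> \<le> k (x - y) * \<eta>"
        proof (cases "norm (x - y) < r")
          case True
          have nx: "norm x \<le> R" using x K(2) R by blast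
          have "norm y \<le> norm x + norm (x - y)" using norm_triangle_ineq4[of x "x - y"] by simp
          then have "norm y \<le> R + 1" using nx True r(4) by linarith
          moreover have "dist y x < d" using True r(3) by (simp add: dist_norm norm_minus_commute)
          ultimately have "dist (\<phi> y) (\<phi> x) < \<eta>" using d(2)[of x y] nx by simp
          then have "\<bar>\<phi> y - \<phi> x\<bar> \<le> \<eta>" by (simp add: dist_real_def)
          then show ?thesis using k0[of "x - y"] by (simp add: abs_mult mult_left_mono)
        qed (simp add: kout)
      qed
      also have "\<dots> = \<eta>" using ikx(2)[of x] by simp
      finally have 2: "\<bar>(LINT y|lborel. k (x - y) * (\<phi> y - \<phi> x))\<bar> \<le> \<eta>" .
      have "U x = (LINT y|lborel. k (x - y) * u y)" unfolding U_def by (simp add: mult.commute)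
      moreover have "(LINT y|lborel. k (x - y) * (u y - \<phi> y))
          = (LINT y|lborel. k (x - y) * u y) - (LINT y|lborel. k (x - y) * \<phi> y)"
        using i\<phi> by (simp add: right_diff_distrib)
      moreover have "(LINT y|lborel. k (x - y) * (\<phi> y - \<phi> x))
          = (LINT y|lborel. k (x - y) * \<phi> y) - \<phi> x"
        using i\<phi> ic c1 by (simp add: right_diff_distrib)
      ultimately show ?thesis using 1 2 by linarith
    qed
    have "integrable lborel (\<lambda>x. indicator K x * U x)"
      using borel_integrable_compact[OF K(1) cU] by simp
    moreover have "integrable lborel (\<lambda>x. indicator K x * u x)"
      using integrable_mult_indicator[of K lborel u] iu by simp
    ultimately have "integrable lborel (\<lambda>x. \<bar>indicator K x * U x - indicator K x * u x\<bar>)"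
      by (intro integrable_abs Bochner_Integration.integrable_diff)
    moreover have "\<bar>indicator K x * U x - indicator K x * u x\<bar> = indicator K x * \<bar>U x - u x\<bar>" for x
      by (simp add: indicator_def)
    ultimately have iKU: "integrable lborel (\<lambda>x. indicator K x * \<bar>U x - u x\<bar>)" by simp
    have iK: "integrable lborel (\<lambda>x. \<eta> * indicator K x)"
      using fK by (intro integrable_mult_right integrable_real_indicator) auto
    have "(LINT x|lborel. indicator K x * \<bar>U x - u x\<bar>) \<le> (LINT x|lborel. (P x + \<eta> * indicator K x) + \<bar>u x - \<phi> x\<bar>)"
    proof (rule integral_mono[OF iKU])
      show "integrable lborel (\<lambda>x. (P x + \<eta> * indicator K x) + \<bar>u x - \<phi> x\<bar>)"
        by (intro Bochner_Integration.integrable_add iP iK iuf)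
      show "indicator K x * \<bar>U x - u x\<bar> \<le> (P x + \<eta> * indicator K x) + \<bar>u x - \<phi> x\<bar>" for x
        using near[of x] P0[of x] by (cases "x \<in> K") auto
    qed
    also have "\<dots> = (LINT x|lborel. P x) + (LINT x|lborel. \<eta> * indicator K x) + (LINT x|lborel. \<bar>u x - \<phi> x\<bar>)"
      using iP iK iuf Bochner_Integration.integrable_add[OF iP iK] by simp
    also have "(LINT x|lborel. P x) = (LINT x|lborel. \<bar>u x - \<phi> x\<bar>)"
      unfolding P_def by (rule convolution_integral(2)[OF ik iuf])
    also have "(LINT x|lborel. \<eta> * indicator K x) = \<eta> * \<mu>" unfolding \<mu>_def by simp
    finally show ?thesis using \<phi>(3) \<eta>(2) by linarith
  qed
  show ?thesis using dU cG energy close by blast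
qed

section \<open>Cone coordinates on the rhombus\<close>

definition pt :: "real \<Rightarrow> real \<Rightarrow> real^2" where
  "pt x y = x *\<^sub>R axis 1 1 + y *\<^sub>R axis 2 1"

lemma pt_nth [simp]: "pt x y $ 1 = x" "pt x y $ 2 = y"
  by (simp_all add: pt_def axis_def)

lemma pt_measurable [measurable]: "case_prod pt \<in> borel_measurable (borel \<Otimes>\<^sub>M borel)"
  unfolding pt_def[abs_def] by measurable

lemma continuous_on_pt [continuous_intros]:
  "continuous_on A f \<Longrightarrow> continuous_on A g \<Longrightarrow> continuous_on A (\<lambda>x. pt (f x) (g x))"
  unfolding pt_def by (intro continuous_intros)

lemma pt_has_derivative:
  assumes "(f has_derivative f') F" "(g has_derivative g') F"
  shows "((\<lambda>x. pt (f x) (g x)) has_derivative (\<lambda>h. pt (f' h) (g' h))) F"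
  unfolding pt_def by (intro derivative_intros assms)

lemma prod_Basis_real2: "(\<Prod>b\<in>Basis. f (b :: real^2)) = f (axis 1 1) * f (axis 2 1)"
proof -
  have B: "(Basis :: (real^2) set) = (\<lambda>i. axis i 1) ` UNIV" by (auto simp: Basis_vec_def)
  have "inj (\<lambda>i::2. axis i (1::real))" by (auto simp: inj_on_def axis_eq_axis)
  then have "(\<Prod>b\<in>Basis. f (b :: real^2)) = (\<Prod>i\<in>UNIV. f (axis i 1))"
    unfolding B by (simp add: prod.reindex)
  then show ?thesis by (simp add: UNIV_2)
qed

text \<open>This carries Fubini's theorem over from pairs of reals to the plane \<open>real^2\<close>.\<close>

lemma lborel_real2: "distr (lborel \<Otimes>\<^sub>M lborel) borel (case_prod pt) = (lborel :: (real^2) measure)"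
proof (rule lborel_eqI[symmetric])
  fix l u :: "real^2"
  assume le: "\<And>b. b \<in> Basis \<Longrightarrow> l \<bullet> b \<le> u \<bullet> b"
  have le': "l $ 1 \<le> u $ 1" "l $ 2 \<le> u $ 2"
    using le[of "axis 1 1"] le[of "axis 2 1"] by (auto simp: inner_axis axis_in_Basis_iff)
  have "emeasure (distr (lborel \<Otimes>\<^sub>M lborel) borel (case_prod pt)) (box l u)
      = emeasure (lborel \<Otimes>\<^sub>M lborel) (case_prod pt -` box l u \<inter> space (lborel \<Otimes>\<^sub>M lborel))"
    by (rule emeasure_distr) simp_all
  also have "case_prod pt -` box l u \<inter> space (lborel \<Otimes>\<^sub>M lborel) = {l $ 1 <..< u $ 1} \<times> {l $ 2 <..< u $ 2}"
    by (auto simp: mem_box_cart forall_2 space_pair_measure)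
  also have "emeasure (lborel \<Otimes>\<^sub>M lborel) \<dots> = emeasure lborel {l $ 1 <..< u $ 1} * emeasure lborel {l $ 2 <..< u $ 2}"
    by (rule lborel.emeasure_pair_measure_Times) simp_all
  also have "\<dots> = ennreal ((u $ 1 - l $ 1) * (u $ 2 - l $ 2))"
    using le' by (simp add: ennreal_mult)
  also have "\<dots> = ennreal (\<Prod>b\<in>Basis. (u - l) \<bullet> b)"
    by (simp add: prod_Basis_real2 inner_axis)
  finally show "emeasure (distr (lborel \<Otimes>\<^sub>M lborel) borel (case_prod pt)) (box l u) = (\<Prod>b\<in>Basis. (u - l) \<bullet> b)" .
qed simp

lemma integral_real2:
  fixes f :: "real^2 \<Rightarrow> real"
  assumes f: "integrable lborel f"
  shows "integrable lborel (\<lambda>x. LINT y|lborel. f (pt x y))"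
    and "(LINT z|lborel. f z) = (LINT x|lborel. LINT y|lborel. f (pt x y))"
proof -
  have [measurable]: "f \<in> borel_measurable borel" using f by auto
  have pm: "case_prod pt \<in> (lborel \<Otimes>\<^sub>M lborel) \<rightarrow>\<^sub>M borel" by simp
  have "integrable (distr (lborel \<Otimes>\<^sub>M lborel) borel (case_prod pt)) f"
    using f by (simp only: lborel_real2)
  then have i: "integrable (lborel \<Otimes>\<^sub>M lborel) (\<lambda>(x, y). f (pt x y))"
    by (subst (asm) integrable_distr_eq[OF pm]) (auto simp: case_prod_unfold)
  show "integrable lborel (\<lambda>x. LINT y|lborel. f (pt x y))"
    using lborel_pair.integrable_fst[OF i] .
  have "(LINT z|lborel. f z) = (LINT z|(distr (lborel \<Otimes>\<^sub>M lborel) borel (case_prod pt)). f z)"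
    by (simp only: lborel_real2)
  also have "\<dots> = (LINT p|(lborel \<Otimes>\<^sub>M lborel). f (case_prod pt p))"
    by (rule integral_distr[OF pm]) simp
  also have "\<dots> = (LINT x|lborel. LINT y|lborel. f (pt x y))"
    using lborel_pair.integral_fst[OF i] by (simp add: case_prod_unfold)
  finally show "(LINT z|lborel. f z) = (LINT x|lborel. LINT y|lborel. f (pt x y))" .
qed

definition closed_rhombus :: "real \<Rightarrow> real \<Rightarrow> (real^2) set" where
  "closed_rhombus e L = {x. \<bar>x $ 1\<bar> + \<bar>x $ 2\<bar> / e \<le> L}"

lemma compact_closed_rhombus:
  assumes e: "0 < e"
  shows "compact (closed_rhombus e L)"
proof -
  have "closed (closed_rhombus e L)"
    unfolding closed_rhombus_def by (intro closed_Collect_le continuous_intros) (use e in auto)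
  moreover have "norm x \<le> L + e * L" if "x \<in> closed_rhombus e L" for x
  proof -
    have x: "\<bar>x $ 1\<bar> + \<bar>x $ 2\<bar> / e \<le> L" using that by (simp add: closed_rhombus_def)
    moreover have "0 \<le> \<bar>x $ 2\<bar> / e" "0 \<le> \<bar>x $ 1\<bar>" using e by auto
    ultimately have "\<bar>x $ 1\<bar> \<le> L" "\<bar>x $ 2\<bar> / e \<le> L" by linarith+
    moreover have "norm x \<le> \<bar>x $ 1\<bar> + \<bar>x $ 2\<bar>" using norm_le_l1_cart[of x] by (simp add: sum_2)
    ultimately show ?thesis using e by (simp add: pos_divide_le_eq mult.commute)
  qed
  then have "bounded (closed_rhombus e L)" by (auto simp: bounded_iff)
  ultimately show ?thesis by (simp add: compact_eq_bounded_closed)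
qed

lemma lborel_integral_interval:
  fixes f :: "real \<Rightarrow> real"
  assumes "continuous_on {a..b} f"
  shows "(LINT x|lborel. indicator {a..b} x * f x) = integral {a..b} f"
proof -
  have "integrable lborel (\<lambda>x. indicator {a..b} x *\<^sub>R f x)"
    by (rule borel_integrable_compact) (use assms in auto)
  then have "set_integrable lborel {a..b} f" by (simp add: set_integrable_def)
  from set_borel_integral_eq_integral(2)[OF this] show ?thesis
    by (simp add: set_lebesgue_integral_def)
qed

lemma cone_in_closed_rhombus:
  assumes e: "0 < e" and t: "t \<in> {-e..e}" and r: "r \<in> {0..L}"
  shows "pt (L - r) (t * r) \<in> closed_rhombus e L" "pt (r - L) (t * r) \<in> closed_rhombus e L"
proof -
  have "\<bar>t * r\<bar> / e = r * (\<bar>t\<bar> / e)" using r by (simp add: abs_mult)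
  also have "\<dots> \<le> r * 1" using t e r by (intro mult_left_mono) (auto simp: pos_divide_le_eq)
  finally have "\<bar>t * r\<bar> / e \<le> r" by simp
  then show "pt (L - r) (t * r) \<in> closed_rhombus e L" "pt (r - L) (t * r) \<in> closed_rhombus e L"
    using r by (auto simp: closed_rhombus_def)
qed

text \<open>Each half of the rhombus is the cone over the segment \<open>{-e..e}\<close>, and \<open>(r, t)\<close> stands for the point at
  horizontal distance \<open>r\<close> from the apex on the ray of slope \<open>t\<close> (on the ray of slope \<open>- t\<close> in the right half).
  Substituting \<open>y = t r\<close> in the vertical slices produces the weight \<open>r\<close>; as the substitution is affine for fixed
  \<open>r\<close>, one-dimensional changes of variables suffice.\<close>

lemma integral_closed_rhombus:
  fixes F :: "real^2 \<Rightarrow> real"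
  assumes e: "0 < e" and L: "0 < L" and F: "continuous_on (closed_rhombus e L) F"
  shows "(LINT x|lborel. indicator (closed_rhombus e L) x * F x)
    = integral {-e..e} (\<lambda>t. integral {0..L} (\<lambda>r. r * (F (pt (L - r) (t * r)) + F (pt (r - L) (t * r)))))"
proof -
  let ?K = "closed_rhombus e L"
  define f where "f x = indicator ?K x * F x" for x
  have f: "integrable lborel f"
    unfolding f_def[abs_def] using borel_integrable_compact[OF compact_closed_rhombus[OF e] F] by simp
  define g where "g x = (LINT y|lborel. f (pt x y))" for x
  have g: "integrable lborel g" and fg: "(LINT x|lborel. f x) = (LINT x|lborel. g x)"
    unfolding g_def[abs_def] using integral_real2[OF f] by auto
  have [measurable]: "g \<in> borel_measurable borel" using g by auto
  have f0: "f (pt x y) = 0" if "L < \<bar>x\<bar>" for x y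
  proof -
    have "0 \<le> \<bar>y\<bar> / e" using e by simp
    then have "pt x y \<notin> ?K" using that unfolding closed_rhombus_def pt_nth mem_Collect_eq by linarith
    then show ?thesis by (simp add: f_def)
  qed
  have g0: "g x = 0" if "L < \<bar>x\<bar>" for x using that by (simp add: g_def f0)
  have slice: "g x = r * (LINT t|lborel. indicator {-e..e} t * F (pt x (t * r)))"
    if r: "0 < r" and x: "\<bar>x\<bar> = L - r" for x r
  proof -
    have "g x = \<bar>r\<bar> *\<^sub>R (LINT t|lborel. f (pt x (0 + r * t)))"
      unfolding g_def by (rule lborel_integral_real_affine) (use r in simp)
    moreover have "f (pt x (0 + r * t)) = indicator {-e..e} t * F (pt x (t * r))" for t
    proof -
      have "pt x (r * t) \<in> ?K \<longleftrightarrow> r * \<bar>t\<bar> / e \<le> r"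
        using r x by (simp add: closed_rhombus_def abs_mult)
      also have "\<dots> \<longleftrightarrow> t \<in> {-e..e}" using r e by (auto simp: pos_divide_le_eq)
      finally show ?thesis by (simp add: f_def indicator_def mult.commute)
    qed
    ultimately show ?thesis using r by simp
  qed
  define H where "H r t = indicator {0..L} r * indicator {-e..e} t * (r * (F (pt (L - r) (t * r)) + F (pt (r - L) (t * r))))" for r t
  have cF: "continuous_on ({0..L} \<times> {-e..e}) (\<lambda>(r, t). r * (F (pt (L - r) (t * r)) + F (pt (r - L) (t * r))))"
    unfolding case_prod_unfold
    by (intro continuous_intros continuous_on_compose2[OF F]) (auto intro!: cone_in_closed_rhombus[OF e])
  have "integrable (lborel :: (real \<times> real) measure)
      (\<lambda>p. indicator ({0..L} \<times> {-e..e}) p *\<^sub>R (case p of (r, t) \<Rightarrow> r * (F (pt (L - r) (t * r)) + F (pt (r - L) (t * r)))))"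
    by (rule borel_integrable_compact[OF _ cF]) (intro compact_Times compact_Icc)
  moreover have "indicator ({0..L} \<times> {-e..e}) p *\<^sub>R (case p of (r, t) \<Rightarrow> r * (F (pt (L - r) (t * r)) + F (pt (r - L) (t * r))))
      = (case p of (r, t) \<Rightarrow> H r t)" for p
    by (auto simp: H_def indicator_def split: prod.split)
  ultimately have H: "integrable (lborel \<Otimes>\<^sub>M lborel) (\<lambda>(r, t). H r t)"
    by (simp add: lborel_prod)
  have "(LINT x|lborel. g x) = (LINT x|lborel. indicator {..0} x * g x + indicator {0..} x * g x)"
  proof (rule integral_cong_AE)
    show "AE x in lborel. g x = indicator {..0} x * g x + indicator {0..} x * g x"
      using AE_lborel_singleton[of 0] by eventually_elim (auto simp: indicator_def)
  qed auto
  also have "\<dots> = (LINT x|lborel. indicator {..0} x * g x) + (LINT x|lborel. indicator {0..} x * g x)"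
    using integrable_mult_indicator[of "{..0}" lborel g] integrable_mult_indicator[of "{0..}" lborel g] g by simp
  also have "(LINT x|lborel. indicator {..0} x * g x) = (LINT r|lborel. indicator {..L} r * g (r - L))"
  proof -
    have "(LINT x|lborel. indicator {..0} x * g x) = \<bar>1\<bar> *\<^sub>R (LINT r|lborel. indicator {..0} (- L + 1 * r) * g (- L + 1 * r))"
      by (rule lborel_integral_real_affine) simp
    also have "\<dots> = (LINT r|lborel. indicator {..L} r * g (r - L))"
      unfolding abs_one scaleR_one
      by (intro Bochner_Integration.integral_cong refl) (auto simp: indicator_def)
    finally show ?thesis .
  qed
  also have "(LINT x|lborel. indicator {0..} x * g x) = (LINT r|lborel. indicator {..L} r * g (L - r))"
  proof -
    have "(LINT x|lborel. indicator {0..} x * g x) = \<bar>- 1\<bar> *\<^sub>R (LINT r|lborel. indicator {0..} (L + (- 1) * r) * g (L + (- 1) * r))"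
      by (rule lborel_integral_real_affine) simp
    also have "\<dots> = (LINT r|lborel. indicator {..L} r * g (L - r))"
      unfolding abs_minus_cancel abs_one scaleR_one
      by (intro Bochner_Integration.integral_cong refl) (auto simp: indicator_def)
    finally show ?thesis .
  qed
  also have "(LINT r|lborel. indicator {..L} r * g (r - L)) + (LINT r|lborel. indicator {..L} r * g (L - r))
      = (LINT r|lborel. indicator {..L} r * g (r - L) + indicator {..L} r * g (L - r))"
  proof (rule Bochner_Integration.integral_add[symmetric])
    have "integrable lborel (\<lambda>r. g (- L + 1 * r))" "integrable lborel (\<lambda>r. g (L + (- 1) * r))"
      by (intro lborel_integrable_real_affine g; simp)+
    then show "integrable lborel (\<lambda>r. indicator {..L} r * g (r - L))" "integrable lborel (\<lambda>r. indicator {..L} r * g (L - r))"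
      using integrable_mult_indicator[of "{..L}" lborel "\<lambda>r. g (r - L)"]
        integrable_mult_indicator[of "{..L}" lborel "\<lambda>r. g (L - r)"] by auto
  qed
  also have "\<dots> = (LINT r|lborel. LINT t|lborel. H r t)"
  proof (rule integral_cong_AE)
    show "AE r in lborel. indicator {..L} r * g (r - L) + indicator {..L} r * g (L - r) = (LINT t|lborel. H r t)"
      using AE_lborel_singleton[of 0]
    proof eventually_elim
      case (elim r)
      consider "r < 0" | "0 < r" "r \<le> L" | "L < r" using elim by linarith
      then show ?case
      proof cases
        case 1
        then show ?thesis using g0[of "r - L"] g0[of "L - r"] L by (simp add: H_def)
      next
        case 2
        have c: "continuous_on {-e..e} (\<lambda>t. F (pt (L - r) (t * r)))" "continuous_on {-e..e} (\<lambda>t. F (pt (r - L) (t * r)))"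
          using 2 by (intro continuous_on_compose2[OF F] continuous_intros image_subsetI cone_in_closed_rhombus[OF e]; simp)+
        have i: "integrable lborel (\<lambda>t. indicator {-e..e} t * F (pt (L - r) (t * r)))"
          "integrable lborel (\<lambda>t. indicator {-e..e} t * F (pt (r - L) (t * r)))"
          using borel_integrable_compact[OF compact_Icc c(1)] borel_integrable_compact[OF compact_Icc c(2)] by auto
        have "g (L - r) + g (r - L)
          = r * (LINT t|lborel. indicator {-e..e} t * F (pt (L - r) (t * r)) + indicator {-e..e} t * F (pt (r - L) (t * r)))"
          using slice[of r "L - r"] slice[of r "r - L"] 2 i by (simp add: distrib_left)
        also have "\<dots> = (LINT t|lborel. r * (indicator {-e..e} t * F (pt (L - r) (t * r)) + indicator {-e..e} t * F (pt (r - L) (t * r))))"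
          by simp
        also have "\<dots> = (LINT t|lborel. H r t)"
          using 2 by (intro Bochner_Integration.integral_cong refl) (simp add: H_def algebra_simps)
        finally show ?thesis using 2 by (simp add: add.commute)
      next
        case 3
        then show ?thesis by (simp add: H_def)
      qed
    qed
    show "(\<lambda>r. LINT t|lborel. H r t) \<in> borel_measurable lborel"
      using lborel_pair.integrable_fst[OF H] by auto
  qed measurable
  also have "\<dots> = (LINT t|lborel. LINT r|lborel. H r t)"
    using lborel_pair.Fubini_integral[OF H] by simp
  also have "\<dots> = (LINT t|lborel. indicator {-e..e} t * integral {0..L} (\<lambda>r. r * (F (pt (L - r) (t * r)) + F (pt (r - L) (t * r)))))"
  proof (intro Bochner_Integration.integral_cong refl)
    fix t
    show "(LINT r|lborel. H r t) = indicator {-e..e} t * integral {0..L} (\<lambda>r. r * (F (pt (L - r) (t * r)) + F (pt (r - L) (t * r))))"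
    proof (cases "t \<in> {-e..e}")
      case True
      have c: "continuous_on {0..L} (\<lambda>r. r * (F (pt (L - r) (t * r)) + F (pt (r - L) (t * r))))"
        by (intro continuous_intros continuous_on_compose2[OF F] image_subsetI cone_in_closed_rhombus[OF e True]; simp)
      show ?thesis using lborel_integral_interval[OF c] True by (simp add: H_def)
    qed (simp add: H_def)
  qed
  also have "\<dots> = integral {-e..e} (\<lambda>t. integral {0..L} (\<lambda>r. r * (F (pt (L - r) (t * r)) + F (pt (r - L) (t * r)))))"
  proof (rule lborel_integral_interval)
    have "continuous_on ({-e..e} \<times> cbox 0 L) (\<lambda>(t, r). r * (F (pt (L - r) (t * r)) + F (pt (r - L) (t * r))))"
      unfolding case_prod_unfold
      by (intro continuous_intros continuous_on_compose2[OF F]) (auto intro!: cone_in_closed_rhombus[OF e])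
    from integral_continuous_on_param[OF this]
    show "continuous_on {-e..e} (\<lambda>t. integral {0..L} (\<lambda>r. r * (F (pt (L - r) (t * r)) + F (pt (r - L) (t * r)))))"
      by simp
  qed
  finally show ?thesis using fg by (simp add: f_def)
qed

section \<open>The Poincare inequality for differentiable functions\<close>

lemma weighted_Cauchy_Schwarz:
  fixes \<rho> f :: "real \<Rightarrow> real"
  assumes c: "continuous_on {a..b} \<rho>" "continuous_on {a..b} f"
    and \<rho>: "\<And>x. x \<in> {a..b} \<Longrightarrow> 0 \<le> \<rho> x" and pos: "0 < integral {a..b} \<rho>"
  shows "(integral {a..b} (\<lambda>x. \<rho> x * f x))\<^sup>2 \<le> integral {a..b} \<rho> * integral {a..b} (\<lambda>x. \<rho> x * (f x)\<^sup>2)"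
proof -
  define A B C where "A = integral {a..b} \<rho>" and "B = integral {a..b} (\<lambda>x. \<rho> x * f x)"
    and "C = integral {a..b} (\<lambda>x. \<rho> x * (f x)\<^sup>2)"
  have i: "(\<rho> has_integral A) {a..b}" "((\<lambda>x. \<rho> x * f x) has_integral B) {a..b}"
    "((\<lambda>x. \<rho> x * (f x)\<^sup>2) has_integral C) {a..b}"
    unfolding A_def B_def C_def
    by (intro integrable_integral integrable_continuous_real continuous_intros c)+
  have "((\<lambda>x. A\<^sup>2 * (\<rho> x * (f x)\<^sup>2) - (2 * A * B) * (\<rho> x * f x) + B\<^sup>2 * \<rho> x)
      has_integral (A\<^sup>2 * C - (2 * A * B) * B + B\<^sup>2 * A)) {a..b}"
    by (intro has_integral_add has_integral_diff has_integral_mult_right i)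
  moreover have "A\<^sup>2 * (\<rho> x * (f x)\<^sup>2) - (2 * A * B) * (\<rho> x * f x) + B\<^sup>2 * \<rho> x = \<rho> x * (A * f x - B)\<^sup>2" for x
    by (simp add: power2_eq_square algebra_simps)
  ultimately have "((\<lambda>x. \<rho> x * (A * f x - B)\<^sup>2) has_integral (A\<^sup>2 * C - (2 * A * B) * B + B\<^sup>2 * A)) {a..b}"
    by simp
  then have "0 \<le> A\<^sup>2 * C - (2 * A * B) * B + B\<^sup>2 * A"
    by (rule has_integral_nonneg) (simp add: \<rho>)
  also have "\<dots> = A * (A * C - B\<^sup>2)" by (simp add: power2_eq_square algebra_simps)
  finally have "0 \<le> A * C - B\<^sup>2" using pos by (simp add: A_def zero_le_mult_iff)
  then show ?thesis by (simp add: A_def B_def C_def)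
qed

text \<open>The variance is at most the quadratic deviation from the value of \<open>w\<close> at the left end point, which the
  Cauchy-Schwarz inequality bounds.  It is the factor \<open>e\<^sup>2\<close> that counts below, not the constant in front of it.\<close>

lemma interval_Poincare:
  fixes w w' :: "real \<Rightarrow> real"
  assumes e: "0 < e" and w: "\<And>t. t \<in> {-e..e} \<Longrightarrow> (w has_real_derivative w' t) (at t within {-e..e})"
    and c: "continuous_on {-e..e} w'"
  shows "integral {-e..e} (\<lambda>t. (w t)\<^sup>2) - (integral {-e..e} w)\<^sup>2 / (2 * e)
    \<le> 4 * e\<^sup>2 * integral {-e..e} (\<lambda>t. (w' t)\<^sup>2)"
proof -
  define D where "D = integral {-e..e} (\<lambda>t. (w' t)\<^sup>2)"
  define k where "k = w (- e)"
  have cw: "continuous_on {-e..e} w" by (rule DERIV_continuous_on) (rule w)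
  have near: "(w t - k)\<^sup>2 \<le> 2 * e * D" if t: "t \<in> {-e..e}" for t
  proof (cases "t = - e")
    case True
    have "0 \<le> D" unfolding D_def by (rule integral_nonneg) (auto intro!: integrable_continuous_real continuous_intros c)
    then show ?thesis using e True by (simp add: k_def)
  next
    case False
    then have lt: "- e < t" using t by auto
    have sub: "{-e..t} \<subseteq> {-e..e}" using t by auto
    note c' = continuous_on_subset[OF c sub]
    have "(w' has_integral (w t - w (- e))) {-e..t}"
      using lt w sub by (intro fundamental_theorem_of_calculus)
        (auto simp: has_real_derivative_iff_has_vector_derivative[symmetric] intro!: DERIV_subset[OF w])
    then have "(w t - k)\<^sup>2 = (integral {-e..t} (\<lambda>x. 1 * w' x))\<^sup>2" by (simp add: k_def integral_unique)
    also have "\<dots> \<le> integral {-e..t} (\<lambda>x. 1) * integral {-e..t} (\<lambda>x. 1 * (w' x)\<^sup>2)"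
      using lt by (intro weighted_Cauchy_Schwarz c') auto
    also have "\<dots> = (t + e) * integral {-e..t} (\<lambda>x. (w' x)\<^sup>2)" using lt by simp
    also have "\<dots> \<le> (2 * e) * D"
    proof (rule mult_mono)
      show "integral {-e..t} (\<lambda>x. (w' x)\<^sup>2) \<le> D" unfolding D_def
        by (rule integral_subset_le[OF sub]) (auto intro!: integrable_continuous_real continuous_intros c c')
      show "0 \<le> integral {-e..t} (\<lambda>x. (w' x)\<^sup>2)"
        by (rule integral_nonneg) (auto intro!: integrable_continuous_real continuous_intros c')
    qed (use t e in auto)
    finally show ?thesis .
  qed
  define W where "W = integral {-e..e} w"
  define W2 where "W2 = integral {-e..e} (\<lambda>t. (w t)\<^sup>2)"
  have "(w has_integral W) {-e..e}" "((\<lambda>t. (w t)\<^sup>2) has_integral W2) {-e..e}" "((\<lambda>t. k\<^sup>2) has_integral (2 * e * k\<^sup>2)) {-e..e}"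
    unfolding W_def W2_def using e has_integral_const_real[of "k\<^sup>2" "-e" e]
    by (auto intro!: integrable_integral integrable_continuous_real continuous_intros cw)
  then have "((\<lambda>t. (w t)\<^sup>2 - 2 * k * w t + k\<^sup>2) has_integral (W2 - 2 * k * W + 2 * e * k\<^sup>2)) {-e..e}"
    by (intro has_integral_add has_integral_diff has_integral_mult_right)
  then have "((\<lambda>t. (w t - k)\<^sup>2) has_integral (W2 - 2 * k * W + 2 * e * k\<^sup>2)) {-e..e}"
    by (simp add: power2_diff algebra_simps)
  moreover have "((\<lambda>t. 2 * e * D) has_integral (2 * e * (2 * e * D))) {-e..e}"
    using e has_integral_const_real[of "2 * e * D" "-e" e] by simp
  ultimately have "W2 - 2 * k * W + 2 * e * k\<^sup>2 \<le> 2 * e * (2 * e * D)"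
    by (rule has_integral_le) (rule near)
  moreover have "W2 - W\<^sup>2 / (2 * e) + (2 * e * k - W)\<^sup>2 / (2 * e) = W2 - 2 * k * W + 2 * e * k\<^sup>2"
    using e by (simp add: power2_eq_square field_simps)
  moreover have "0 \<le> (2 * e * k - W)\<^sup>2 / (2 * e)" using e by simp
  ultimately have "W2 - W\<^sup>2 / (2 * e) \<le> 2 * e * (2 * e * D)" by linarith
  then show ?thesis by (simp add: W_def W2_def D_def power2_eq_square)
qed

lemma integral_weight: "0 \<le> L \<Longrightarrow> integral {0..L} (\<lambda>r::real. r) = L\<^sup>2 / 2"
  by (rule integral_unique) (use ident_has_integral[of 0 L] in simp)

text \<open>The common end value \<open>c = f L = g L\<close> is subtracted from both functions.  The left-hand side is \<open>s\<^sup>2\<close> times the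
  variance with respect to the weight \<open>r\<close> on both copies of the interval, whose total mass is \<open>L\<^sup>2\<close>; the variance
  is the minimum of the quadratic deviation from a constant, hence at most the one from \<open>c\<close>.\<close>

lemma bessel_hardy_glued:
  fixes f g f' g' :: "real \<Rightarrow> real"
  assumes L: "0 < L" and s: "0 \<le> s" "s * L < j01"
    and f': "\<And>r. r \<in> {0..L} \<Longrightarrow> (f has_real_derivative f' r) (at r within {0..L})"
    and g': "\<And>r. r \<in> {0..L} \<Longrightarrow> (g has_real_derivative g' r) (at r within {0..L})"
    and cont: "continuous_on {0..L} f'" "continuous_on {0..L} g'"
    and glue: "f L = g L"
  shows "s\<^sup>2 * (integral {0..L} (\<lambda>r. r * ((f r)\<^sup>2 + (g r)\<^sup>2)) - (integral {0..L} (\<lambda>r. r * (f r + g r)))\<^sup>2 / L\<^sup>2)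
    \<le> integral {0..L} (\<lambda>r. r * ((f' r)\<^sup>2 + (g' r)\<^sup>2))"
proof -
  define c where "c = f L"
  have cf: "continuous_on {0..L} f" by (rule DERIV_continuous_on) (rule f')
  have cg: "continuous_on {0..L} g" by (rule DERIV_continuous_on) (rule g')
  have 1: "s\<^sup>2 * integral {0..L} (\<lambda>r. r * (f r - c)\<^sup>2) \<le> integral {0..L} (\<lambda>r. r * (f' r)\<^sup>2)"
    by (rule bessel_hardy[OF L s _ cont(1)]) (auto intro!: derivative_eq_intros f' simp: c_def)
  have 2: "s\<^sup>2 * integral {0..L} (\<lambda>r. r * (g r - c)\<^sup>2) \<le> integral {0..L} (\<lambda>r. r * (g' r)\<^sup>2)"
    by (rule bessel_hardy[OF L s _ cont(2)]) (auto intro!: derivative_eq_intros g' simp: c_def glue)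
  define A B where "A = integral {0..L} (\<lambda>r. r * ((f r)\<^sup>2 + (g r)\<^sup>2))" and "B = integral {0..L} (\<lambda>r. r * (f r + g r))"
  have i: "((\<lambda>r. r * ((f r)\<^sup>2 + (g r)\<^sup>2)) has_integral A) {0..L}" "((\<lambda>r. r * (f r + g r)) has_integral B) {0..L}"
    "((\<lambda>r. r) has_integral (L\<^sup>2 / 2)) {0..L}"
    unfolding A_def B_def using L ident_has_integral[of 0 L]
    by (auto intro!: integrable_integral integrable_continuous_real continuous_intros cf cg)
  have j: "(\<lambda>r. r * (f r - c)\<^sup>2) integrable_on {0..L}" "(\<lambda>r. r * (g r - c)\<^sup>2) integrable_on {0..L}"
    "(\<lambda>r. r * (f' r)\<^sup>2) integrable_on {0..L}" "(\<lambda>r. r * (g' r)\<^sup>2) integrable_on {0..L}"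
    by (intro integrable_continuous_real continuous_intros cf cg cont)+
  have "((\<lambda>r. r * ((f r)\<^sup>2 + (g r)\<^sup>2) - (2 * c) * (r * (f r + g r)) + (2 * c\<^sup>2) * r)
      has_integral (A - (2 * c) * B + (2 * c\<^sup>2) * (L\<^sup>2 / 2))) {0..L}"
    by (intro has_integral_add has_integral_diff has_integral_mult_right i)
  moreover have "r * ((f r)\<^sup>2 + (g r)\<^sup>2) - (2 * c) * (r * (f r + g r)) + (2 * c\<^sup>2) * r
      = r * (f r - c)\<^sup>2 + r * (g r - c)\<^sup>2" for r
    by (simp add: power2_eq_square algebra_simps)
  ultimately have "((\<lambda>r. r * (f r - c)\<^sup>2 + r * (g r - c)\<^sup>2) has_integral (A - (2 * c) * B + (2 * c\<^sup>2) * (L\<^sup>2 / 2))) {0..L}"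
    by simp
  then have eq: "integral {0..L} (\<lambda>r. r * (f r - c)\<^sup>2) + integral {0..L} (\<lambda>r. r * (g r - c)\<^sup>2)
      = A - 2 * c * B + c\<^sup>2 * L\<^sup>2"
    using j by (simp add: integral_unique flip: Henstock_Kurzweil_Integration.integral_add)
  have "A - B\<^sup>2 / L\<^sup>2 + (c * L - B / L)\<^sup>2 = A - 2 * c * B + c\<^sup>2 * L\<^sup>2"
    using L by (simp add: power2_eq_square field_simps)
  then have "A - B\<^sup>2 / L\<^sup>2 \<le> A - 2 * c * B + c\<^sup>2 * L\<^sup>2" using zero_le_power2[of "c * L - B / L"] by linarith
  then have "s\<^sup>2 * (A - B\<^sup>2 / L\<^sup>2) \<le> s\<^sup>2 * (A - 2 * c * B + c\<^sup>2 * L\<^sup>2)" by (rule mult_left_mono) simp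
  also have "\<dots> \<le> integral {0..L} (\<lambda>r. r * (f' r)\<^sup>2) + integral {0..L} (\<lambda>r. r * (g' r)\<^sup>2)"
    unfolding eq[symmetric] distrib_left using 1 2 by (rule add_mono)
  also have "\<dots> = integral {0..L} (\<lambda>r. r * ((f' r)\<^sup>2 + (g' r)\<^sup>2))"
    using j by (simp add: distrib_left Henstock_Kurzweil_Integration.integral_add)
  finally show ?thesis unfolding A_def B_def .
qed

lemma inner_pt: "x \<bullet> pt a b = x $ 1 * a + x $ 2 * b"
  by (simp add: inner_vec_def sum_2)

text \<open>The left-hand side is the squared derivative along a leaf.  The mixed term is split so that the square of
  the axial component \<open>a\<close> is enlarged by a factor \<open>1 + O(e\<^sup>2)\<close> only; the price is the coefficient of \<open>b\<^sup>2\<close>, which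
  stays near \<open>1/2\<close> and thus leaves room for the oscillation of the leaf means.\<close>

lemma cone_derivative_square:
  fixes e t \<sigma> a b :: real
  assumes e: "0 < e" and t: "t \<in> {-e..e}" and \<sigma>: "\<sigma>\<^sup>2 = 1"
  shows "(t * b - \<sigma> * a)\<^sup>2 \<le> (1 + 2 * e\<^sup>2) * a\<^sup>2 + (e\<^sup>2 + 1 / 2) * b\<^sup>2"
proof -
  have t2: "t\<^sup>2 \<le> e\<^sup>2" using t e by (simp add: abs_le_square_iff[symmetric] abs_le_iff)
  have tb: "t\<^sup>2 * b\<^sup>2 \<le> e\<^sup>2 * b\<^sup>2" by (rule mult_right_mono[OF t2]) simp
  have "0 \<le> (2 * e\<^sup>2 * a + \<sigma> * t * b)\<^sup>2" by simp
  also have "\<dots> = 4 * (e\<^sup>2 * e\<^sup>2) * a\<^sup>2 + 4 * e\<^sup>2 * (\<sigma> * t * a * b) + \<sigma>\<^sup>2 * (t\<^sup>2 * b\<^sup>2)"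
    by (simp add: power2_eq_square algebra_simps)
  also have "\<dots> \<le> 4 * (e\<^sup>2 * e\<^sup>2) * a\<^sup>2 + 4 * e\<^sup>2 * (\<sigma> * t * a * b) + e\<^sup>2 * b\<^sup>2"
    using tb \<sigma> by simp
  also have "\<dots> = e\<^sup>2 * (4 * e\<^sup>2 * a\<^sup>2 + 4 * (\<sigma> * t * a * b) + b\<^sup>2)"
    by (simp add: algebra_simps)
  finally have "0 \<le> 4 * e\<^sup>2 * a\<^sup>2 + 4 * (\<sigma> * t * a * b) + b\<^sup>2"
    using e by (simp add: zero_le_mult_iff)
  moreover have "(t * b - \<sigma> * a)\<^sup>2 = t\<^sup>2 * b\<^sup>2 - 2 * (\<sigma> * t * a * b) + \<sigma>\<^sup>2 * a\<^sup>2"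
    by (simp add: power2_eq_square algebra_simps)
  ultimately show ?thesis using tb \<sigma> by (simp add: algebra_simps)
qed

text \<open>The number \<open>2 e L\<^sup>2\<close> is the area of the rhombus, so the left-hand side is \<open>s\<^sup>2\<close> times the variance of \<open>U\<close>.  It
  splits into the variance along the leaves and the variance of the leaf means.  The former costs
  \<open>(1 + 2 e\<^sup>2)\<close> of the axial and \<open>1/2 + e\<^sup>2\<close> of the transversal energy, the latter \<open>4 s\<^sup>2 e\<^sup>2 \<le> 1/2\<close> of the
  transversal energy, by the smallness condition on \<open>e\<close>.\<close>

lemma rhombus_Poincare_C1:
  fixes U :: "real^2 \<Rightarrow> real" and G :: "real^2 \<Rightarrow> real^2"
  assumes e: "0 < e" and L: "0 < L" "L \<le> 1" and s: "0 \<le> s" "s < j01" "8 * s\<^sup>2 * e\<^sup>2 \<le> 1"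
  defines "K \<equiv> closed_rhombus e L"
  assumes dU: "\<And>x. x \<in> K \<Longrightarrow> (U has_derivative (\<lambda>h. G x \<bullet> h)) (at x)" and cG: "continuous_on K G"
  shows "s\<^sup>2 * ((LINT x|lborel. indicator K x * (U x)\<^sup>2) - (LINT x|lborel. indicator K x * U x)\<^sup>2 / (2 * e * L\<^sup>2))
    \<le> (1 + 2 * e\<^sup>2) * (LINT x|lborel. indicator K x * (norm (G x))\<^sup>2)"
proof -
  define P where "P t r = pt (L - r) (t * r)" for t r
  define Q where "Q t r = pt (r - L) (t * r)" for t r
  have PK: "P t r \<in> K" "Q t r \<in> K" if "t \<in> {-e..e}" "r \<in> {0..L}" for t r
    using cone_in_closed_rhombus[OF e that] by (auto simp: P_def Q_def K_def)
  have cU: "continuous_on K U"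
    using dU has_derivative_continuous continuous_at_imp_continuous_on by blast
  \<comment> \<open>\<open>J F t\<close> integrates \<open>F\<close> over the leaf with parameter \<open>t\<close>.\<close>
  define J where "J F t = integral {0..L} (\<lambda>r. r * (F (P t r) + F (Q t r)))" for F :: "real^2 \<Rightarrow> real" and t
  have cF: "continuous_on ({-e..e} \<times> {0..L}) (\<lambda>(t, r). F (P t r))"
    "continuous_on ({-e..e} \<times> {0..L}) (\<lambda>(t, r). F (Q t r))"
    if "continuous_on K F" for F :: "real^2 \<Rightarrow> real"
    unfolding case_prod_unfold P_def Q_def
    by (rule continuous_on_compose2[OF that], intro continuous_intros,
        use PK in \<open>auto simp: P_def Q_def\<close>)+
  have cr: "continuous_on {0..L} (\<lambda>r. F (P t r))" "continuous_on {0..L} (\<lambda>r. F (Q t r))"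
    if "continuous_on K F" "t \<in> {-e..e}" for F :: "real^2 \<Rightarrow> real" and t
    unfolding P_def Q_def
    by (rule continuous_on_compose2[OF that(1)], intro continuous_intros,
        use PK that(2) in \<open>auto simp: P_def Q_def\<close>)+
  have cJ: "continuous_on {-e..e} (J F)" if "continuous_on K F" for F
  proof -
    have "continuous_on ({-e..e} \<times> cbox 0 L) (\<lambda>(t, r). r * (F (P t r) + F (Q t r)))"
      using cF[OF that] by (auto simp: case_prod_unfold intro!: continuous_intros)
    from integral_continuous_on_param[OF this] show ?thesis by (simp add: J_def[abs_def])
  qed
  have iJ: "J F integrable_on {-e..e}" if "continuous_on K F" for F
    using cJ[OF that] by (rule integrable_continuous_real)
  have IJ: "(LINT x|lborel. indicator K x * F x) = integral {-e..e} (J F)" if "continuous_on K F" for F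
    using integral_closed_rhombus[OF e L(1) that[unfolded K_def]] unfolding K_def J_def[abs_def] P_def Q_def .
  have lin: "J (\<lambda>x. \<alpha> * F x + \<beta> * F' x) t = \<alpha> * J F t + \<beta> * J F' t"
    if c: "continuous_on K F" "continuous_on K F'" and t: "t \<in> {-e..e}" for F F' t and \<alpha> \<beta> :: real
  proof -
    have i: "(\<lambda>r. r * (F (P t r) + F (Q t r))) integrable_on {0..L}" "(\<lambda>r. r * (F' (P t r) + F' (Q t r))) integrable_on {0..L}"
      by (intro integrable_continuous_real continuous_intros cr c t)+
    have "J (\<lambda>x. \<alpha> * F x + \<beta> * F' x) t
      = integral {0..L} (\<lambda>r. \<alpha> * (r * (F (P t r) + F (Q t r))) + \<beta> * (r * (F' (P t r) + F' (Q t r))))"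
      unfolding J_def by (intro integral_cong) (simp add: algebra_simps)
    also have "\<dots> = \<alpha> * J F t + \<beta> * J F' t"
      unfolding J_def using has_integral_add[OF has_integral_mult_right[OF integrable_integral[OF i(1)], of \<alpha>]
          has_integral_mult_right[OF integrable_integral[OF i(2)], of \<beta>]]
      by (rule integral_unique)
    finally show ?thesis .
  qed
  define G1 where "G1 x = (G x $ 1)\<^sup>2" for x
  define G2 where "G2 x = (G x $ 2)\<^sup>2" for x
  have c1: "continuous_on K G1" and c2: "continuous_on K G2"
    unfolding G1_def[abs_def] G2_def[abs_def] by (intro continuous_intros cG)+
  have cU2: "continuous_on K (\<lambda>x. (U x)\<^sup>2)" by (intro continuous_intros cU)
  have G0: "0 \<le> G1 x" "0 \<le> G2 x" for x by (auto simp: G1_def G2_def)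
  have Gn: "(norm (G x))\<^sup>2 = 1 * G1 x + 1 * G2 x" for x
    unfolding power2_norm_eq_inner G1_def G2_def by (simp add: inner_vec_def sum_2 power2_eq_square)
  \<comment> \<open>The Hardy inequality on each leaf: the two halves meet at \<open>r = L\<close>, on the short diagonal.\<close>
  have radial: "s\<^sup>2 * (J (\<lambda>x. (U x)\<^sup>2) t - (J U t)\<^sup>2 / L\<^sup>2) \<le> (1 + 2 * e\<^sup>2) * J G1 t + (e\<^sup>2 + 1 / 2) * J G2 t"
    if t: "t \<in> {-e..e}" for t
  proof -
    let ?f' = "\<lambda>r. t * (G (P t r) $ 2) - 1 * (G (P t r) $ 1)"
    let ?g' = "\<lambda>r. t * (G (Q t r) $ 2) - (- 1) * (G (Q t r) $ 1)"
    have Gc: "continuous_on {0..L} (\<lambda>r. G (P t r) $ i)" "continuous_on {0..L} (\<lambda>r. G (Q t r) $ i)" for i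
    proof -
      have "continuous_on K (\<lambda>x. G x $ i)" by (intro continuous_intros cG)
      from cr[OF this t] show "continuous_on {0..L} (\<lambda>r. G (P t r) $ i)" "continuous_on {0..L} (\<lambda>r. G (Q t r) $ i)" .
    qed
    have cont: "continuous_on {0..L} ?f'" "continuous_on {0..L} ?g'"
      by (intro continuous_intros Gc)+
    have "s\<^sup>2 * (J (\<lambda>x. (U x)\<^sup>2) t - (J U t)\<^sup>2 / L\<^sup>2) \<le> integral {0..L} (\<lambda>r. r * ((?f' r)\<^sup>2 + (?g' r)\<^sup>2))"
      unfolding J_def
    proof (rule bessel_hardy_glued[OF L(1) s(1) _ _ _ cont])
      have "s * L \<le> s * 1" using L s by (intro mult_left_mono) auto
      then show "s * L < j01" using s by simp
      show "U (P t L) = U (Q t L)" by (simp add: P_def Q_def)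
      fix r assume r: "r \<in> {0..L}"
      have "((\<lambda>r. P t r) has_derivative (\<lambda>h. pt (- h) (t * h))) (at r within {0..L})"
        unfolding P_def by (rule pt_has_derivative) (auto intro!: derivative_eq_intros)
      from has_derivative_compose[OF this dU[OF PK(1)[OF t r]]]
      show "((\<lambda>r. U (P t r)) has_real_derivative ?f' r) (at r within {0..L})"
        unfolding has_field_derivative_def
        by (rule has_derivative_eq_rhs) (simp add: inner_pt fun_eq_iff algebra_simps)
      have "((\<lambda>r. Q t r) has_derivative (\<lambda>h. pt h (t * h))) (at r within {0..L})"
        unfolding Q_def by (rule pt_has_derivative) (auto intro!: derivative_eq_intros)
      from has_derivative_compose[OF this dU[OF PK(2)[OF t r]]]
      show "((\<lambda>r. U (Q t r)) has_real_derivative ?g' r) (at r within {0..L})"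
        unfolding has_field_derivative_def
        by (rule has_derivative_eq_rhs) (simp add: inner_pt fun_eq_iff algebra_simps)
    qed
    also have "\<dots> \<le> J (\<lambda>x. (1 + 2 * e\<^sup>2) * G1 x + (e\<^sup>2 + 1 / 2) * G2 x) t"
      unfolding J_def
    proof (rule integral_le)
      show "(\<lambda>r. r * ((?f' r)\<^sup>2 + (?g' r)\<^sup>2)) integrable_on {0..L}"
        by (intro integrable_continuous_real continuous_intros Gc)
      show "(\<lambda>r. r * ((1 + 2 * e\<^sup>2) * G1 (P t r) + (e\<^sup>2 + 1 / 2) * G2 (P t r)
          + ((1 + 2 * e\<^sup>2) * G1 (Q t r) + (e\<^sup>2 + 1 / 2) * G2 (Q t r)))) integrable_on {0..L}"
        by (intro integrable_continuous_real continuous_intros cr c1 c2 t)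
      fix r assume r: "r \<in> {0..L}"
      show "r * ((?f' r)\<^sup>2 + (?g' r)\<^sup>2) \<le> r * ((1 + 2 * e\<^sup>2) * G1 (P t r) + (e\<^sup>2 + 1 / 2) * G2 (P t r)
          + ((1 + 2 * e\<^sup>2) * G1 (Q t r) + (e\<^sup>2 + 1 / 2) * G2 (Q t r)))"
        unfolding G1_def G2_def
        by (intro mult_left_mono add_mono cone_derivative_square[OF e t]) (use r in auto)
    qed
    also have "\<dots> = (1 + 2 * e\<^sup>2) * J G1 t + (e\<^sup>2 + 1 / 2) * J G2 t" by (rule lin[OF c1 c2 t])
    finally show ?thesis .
  qed
  \<comment> \<open>The leaf integrals \<open>J U\<close> are differentiable in \<open>t\<close>, with derivative \<open>w'\<close>: at fixed \<open>r\<close>, moving \<open>t\<close> moves the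
    point vertically with speed \<open>r\<close>.\<close>
  define w' where "w' t = integral {0..L} (\<lambda>r. r * (r * (G (P t r) $ 2 + G (Q t r) $ 2)))" for t
  have cg: "continuous_on K (\<lambda>x. G x $ 2)" by (intro continuous_intros cG)
  have cw2: "continuous_on ({-e..e} \<times> cbox 0 L) (\<lambda>(t, r). r * (r * (G (P t r) $ 2 + G (Q t r) $ 2)))"
    using cF[OF cg] by (auto simp: case_prod_unfold intro!: continuous_intros)
  have cw': "continuous_on {-e..e} w'"
    using integral_continuous_on_param[OF cw2] by (simp add: w'_def[abs_def])
  have dw: "(J U has_real_derivative w' t) (at t within {-e..e})" if t: "t \<in> {-e..e}" for t
  proof -
  have "((\<lambda>t. integral (cbox 0 L) (\<lambda>r. r * (U (P t r) + U (Q t r)))) has_real_derivative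
      integral (cbox 0 L) (\<lambda>r. r * (r * (G (P t r) $ 2 + G (Q t r) $ 2)))) (at t within {-e..e})"
  proof (rule leibniz_rule_field_derivative[OF _ _ cw2 t])
    show "(\<lambda>r. r * (U (P x r) + U (Q x r))) integrable_on cbox 0 L" if "x \<in> {-e..e}" for x
      unfolding cbox_interval by (intro integrable_continuous_real continuous_intros cr cU that)
    fix x r assume x: "x \<in> {-e..e}" and "r \<in> cbox 0 L"
    then have r: "r \<in> {0..L}" by simp
    have "((\<lambda>t. P t r) has_derivative (\<lambda>h. pt 0 (h * r))) (at x within {-e..e})"
      unfolding P_def by (rule pt_has_derivative) (auto intro!: derivative_eq_intros)
    from has_derivative_compose[OF this dU[OF PK(1)[OF x r]]]
    have 1: "((\<lambda>t. U (P t r)) has_real_derivative r * (G (P x r) $ 2)) (at x within {-e..e})"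
      unfolding has_field_derivative_def
      by (rule has_derivative_eq_rhs) (simp add: inner_pt fun_eq_iff algebra_simps)
    have "((\<lambda>t. Q t r) has_derivative (\<lambda>h. pt 0 (h * r))) (at x within {-e..e})"
      unfolding Q_def by (rule pt_has_derivative) (auto intro!: derivative_eq_intros)
    from has_derivative_compose[OF this dU[OF PK(2)[OF x r]]]
    have 2: "((\<lambda>t. U (Q t r)) has_real_derivative r * (G (Q x r) $ 2)) (at x within {-e..e})"
      unfolding has_field_derivative_def
      by (rule has_derivative_eq_rhs) (simp add: inner_pt fun_eq_iff algebra_simps)
    show "((\<lambda>t. r * (U (P t r) + U (Q t r))) has_real_derivative r * (r * (G (P x r) $ 2 + G (Q x r) $ 2))) (at x within {-e..e})"
      using DERIV_cmult[OF DERIV_add[OF 1 2], of r] by (simp add: distrib_left)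
  qed simp
  then show ?thesis by (simp add: J_def[abs_def] w'_def)
  qed
  have w'2: "(w' t)\<^sup>2 \<le> L\<^sup>2 * J G2 t" if t: "t \<in> {-e..e}" for t
  proof -
    let ?p = "\<lambda>r. G (P t r) $ 2" and ?q = "\<lambda>r. G (Q t r) $ 2"
    note c = cr[OF cg t]
    have "(w' t)\<^sup>2 \<le> integral {0..L} (\<lambda>r. r) * integral {0..L} (\<lambda>r. r * (r * (?p r + ?q r))\<^sup>2)"
      unfolding w'_def
    proof (rule weighted_Cauchy_Schwarz)
      show "0 < integral {0..L} (\<lambda>r. r)" using L by (simp add: integral_weight)
    qed (auto intro!: continuous_intros c)
    also have "\<dots> \<le> (L\<^sup>2 / 2) * integral {0..L} (\<lambda>r. 2 * (r * (G2 (P t r) + G2 (Q t r))))"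
    proof (rule mult_mono)
      show "integral {0..L} (\<lambda>r. r * (r * (?p r + ?q r))\<^sup>2) \<le> integral {0..L} (\<lambda>r. 2 * (r * (G2 (P t r) + G2 (Q t r))))"
      proof (rule integral_le)
        fix r assume r: "r \<in> {0..L}"
        have "r\<^sup>2 * (?p r + ?q r)\<^sup>2 \<le> 1 * (?p r + ?q r)\<^sup>2"
          using r L by (intro mult_right_mono) (auto simp: power_le_one)
        also have "\<dots> \<le> 2 * (G2 (P t r) + G2 (Q t r))"
          using zero_le_power2[of "?p r - ?q r"] by (simp add: G2_def power2_sum power2_diff)
        finally have "r * (r\<^sup>2 * (?p r + ?q r)\<^sup>2) \<le> r * (2 * (G2 (P t r) + G2 (Q t r)))"
          using r by (intro mult_left_mono) auto
        then show "r * (r * (?p r + ?q r))\<^sup>2 \<le> 2 * (r * (G2 (P t r) + G2 (Q t r)))"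
          by (simp add: power_mult_distrib mult_ac)
      qed (intro integrable_continuous_real continuous_intros c cr c2 t)+
      show "0 \<le> integral {0..L} (\<lambda>r. r * (r * (?p r + ?q r))\<^sup>2)"
        by (rule integral_nonneg) (auto intro!: integrable_continuous_real continuous_intros c)
    qed (use L in \<open>auto simp: integral_weight\<close>)
    also have "\<dots> = L\<^sup>2 * J G2 t" by (simp add: J_def)
    finally show ?thesis .
  qed
  define W2 where "W2 = integral {-e..e} (\<lambda>t. (J U t)\<^sup>2)"
  define W where "W = integral {-e..e} (J U)"
  define A where "A = integral {-e..e} (J (\<lambda>x. (U x)\<^sup>2))"
  define B1 where "B1 = integral {-e..e} (J G1)"
  define B2 where "B2 = integral {-e..e} (J G2)"
  have hi: "(J (\<lambda>x. (U x)\<^sup>2) has_integral A) {-e..e}" "(J G1 has_integral B1) {-e..e}" "(J G2 has_integral B2) {-e..e}"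
    "((\<lambda>t. (J U t)\<^sup>2) has_integral W2) {-e..e}"
    unfolding A_def B1_def B2_def W2_def
    by (intro integrable_integral iJ cU2 c1 c2 integrable_continuous_real continuous_intros cJ cU)+
  have "W2 - W\<^sup>2 / (2 * e) \<le> 4 * e\<^sup>2 * integral {-e..e} (\<lambda>t. (w' t)\<^sup>2)"
    unfolding W2_def W_def by (rule interval_Poincare[OF e dw cw'])
  also have "\<dots> \<le> 4 * e\<^sup>2 * (L\<^sup>2 * B2)"
  proof (rule mult_left_mono)
    have "((\<lambda>t. (w' t)\<^sup>2) has_integral integral {-e..e} (\<lambda>t. (w' t)\<^sup>2)) {-e..e}"
      by (intro integrable_integral integrable_continuous_real continuous_intros cw')
    from has_integral_le[OF this has_integral_mult_right[OF hi(3)] w'2]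
    show "integral {-e..e} (\<lambda>t. (w' t)\<^sup>2) \<le> L\<^sup>2 * B2" .
  qed simp
  finally have trans: "(W2 - W\<^sup>2 / (2 * e)) / L\<^sup>2 \<le> 4 * e\<^sup>2 * B2"
    using L by (simp add: pos_divide_le_eq mult_ac)
  have "((\<lambda>t. s\<^sup>2 * (J (\<lambda>x. (U x)\<^sup>2) t - (J U t)\<^sup>2 / L\<^sup>2)) has_integral (s\<^sup>2 * (A - W2 / L\<^sup>2))) {-e..e}"
    by (intro has_integral_mult_right has_integral_diff has_integral_divide hi)
  moreover have "((\<lambda>t. (1 + 2 * e\<^sup>2) * J G1 t + (e\<^sup>2 + 1 / 2) * J G2 t)
      has_integral ((1 + 2 * e\<^sup>2) * B1 + (e\<^sup>2 + 1 / 2) * B2)) {-e..e}"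
    by (intro has_integral_mult_right has_integral_add hi)
  ultimately have rad: "s\<^sup>2 * (A - W2 / L\<^sup>2) \<le> (1 + 2 * e\<^sup>2) * B1 + (e\<^sup>2 + 1 / 2) * B2"
    by (rule has_integral_le) (rule radial)
  have B2: "0 \<le> B2" unfolding B2_def J_def[abs_def]
  proof (rule integral_nonneg[OF iJ[OF c2, unfolded J_def[abs_def]]])
    show "0 \<le> integral {0..L} (\<lambda>r. r * (G2 (P t r) + G2 (Q t r)))" if t: "t \<in> {-e..e}" for t
      by (rule integral_nonneg[OF integrable_continuous_real])
        (auto intro!: continuous_intros cr c2 t mult_nonneg_nonneg add_nonneg_nonneg G0 simp: t[simplified])
  qed
  have "A - W\<^sup>2 / (2 * e * L\<^sup>2) = (A - W2 / L\<^sup>2) + (W2 - W\<^sup>2 / (2 * e)) / L\<^sup>2"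
    by (simp add: diff_divide_distrib)
  then have "s\<^sup>2 * (A - W\<^sup>2 / (2 * e * L\<^sup>2)) = s\<^sup>2 * (A - W2 / L\<^sup>2) + s\<^sup>2 * ((W2 - W\<^sup>2 / (2 * e)) / L\<^sup>2)"
    by (simp only: distrib_left)
  also have "\<dots> \<le> ((1 + 2 * e\<^sup>2) * B1 + (e\<^sup>2 + 1 / 2) * B2) + s\<^sup>2 * (4 * e\<^sup>2 * B2)"
    using rad trans by (intro add_mono mult_left_mono) auto
  also have "\<dots> = (1 + 2 * e\<^sup>2) * B1 + (e\<^sup>2 + 1 / 2 + 4 * s\<^sup>2 * e\<^sup>2) * B2" by (simp add: algebra_simps)
  also have "\<dots> \<le> (1 + 2 * e\<^sup>2) * B1 + (1 + 2 * e\<^sup>2) * B2"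
  proof (intro add_left_mono mult_right_mono B2)
    show "e\<^sup>2 + 1 / 2 + 4 * s\<^sup>2 * e\<^sup>2 \<le> 1 + 2 * e\<^sup>2"
      using s(3) zero_le_power2[of e] by linarith
  qed
  also have "\<dots> = (1 + 2 * e\<^sup>2) * integral {-e..e} (J (\<lambda>x. 1 * G1 x + 1 * G2 x))"
  proof -
    have "integral {-e..e} (J (\<lambda>x. 1 * G1 x + 1 * G2 x)) = integral {-e..e} (\<lambda>t. 1 * J G1 t + 1 * J G2 t)"
      by (rule integral_cong) (rule lin[OF c1 c2])
    also have "\<dots> = B1 + B2" using has_integral_add[OF hi(2,3)] by (simp add: integral_unique)
    finally show ?thesis by (simp add: distrib_left)
  qed
  also have "integral {-e..e} (J (\<lambda>x. 1 * G1 x + 1 * G2 x)) = (LINT x|lborel. indicator K x * (norm (G x))\<^sup>2)"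
  proof -
    have "continuous_on K (\<lambda>x. 1 * G1 x + 1 * G2 x)" by (intro continuous_intros c1 c2)
    from IJ[OF this] show ?thesis by (simp only: Gn)
  qed
  finally show ?thesis unfolding A_def W_def IJ[OF cU2] IJ[OF cU] .
qed

section \<open>The Poincare inequality in \<open>H\<^sup>1\<close>\<close>

lemma Fatou_square_integral:
  fixes f :: "nat \<Rightarrow> 'a \<Rightarrow> real"
  assumes f: "\<And>n. integrable M (\<lambda>x. (f n x)\<^sup>2)" "\<And>n. f n \<in> borel_measurable M"
    and v: "integrable M (\<lambda>x. (v x)\<^sup>2)" and ae: "AE x in M. (\<lambda>n. f n x) \<longlonglongrightarrow> v x"
    and b: "\<And>n. (LINT x|M. (f n x)\<^sup>2) \<le> c n" and c: "c \<longlonglongrightarrow> c'"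
  shows "(LINT x|M. (v x)\<^sup>2) \<le> c'"
proof -
  have [measurable]: "f n \<in> borel_measurable M" for n by (rule f(2))
  have int0: "0 \<le> (LINT x|M. (f n x)\<^sup>2)" for n by (intro integral_nonneg_AE) auto
  have c0: "0 \<le> c n" for n using int0 b by (rule order_trans)
  have c'0: "0 \<le> c'" by (rule LIMSEQ_le_const[OF c]) (use c0 in auto)
  have "ennreal (LINT x|M. (v x)\<^sup>2) = (\<integral>\<^sup>+x. ennreal ((v x)\<^sup>2) \<partial>M)"
    by (rule nn_integral_eq_integral[symmetric, OF v]) simp
  also have "\<dots> = (\<integral>\<^sup>+x. liminf (\<lambda>n. ennreal ((f n x)\<^sup>2)) \<partial>M)"
  proof (rule nn_integral_cong_AE)
    show "AE x in M. ennreal ((v x)\<^sup>2) = liminf (\<lambda>n. ennreal ((f n x)\<^sup>2))"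
      using ae
    proof eventually_elim
      case (elim x)
      then have "(\<lambda>n. ennreal ((f n x)\<^sup>2)) \<longlonglongrightarrow> ennreal ((v x)\<^sup>2)" by (intro tendsto_intros) auto
      then show ?case by (intro lim_imp_Liminf[symmetric]) auto
    qed
  qed
  also have "\<dots> \<le> liminf (\<lambda>n. \<integral>\<^sup>+x. ennreal ((f n x)\<^sup>2) \<partial>M)"
    by (rule nn_integral_liminf) measurable
  also have "\<dots> \<le> liminf (\<lambda>n. ennreal (c n))"
  proof (intro Liminf_mono always_eventually allI)
    fix n
    have "(\<integral>\<^sup>+x. ennreal ((f n x)\<^sup>2) \<partial>M) = ennreal (LINT x|M. (f n x)\<^sup>2)"
      by (rule nn_integral_eq_integral[OF f(1)]) simp
    then show "(\<integral>\<^sup>+x. ennreal ((f n x)\<^sup>2) \<partial>M) \<le> ennreal (c n)" using b by (simp add: ennreal_leI)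
  qed
  also have "\<dots> = ennreal c'" by (intro lim_imp_Liminf tendsto_ennrealI c) simp
  finally show ?thesis using c'0 by (simp add: ennreal_le_iff)
qed

text \<open>The rhombus is exhausted by the compact rhombi of half-length \<open>L n\<close>, and on the \<open>n\<close>-th of them \<open>v\<close> is replaced
  by a mollified function.  The functions so obtained, extended by \<open>0\<close>, converge to \<open>v\<close> in \<open>L\<^sup>1\<close>, so that their
  means tend to \<open>0\<close> and a subsequence converges almost everywhere.\<close>

lemma rhombus_Poincare:
  assumes e: "0 < e" "e \<le> 1" and s: "0 < s" "s < j01" "8 * s\<^sup>2 * e\<^sup>2 \<le> 1"
    and bw: "borel_weak_gradient (rhombus e) v g" and mean: "(LINT x|lborel. v x) = 0"
  shows "s\<^sup>2 * (LINT x|lborel. (v x)\<^sup>2) \<le> (1 + 2 * e\<^sup>2) * (LINT x|lborel. (norm (g x))\<^sup>2)"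
proof -
  let ?R = "rhombus e"
  have O: "open ?R" "bounded ?R" using e by (auto intro: open_rhombus bounded_rhombus)
  have [measurable]: "v \<in> borel_measurable borel" and v0: "\<And>x. x \<notin> ?R \<Longrightarrow> v x = 0"
    and iv2: "integrable lborel (\<lambda>x. (v x)\<^sup>2)"
    using bw unfolding borel_weak_gradient_def by blast+
  have iv: "integrable lborel v"
    by (rule square_integrable_bounded_support[OF O]) (use v0 iv2 in simp_all)
  define E where "E = (LINT x|lborel. (norm (g x))\<^sup>2)"
  define L where "L n = 1 + - inverse (real (Suc (Suc n)))" for n
  have L: "0 < L n" "L n < 1" for n by (auto simp: L_def field_simps)
  have Llim: "L \<longlonglongrightarrow> 1"
    unfolding L_def[abs_def] by (rule LIMSEQ_Suc[OF LIMSEQ_inverse_real_of_nat_add_minus])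
  define K where "K n = closed_rhombus e (L n)" for n
  have K: "compact (K n)" "K n \<subseteq> ?R" for n
    using compact_closed_rhombus[OF e(1)] L[of n] by (auto simp: K_def closed_rhombus_def rhombus_def)
  have mK [measurable]: "K n \<in> sets borel" for n using K(1) by (simp add: borel_compact)
  define good where "good n U G \<longleftrightarrow> (\<forall>x\<in>K n. (U has_derivative (\<lambda>h. G x \<bullet> h)) (at x)) \<and> continuous_on (K n) G \<and>
    (LINT x|lborel. indicator (K n) x * (norm (G x))\<^sup>2) \<le> E \<and>
    (LINT x|lborel. indicator (K n) x * \<bar>U x - v x\<bar>) \<le> inverse (real (Suc n))" for n U G
  have "\<exists>U G. good n U G" for n
    unfolding good_def E_def by (rule mollify[OF bw O K]) simp
  then obtain U G where good: "\<And>n. good n (U n) (G n)" by metis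
  have dU: "\<And>n x. x \<in> K n \<Longrightarrow> (U n has_derivative (\<lambda>h. G n x \<bullet> h)) (at x)"
    and cG: "\<And>n. continuous_on (K n) (G n)"
    and energy: "\<And>n. (LINT x|lborel. indicator (K n) x * (norm (G n x))\<^sup>2) \<le> E"
    and close: "\<And>n. (LINT x|lborel. indicator (K n) x * \<bar>U n x - v x\<bar>) \<le> inverse (real (Suc n))"
    using good unfolding good_def by blast+
  have cU: "continuous_on (K n) (U n)" for n
    using dU has_derivative_continuous continuous_at_imp_continuous_on by blast
  define f where "f n x = indicator (K n) x * U n x" for n x
  have i_f: "integrable lborel (f n)" for n
    using borel_integrable_compact[OF K(1) cU] by (simp add: f_def[abs_def])
  have f2: "(f n x)\<^sup>2 = indicator (K n) x * (U n x)\<^sup>2" for n x by (simp add: f_def indicator_def)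
  have i_f2: "integrable lborel (\<lambda>x. (f n x)\<^sup>2)" for n
    using borel_integrable_compact[OF K(1), of n "\<lambda>x. (U n x)\<^sup>2"] cU[of n] by (simp add: f2 continuous_intros)
  have bound: "s\<^sup>2 * ((LINT x|lborel. (f n x)\<^sup>2) - (LINT x|lborel. f n x)\<^sup>2 / (2 * e * (L n)\<^sup>2)) \<le> (1 + 2 * e\<^sup>2) * E" for n
  proof -
    have "s\<^sup>2 * ((LINT x|lborel. (f n x)\<^sup>2) - (LINT x|lborel. f n x)\<^sup>2 / (2 * e * (L n)\<^sup>2))
      \<le> (1 + 2 * e\<^sup>2) * (LINT x|lborel. indicator (K n) x * (norm (G n x))\<^sup>2)"
      unfolding f2 unfolding f_def K_def
      by (rule rhombus_Poincare_C1[OF e(1)]) (use L[of n] s dU cG in \<open>auto simp: K_def less_imp_le\<close>)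
    also have "\<dots> \<le> (1 + 2 * e\<^sup>2) * E" using energy by (intro mult_left_mono) auto
    finally show ?thesis .
  qed
  define d where "d n = (LINT x|lborel. \<bar>indicator (K n) x * v x - v x\<bar>)" for n
  have dlim: "d \<longlonglongrightarrow> 0"
  proof -
    have "(\<lambda>n. LINT x|lborel. \<bar>indicator (K n) x * v x - v x\<bar>) \<longlonglongrightarrow> (LINT x|(lborel :: (real^2) measure). 0)"
    proof (rule integral_dominated_convergence[where w = "\<lambda>x. \<bar>v x\<bar>"])
      show "AE x in lborel. (\<lambda>n. \<bar>indicator (K n) x * v x - v x\<bar>) \<longlonglongrightarrow> 0"
      proof (rule AE_I2, rule tendsto_eventually)
        fix x
        show "\<forall>\<^sub>F n in sequentially. \<bar>indicator (K n) x * v x - v x\<bar> = 0"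
        proof (cases "x \<in> ?R")
          case True
          then have "\<forall>\<^sub>F n in sequentially. \<bar>x $ 1\<bar> + \<bar>x $ 2\<bar> / e < L n"
            using order_tendstoD(1)[OF Llim] by (simp add: rhombus_def)
          then show ?thesis by eventually_elim (simp add: K_def closed_rhombus_def)
        qed (simp add: v0)
      qed
      show "AE x in lborel. norm \<bar>indicator (K n) x * v x - v x\<bar> \<le> \<bar>v x\<bar>" for n
        by (intro AE_I2) (simp add: indicator_def)
    qed (use iv in auto)
    then show ?thesis by (simp add: d_def[abs_def])
  qed
  have L1: "(LINT x|lborel. \<bar>f n x - v x\<bar>) \<le> inverse (real (Suc n)) + d n" for n
  proof -
    have iKv: "integrable lborel (\<lambda>x. indicator (K n) x * v x)"
      using integrable_mult_indicator[of "K n" lborel v] iv by simp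
    have eq: "indicator (K n) x * \<bar>U n x - v x\<bar> = \<bar>f n x - indicator (K n) x * v x\<bar>" for x
      by (simp add: f_def indicator_def)
    have "(LINT x|lborel. \<bar>f n x - v x\<bar>)
      \<le> (LINT x|lborel. \<bar>f n x - indicator (K n) x * v x\<bar> + \<bar>indicator (K n) x * v x - v x\<bar>)"
      using i_f[of n] iKv iv by (intro integral_mono) auto
    also have "\<dots> = (LINT x|lborel. indicator (K n) x * \<bar>U n x - v x\<bar>) + d n"
      unfolding d_def eq using i_f[of n] iKv iv by (intro Bochner_Integration.integral_add) auto
    finally show ?thesis using close[of n] by simp
  qed
  have L1lim: "(\<lambda>n. LINT x|lborel. \<bar>f n x - v x\<bar>) \<longlonglongrightarrow> 0"
  proof (rule tendsto_sandwich[OF _ _ tendsto_const])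
    show "\<forall>\<^sub>F n in sequentially. (LINT x|lborel. \<bar>f n x - v x\<bar>) \<le> inverse (real (Suc n)) + d n" using L1 by simp
    from tendsto_add[OF LIMSEQ_inverse_real_of_nat dlim] show "(\<lambda>n. inverse (real (Suc n)) + d n) \<longlonglongrightarrow> 0" by simp
  qed (auto intro!: always_eventually integral_nonneg_AE)
  have mlim: "(\<lambda>n. LINT x|lborel. f n x) \<longlonglongrightarrow> 0"
  proof (rule Lim_null_comparison[OF _ L1lim], rule always_eventually, rule allI)
    fix n
    have "(LINT x|lborel. f n x) = (LINT x|lborel. f n x - v x)" using i_f[of n] iv mean by simp
    then show "norm (LINT x|lborel. f n x) \<le> (LINT x|lborel. \<bar>f n x - v x\<bar>)"
      using integral_abs_bound[of lborel "\<lambda>x. f n x - v x"] by simp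
  qed
  have "\<exists>q. strict_mono q \<and> (AE x in lborel. (\<lambda>n. f (q n) x - v x) \<longlonglongrightarrow> 0)"
    by (rule tendsto_L1_AE_subseq) (use i_f iv L1lim in auto)
  then obtain q where q: "strict_mono q" "AE x in lborel. (\<lambda>n. f (q n) x - v x) \<longlonglongrightarrow> 0" by blast
  define c where "c n = (1 + 2 * e\<^sup>2) * E / s\<^sup>2 + (LINT x|lborel. f n x)\<^sup>2 / (2 * e * (L n)\<^sup>2)" for n
  have "c \<longlonglongrightarrow> (1 + 2 * e\<^sup>2) * E / s\<^sup>2 + 0\<^sup>2 / (2 * e * 1\<^sup>2)"
    unfolding c_def[abs_def] by (intro tendsto_intros mlim Llim) (use e in auto)
  then have clim: "c \<longlonglongrightarrow> (1 + 2 * e\<^sup>2) * E / s\<^sup>2" by simp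
  have "(LINT x|lborel. (v x)\<^sup>2) \<le> (1 + 2 * e\<^sup>2) * E / s\<^sup>2"
  proof (rule Fatou_square_integral[OF _ _ iv2])
    show "integrable lborel (\<lambda>x. (f (q n) x)\<^sup>2)" for n by (rule i_f2)
    show "f (q n) \<in> borel_measurable lborel" for n using i_f by auto
    show "AE x in lborel. (\<lambda>n. f (q n) x) \<longlonglongrightarrow> v x"
      using q(2) by eventually_elim (simp add: LIM_zero_iff)
    show "(LINT x|lborel. (f (q n) x)\<^sup>2) \<le> (c \<circ> q) n" for n
      using bound[of "q n"] s(1) by (simp add: c_def field_simps)
    show "(c \<circ> q) \<longlonglongrightarrow> (1 + 2 * e\<^sup>2) * E / s\<^sup>2"
      using clim q(1) by (rule LIMSEQ_subseq_LIMSEQ)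
  qed
  then show ?thesis using s(1) unfolding E_def[symmetric] by (simp add: field_simps)
qed

section \<open>The eigenvalue of the rhombus and the exponent\<close>

lemma continuous_lebesgue_on:
  fixes f :: "'a::euclidean_space \<Rightarrow> 'b::euclidean_space"
  assumes O: "open \<Omega>" "bounded \<Omega>" and f: "continuous_on UNIV f"
  shows "f \<in> borel_measurable (lebesgue_on \<Omega>)" "integrable (lebesgue_on \<Omega>) f"
    "(LINT x|lebesgue_on \<Omega>. f x) = (LINT x|lborel. indicator \<Omega> x *\<^sub>R f x)"
    "integrable lborel (\<lambda>x. indicator \<Omega> x *\<^sub>R f x)"
proof -
  have [measurable]: "\<Omega> \<in> sets borel" using O by simp
  have mb [measurable]: "f \<in> borel_measurable borel" by (rule borel_measurable_continuous_onI[OF f])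
  then have "f \<in> borel_measurable lborel" by simp
  then show m: "f \<in> borel_measurable (lebesgue_on \<Omega>)"
    by (intro measurable_restrict_space1 measurable_completion)
  show i: "integrable lborel (\<lambda>x. indicator \<Omega> x *\<^sub>R f x)"
  proof (rule Bochner_Integration.integrable_bound)
    show "integrable lborel (\<lambda>x. indicator (closure \<Omega>) x *\<^sub>R f x)"
      using O by (intro borel_integrable_compact continuous_on_subset[OF f]) auto
    have "norm (indicator \<Omega> x *\<^sub>R f x) \<le> norm (indicator (closure \<Omega>) x *\<^sub>R f x)" for x
      using closure_subset[of \<Omega>] by (auto simp: indicator_def)
    then show "AE x in lborel. norm (indicator \<Omega> x *\<^sub>R f x) \<le> norm (indicator (closure \<Omega>) x *\<^sub>R f x)"
      by simp
  qed simp
  have ae: "AE x in lebesgue_on \<Omega>. f x = indicator \<Omega> x *\<^sub>R f x"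
    by (rule AE_I2) simp
  have mi: "(\<lambda>x. indicator \<Omega> x *\<^sub>R f x) \<in> borel_measurable borel" by measurable
  show "integrable (lebesgue_on \<Omega>) f"
    using lebesgue_on_transfer(2)[OF O(1) m mi _ ae] i by simp
  show "(LINT x|lebesgue_on \<Omega>. f x) = (LINT x|lborel. indicator \<Omega> x *\<^sub>R f x)"
    by (rule lebesgue_on_transfer(1)[OF O(1) m mi _ ae]) simp
qed

text \<open>Integration by parts: the integral of the derivative of the compactly supported smooth function
  \<open>(x \<bullet> b + c) \<phi>\<close> vanishes.\<close>

lemma weak_gradient_affine:
  fixes \<Omega> :: "'a::euclidean_space set"
  assumes O: "open \<Omega>" "bounded \<Omega>"
  shows "weak_gradient \<Omega> (\<lambda>x. x \<bullet> b + c) (\<lambda>x. b)"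
  unfolding weak_gradient_def L2_on_def
proof (intro conjI allI impI ballI)
  have cu: "continuous_on UNIV (\<lambda>x::'a. x \<bullet> b + c)" by (intro continuous_intros)
  show "(\<lambda>x. x \<bullet> b + c) \<in> borel_measurable (lebesgue_on \<Omega>)" by (rule continuous_lebesgue_on(1)[OF O cu])
  show "integrable (lebesgue_on \<Omega>) (\<lambda>x. (norm (x \<bullet> b + c))\<^sup>2)"
    by (rule continuous_lebesgue_on(2)[OF O]) (intro continuous_intros)
  show "(\<lambda>x. b) \<in> borel_measurable (lebesgue_on \<Omega>)" by simp
  show "integrable (lebesgue_on \<Omega>) (\<lambda>x. (norm b)\<^sup>2)"
    by (rule continuous_lebesgue_on(2)[OF O]) (intro continuous_intros)
  fix \<phi> :: "'a \<Rightarrow> real" and i :: 'a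
  assume \<phi>: "test_function \<Omega> \<phi>" and i: "i \<in> Basis"
  let ?D = "\<lambda>x. frechet_derivative \<phi> (at x) i"
  let ?S = "closure {x. \<phi> x \<noteq> 0}"
  have Ck\<phi>: "\<And>k. Ck k \<phi>" and S: "compact ?S" "?S \<subseteq> \<Omega>" using \<phi> by (auto simp: test_function_def)
  have S0: "\<phi> x = 0" if "x \<notin> ?S" for x using that closure_subset[of "{x. \<phi> x \<noteq> 0}"] by blast
  have D0: "?D x = 0" if "x \<notin> ?S" for x
    by (simp add: frechet_derivative_outside_support[OF order_refl that])
  have c\<phi>: "continuous_on UNIV \<phi>" by (rule Ck_continuous[OF Ck\<phi>])
  have cD: "continuous_on UNIV ?D" by (rule Ck_continuous[OF Ck_SucD(2)[OF Ck\<phi> i]])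
  have i1: "integrable lborel (\<lambda>x. (x \<bullet> b + c) * ?D x)"
  proof -
    have "integrable lborel (\<lambda>x. indicator ?S x *\<^sub>R ((x \<bullet> b + c) * ?D x))"
      by (intro borel_integrable_compact S continuous_intros continuous_on_subset[OF cD]) auto
    moreover have "indicator ?S x *\<^sub>R ((x \<bullet> b + c) * ?D x) = (x \<bullet> b + c) * ?D x" for x
      using D0[of x] by (auto simp: indicator_def)
    ultimately show ?thesis by (simp only:)
  qed
  have i2: "integrable lborel (\<lambda>x. (b \<bullet> i) * \<phi> x)"
  proof -
    have "integrable lborel (\<lambda>x. indicator ?S x *\<^sub>R ((b \<bullet> i) * \<phi> x))"
      by (intro borel_integrable_compact S continuous_intros continuous_on_subset[OF c\<phi>]) auto
    moreover have "indicator ?S x *\<^sub>R ((b \<bullet> i) * \<phi> x) = (b \<bullet> i) * \<phi> x" for x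
      using S0[of x] by (auto simp: indicator_def)
    ultimately show ?thesis by (simp only:)
  qed
  define \<psi> where "\<psi> x = (x \<bullet> b + c) * \<phi> x" for x
  have Ck\<psi>: "Ck k \<psi>" for k
    unfolding \<psi>_def[abs_def] by (intro Ck_mult Ck_add Ck_inner Ck_const Ck\<phi>)
  have sup: "closure {x. \<psi> x \<noteq> 0} \<subseteq> ?S"
    by (rule closure_mono) (auto simp: \<psi>_def)
  have d\<psi>: "frechet_derivative \<psi> (at x) i = (x \<bullet> b + c) * ?D x + (b \<bullet> i) * \<phi> x" for x
  proof -
    have "((\<lambda>x. x \<bullet> b + c) has_derivative (\<lambda>h. h \<bullet> b)) (at x)"
      by (auto intro!: derivative_eq_intros)
    from has_derivative_mult[OF this Ck_SucD(1)[OF Ck\<phi>[of "Suc 0"]]]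
    have "(\<psi> has_derivative (\<lambda>h. (x \<bullet> b + c) * frechet_derivative \<phi> (at x) h + (h \<bullet> b) * \<phi> x)) (at x)"
      unfolding \<psi>_def[abs_def] .
    from frechet_derivative_at[OF this, symmetric] show ?thesis by (simp add: inner_commute)
  qed
  have "0 = (LINT x|lborel. frechet_derivative \<psi> (at x) i)"
    using integral_derivative_compact_support[OF Ck\<psi> sup S(1) i] by simp
  also have "\<dots> = (LINT x|lborel. (x \<bullet> b + c) * ?D x) + (LINT x|lborel. (b \<bullet> i) * \<phi> x)"
    unfolding d\<psi> using i1 i2 by (rule Bochner_Integration.integral_add)
  finally have parts: "(LINT x|lborel. (x \<bullet> b + c) * ?D x) = - (LINT x|lborel. (b \<bullet> i) * \<phi> x)" by simp
  have "(LINT x|lebesgue_on \<Omega>. (x \<bullet> b + c) * ?D x) = (LINT x|lborel. indicator \<Omega> x *\<^sub>R ((x \<bullet> b + c) * ?D x))"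
    by (rule continuous_lebesgue_on(3)[OF O]) (intro continuous_intros cD)
  also have "\<dots> = (LINT x|lborel. (x \<bullet> b + c) * ?D x)"
  proof (intro Bochner_Integration.integral_cong refl)
    show "indicator \<Omega> x *\<^sub>R ((x \<bullet> b + c) * ?D x) = (x \<bullet> b + c) * ?D x" for x
      using D0[of x] S(2) by (cases "x \<in> \<Omega>") auto
  qed
  also note parts
  also have "(LINT x|lborel. (b \<bullet> i) * \<phi> x) = (LINT x|lborel. indicator \<Omega> x *\<^sub>R ((b \<bullet> i) * \<phi> x))"
  proof (intro Bochner_Integration.integral_cong refl)
    show "(b \<bullet> i) * \<phi> x = indicator \<Omega> x *\<^sub>R ((b \<bullet> i) * \<phi> x)" for x
      using S0[of x] S(2) by (cases "x \<in> \<Omega>") auto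
  qed
  also have "\<dots> = (LINT x|lebesgue_on \<Omega>. (b \<bullet> i) * \<phi> x)"
    by (rule continuous_lebesgue_on(3)[OF O, symmetric]) (intro continuous_intros c\<phi>)
  finally show "(LINT x|lebesgue_on \<Omega>. (x \<bullet> b + c) * ?D x) = - (LINT x|lebesgue_on \<Omega>. (b \<bullet> i) * \<phi> x)" .
qed

text \<open>A lower bound of all Rayleigh quotients bounds their infimum only if there are any, since the infimum of the
  empty set of reals is unspecified.  An affine function with mean zero provides one.\<close>

lemma rayleigh_quotients_nonempty:
  fixes \<Omega> :: "'a::euclidean_space set"
  assumes O: "open \<Omega>" "bounded \<Omega>" and ne: "\<Omega> \<noteq> {}"
  shows "rayleigh_quotients \<Omega> \<noteq> {}"
proof -
  obtain b :: 'a where b: "b \<in> Basis" using nonempty_Basis by blast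
  have [measurable]: "\<Omega> \<in> sets borel" using O by simp
  have fin: "emeasure lborel \<Omega> < \<infinity>" using O(2) by (rule emeasure_bounded_finite)
  have nn: "\<not> negligible \<Omega>" using open_not_negligible[OF O(1) ne] .
  have "measure lborel \<Omega> \<noteq> 0"
  proof
    assume "measure lborel \<Omega> = 0"
    then have "emeasure lborel \<Omega> = 0" using fin by (simp add: emeasure_eq_ennreal_measure)
    then have "\<Omega> \<in> null_sets lborel" by (auto simp: null_sets_def)
    then show False using nn by (simp add: negligible_iff_null_sets null_sets_completionI)
  qed
  then have m: "0 < measure lborel \<Omega>" by (simp add: zero_less_measure_iff)
  define c where "c = - (LINT x|lborel. indicator \<Omega> x *\<^sub>R (x \<bullet> b)) / measure lborel \<Omega>"
  define u where "u x = x \<bullet> b + c" for x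
  have wg: "weak_gradient \<Omega> u (\<lambda>x. b)" unfolding u_def[abs_def] by (rule weak_gradient_affine[OF O])
  have "(LINT x|lebesgue_on \<Omega>. u x) = (LINT x|lborel. indicator \<Omega> x *\<^sub>R u x)"
    unfolding u_def by (rule continuous_lebesgue_on(3)[OF O]) (intro continuous_intros)
  also have "\<dots> = (LINT x|lborel. indicator \<Omega> x *\<^sub>R (x \<bullet> b) + c * indicator \<Omega> x)"
    by (intro Bochner_Integration.integral_cong refl) (simp add: u_def algebra_simps)
  also have "\<dots> = (LINT x|lborel. indicator \<Omega> x *\<^sub>R (x \<bullet> b)) + (LINT x|lborel. c * indicator \<Omega> x)"
  proof (rule Bochner_Integration.integral_add)
    show "integrable lborel (\<lambda>x. indicator \<Omega> x *\<^sub>R (x \<bullet> b))"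
      by (rule continuous_lebesgue_on(4)[OF O]) (intro continuous_intros)
    show "integrable lborel (\<lambda>x. c * indicator \<Omega> x)"
      using fin by (intro integrable_mult_right integrable_real_indicator) auto
  qed
  also have "\<dots> = 0" using m by (simp add: c_def)
  finally have mean: "(LINT x|lebesgue_on \<Omega>. u x) = 0" .
  have "\<not> (AE x in lebesgue_on \<Omega>. u x = 0)"
  proof
    assume "AE x in lebesgue_on \<Omega>. u x = 0"
    then have 1: "AE x in lebesgue. x \<in> \<Omega> \<longrightarrow> u x = 0" using O by (simp add: AE_restrict_space_iff)
    have "negligible {x. b \<bullet> x = - c}" using b by (intro negligible_hyperplane) auto
    then have "{x. b \<bullet> x = - c} \<in> null_sets lebesgue" by (simp add: negligible_iff_null_sets)
    then have "AE x in lebesgue. x \<notin> {x. b \<bullet> x = - c}" by (rule AE_not_in)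
    with 1 have "AE x in lebesgue. x \<notin> \<Omega>"
      by eventually_elim (auto simp: u_def inner_commute)
    then have "\<Omega> \<in> null_sets lebesgue" using O by (simp add: AE_iff_null_sets)
    then show False using nn by (simp add: negligible_iff_null_sets)
  qed
  with wg mean show ?thesis unfolding rayleigh_quotients_def by blast
qed

text \<open>The bound is first obtained with \<open>s < j01\<close> in place of \<open>j01\<close>; then \<open>s\<close> tends to \<open>j01\<close> from the left.\<close>

lemma neumann_mu1_rhombus:
  assumes e: "0 < e" "e \<le> 1" "8 * j01\<^sup>2 * e\<^sup>2 \<le> 1"
  shows "j01\<^sup>2 / (1 + 2 * e\<^sup>2) \<le> neumann_mu1 (rhombus e)"
proof -
  let ?R = "rhombus e"
  have O: "open ?R" "bounded ?R" using e by (auto intro: open_rhombus bounded_rhombus)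
  have ne: "?R \<noteq> {}" 
  proof -
    have "0 \<in> ?R" by (simp add: rhombus_def)
    then show ?thesis by blast
  qed
  have lower: "s\<^sup>2 / (1 + 2 * e\<^sup>2) \<le> neumann_mu1 ?R" if s: "0 < s" "s < j01" for s
    unfolding neumann_mu1_def
  proof (rule cInf_greatest[OF rayleigh_quotients_nonempty[OF O ne]])
    fix q assume "q \<in> rayleigh_quotients ?R"
    then obtain u g where wg: "weak_gradient ?R u g" and nz: "\<not> (AE x in lebesgue_on ?R. u x = 0)"
      and mean: "(LINT x|lebesgue_on ?R. u x) = 0"
      and q: "q = (LINT x|lebesgue_on ?R. (norm (g x))\<^sup>2) / (LINT x|lebesgue_on ?R. (u x)\<^sup>2)"
      unfolding rayleigh_quotients_def by blast
    have iu: "integrable (lebesgue_on ?R) (\<lambda>x. (u x)\<^sup>2)"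
      using wg by (auto simp: weak_gradient_def L2_on_def)
    have "0 \<le> (LINT x|lebesgue_on ?R. (u x)\<^sup>2)" by (intro integral_nonneg_AE) auto
    moreover have "(LINT x|lebesgue_on ?R. (u x)\<^sup>2) \<noteq> 0"
      using nz integral_nonneg_eq_0_iff_AE[OF iu] by simp
    ultimately have pos: "0 < (LINT x|lebesgue_on ?R. (u x)\<^sup>2)" by linarith
    obtain v G where vG: "borel_weak_gradient ?R v G"
      "AE x in lebesgue_on ?R. u x = v x"
      "(LINT x|lebesgue_on ?R. u x) = (LINT x|lborel. v x)"
      "(LINT x|lebesgue_on ?R. (u x)\<^sup>2) = (LINT x|lborel. (v x)\<^sup>2)"
      "(LINT x|lebesgue_on ?R. (norm (g x))\<^sup>2) = (LINT x|lborel. (norm (G x))\<^sup>2)"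
      by (rule weak_gradient_borel[OF O(1) wg])
    have "s\<^sup>2 \<le> j01\<^sup>2" using s by (intro power_mono) auto
    then have "8 * s\<^sup>2 * e\<^sup>2 \<le> 8 * j01\<^sup>2 * e\<^sup>2" by (intro mult_right_mono mult_left_mono) auto
    then have se: "8 * s\<^sup>2 * e\<^sup>2 \<le> 1" using e(3) by linarith
    have "(LINT x|lborel. v x) = 0" using mean vG(3) by simp
    from rhombus_Poincare[OF e(1,2) s se vG(1) this]
    have "s\<^sup>2 * (LINT x|lebesgue_on ?R. (u x)\<^sup>2) \<le> (1 + 2 * e\<^sup>2) * (LINT x|lebesgue_on ?R. (norm (g x))\<^sup>2)"
      by (simp only: vG(4,5))
    moreover have "0 < 1 + 2 * e\<^sup>2" by (simp add: add_pos_nonneg)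
    ultimately show "s\<^sup>2 / (1 + 2 * e\<^sup>2) \<le> q" using pos unfolding q
      by (simp add: pos_divide_le_eq pos_le_divide_eq mult.commute)
  qed
  have "((\<lambda>s. s\<^sup>2 / (1 + 2 * e\<^sup>2)) \<longlongrightarrow> j01\<^sup>2 / (1 + 2 * e\<^sup>2)) (at_left j01)"
    by (intro tendsto_intros) (simp add: add_pos_nonneg less_imp_neq[symmetric])
  moreover have "\<forall>\<^sub>F s in at_left j01. s\<^sup>2 / (1 + 2 * e\<^sup>2) \<le> neumann_mu1 ?R"
    using eventually_at_left_real[OF j01_pos] by eventually_elim (auto intro: lower)
  ultimately show ?thesis by (rule tendsto_upperbound) simp
qed

theorem theorem1p2:
  fixes \<alpha> C :: real
  assumes "0 < \<alpha>" and "\<alpha> < 2" and "0 < C"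
  shows "\<exists>\<Omega> :: (real^2) set. \<Omega> \<noteq> {} \<and> open \<Omega> \<and> bounded \<Omega> \<and> convex \<Omega> \<and>
    neumann_mu1 \<Omega> >
      4 * j01\<^sup>2 / (diameter \<Omega>)\<^sup>2
        - C * (john_a2 \<Omega> powr \<alpha> / diameter \<Omega> powr (2 + \<alpha>))"
proof -
  \<comment> \<open>With this \<open>c\<close> the correction term of the claim is \<open>c e\<^sup>\<alpha>\<close>.\<close>
  define c where "c = C / (sqrt 2 powr \<alpha> * 2 powr (2 + \<alpha>))"
  define d where "d = c / (4 * j01\<^sup>2)"
  have c: "0 < c" using assms by (simp add: c_def)
  have j: "0 < j01" by (rule j01_pos)
  have d: "0 < d" using c j by (simp add: d_def)
  \<comment> \<open>The first bound gives \<open>e \<le> 1\<close> and \<open>8 j01\<^sup>2 e\<^sup>2 \<le> 1\<close>; the second one gives \<open>e\<^sup>2 \<le> d e\<^sup>\<alpha>\<close>,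
    so that the loss \<open>2 j01\<^sup>2 e\<^sup>2\<close> is at most \<open>c e\<^sup>\<alpha> / 2\<close>.\<close>
  define e where "e = min (1 / (1 + 3 * j01)) (d powr (1 / (2 - \<alpha>)))"
  have e: "0 < e" "e \<le> 1 / (1 + 3 * j01)" "e \<le> d powr (1 / (2 - \<alpha>))"
    using j d by (auto simp: e_def)
  have "1 / (1 + 3 * j01) \<le> 1" using j by simp
  then have e1: "e \<le> 1" using e(2) by simp
  have "e * (1 + 3 * j01) \<le> 1" using e(2) j by (simp add: pos_le_divide_eq)
  then have "3 * (j01 * e) \<le> 1" using e(1) by (simp add: algebra_simps)
  then have "(3 * (j01 * e))\<^sup>2 \<le> 1" using e(1) j by (intro power_le_one) auto
  then have je: "8 * j01\<^sup>2 * e\<^sup>2 \<le> 1"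
    using zero_le_power2[of "j01 * e"] by (simp add: power_mult_distrib)
  have "e powr (2 - \<alpha>) \<le> (d powr (1 / (2 - \<alpha>))) powr (2 - \<alpha>)"
    using e assms by (intro powr_mono2) auto
  also have "\<dots> = d" using d assms by (simp add: powr_powr)
  finally have ed: "e powr (2 - \<alpha>) \<le> d" .
  have "e\<^sup>2 = e powr (2 - \<alpha>) * e powr \<alpha>" using e(1) by (simp add: powr_add[symmetric])
  also have "\<dots> \<le> d * e powr \<alpha>" using ed by (rule mult_right_mono) simp
  finally have "2 * j01\<^sup>2 * e\<^sup>2 \<le> 2 * j01\<^sup>2 * (d * e powr \<alpha>)" by (rule mult_left_mono) simp
  also have "\<dots> = c / 2 * e powr \<alpha>" using j by (simp add: d_def)
  also have "\<dots> < c * e powr \<alpha>" using c e(1) by simp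
  finally have small: "2 * j01\<^sup>2 * e\<^sup>2 < c * e powr \<alpha>" .
  have pos: "0 < 1 + 2 * e\<^sup>2" by (simp add: add_pos_nonneg)
  have "(j01\<^sup>2 - 2 * j01\<^sup>2 * e\<^sup>2) * (1 + 2 * e\<^sup>2) = j01\<^sup>2 - 4 * (j01\<^sup>2 * (e\<^sup>2 * e\<^sup>2))"
    by (simp add: algebra_simps)
  also have "\<dots> \<le> j01\<^sup>2" by simp
  finally have "j01\<^sup>2 - 2 * j01\<^sup>2 * e\<^sup>2 \<le> j01\<^sup>2 / (1 + 2 * e\<^sup>2)" using pos by (simp add: pos_le_divide_eq)
  also have "\<dots> \<le> neumann_mu1 (rhombus e)" by (rule neumann_mu1_rhombus[OF e(1) e1 je])
  finally have mu: "j01\<^sup>2 - c * e powr \<alpha> < neumann_mu1 (rhombus e)" using small by linarith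
  have "C * (john_a2 (rhombus e) powr \<alpha> / diameter (rhombus e) powr (2 + \<alpha>)) = c * e powr \<alpha>"
    using e(1) by (simp add: john_a2_rhombus[OF e(1) e1] diameter_rhombus[OF e(1) e1] c_def powr_divide)
  then have "4 * j01\<^sup>2 / (diameter (rhombus e))\<^sup>2
      - C * (john_a2 (rhombus e) powr \<alpha> / diameter (rhombus e) powr (2 + \<alpha>)) = j01\<^sup>2 - c * e powr \<alpha>"
    by (simp add: diameter_rhombus[OF e(1) e1])
  then have "4 * j01\<^sup>2 / (diameter (rhombus e))\<^sup>2
      - C * (john_a2 (rhombus e) powr \<alpha> / diameter (rhombus e) powr (2 + \<alpha>)) < neumann_mu1 (rhombus e)"
    using mu by simp
  moreover have "0 \<in> rhombus e" by (simp add: rhombus_def)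
  ultimately show ?thesis
    using open_rhombus[OF e(1)] bounded_rhombus[OF e(1) e1] convex_rhombus[OF e(1)] by blast
qed

end
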